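(* The generic transcendental lattice of a $D_{1,6}$-polarised Enriques surface $S$, in the Hodge structure $H^2(S,\mathbb Z_-)$ — that is, the orthogonal complement in $H^2(S,\mathbb Z_-)$ of the distinguished $D_6(-1)$ sublattice, which is $H^{1,1}(S,\mathbb Z_-)$ for generic $S$ — is isomorphic to the lattice $\mathbb Z^2(2)\oplus\mathbb Z^4(-1)$.
   Context: For a lattice $M$, $M(n)$ is $M$ with form multiplied by $n$; $\mathbb Z^n$ is the standard Euclidean lattice, $\mathbb Z^{p,q}$ the standard odd unimodular lattice of signature $(p,q)$, $D_{p,q}\subset\mathbb Z^{p,q}$ the sublattice of vectors with even coordinate sum, $D_6=D_{6,0}$. Let $(e_0;e_1,\dots,e_6)$ be the canonical basis of $\mathbb Z^{1,6}$. A $D_{1,6}$-polarised Enriques surface is a (complex, smooth) Enriques surface whose Picard group contains a primitively embedded copy of $D_{1,6}$ such that the six vectors $e_1\pm e_2,e_3\pm e_4,e_5\pm e_6$ correspond to six smooth rational curves $R_i$, and $2e_0$ to a nef class $H$ with $H^2=4$. Equivalently the disjoint curves $R_i$ contain three even sets (subsets whose sum is divisible by $2$ in the Picard group) and $H+\sum R_i$ is divisible by two. $\mathbb Z_-$ is the unique nontrivial rank one local system of integers on $S$; $H^2(S,\mathbb Z_-)$ with cup product is an odd unimodular lattice of signature $(2,10)$ carrying a polarised Hodge structure. The curves $R_i$, with orientations of $\mathbb Z_-|_{R_i}$, define classes in $H^2(S,\mathbb Z_-)$ of square $-2$, and their primitive saturation is the distinguished sublattice isometric to $D_6(-1)$.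 *)

theory Defs
  imports "HOL-Analysis.Analysis" "HOL-Homology.Homology"
begin

section \<open>Lattices\<close>

text \<open>As in HOL-Algebra and HOL-Homology, the additive group of a lattice is a \<open>monoid\<close> record
  written multiplicatively: \<open>x \<otimes> y\<close> is the sum and \<open>x [^] m\<close> the multiple \<open>m x\<close>.\<close>

record 'a zlattice = "'a monoid" +
  bform :: "'a \<Rightarrow> 'a \<Rightarrow> int"

definition lattice_basis :: "'a zlattice \<Rightarrow> nat \<Rightarrow> (nat \<Rightarrow> 'a) \<Rightarrow> bool" where
  "lattice_basis L n b \<longleftrightarrow> b \<in> {..<n} \<rightarrow> carrier L \<and>
     bij_betw (\<lambda>c. finprod L (\<lambda>i. b i [^]\<^bsub>L\<^esub> (c i :: int)) {..<n}) ({..<n} \<rightarrow>\<^sub>E UNIV) (carrier L)"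

definition is_lattice :: "'a zlattice \<Rightarrow> bool" where
  "is_lattice L \<longleftrightarrow> comm_group L \<and> (\<exists>n b. lattice_basis L n b) \<and>
     (\<forall>x\<in>carrier L. \<forall>y\<in>carrier L. bform L x y = bform L y x) \<and>
     (\<forall>x\<in>carrier L. \<forall>y\<in>carrier L. \<forall>z\<in>carrier L.
        bform L (x \<otimes>\<^bsub>L\<^esub> y) z = bform L x z + bform L y z)"

text \<open>The adjoint map to the dual lattice is bijective.\<close>

definition unimodular :: "'a zlattice \<Rightarrow> bool" where
  "unimodular L \<longleftrightarrow>
     (\<forall>f\<in>hom L integer_group. \<exists>!x. x \<in> carrier L \<and> (\<forall>y\<in>carrier L. f y = bform L x y))"

definition odd_lattice :: "'a zlattice \<Rightarrow> bool" where
  "odd_lattice L \<longleftrightarrow> (\<exists>x\<in>carrier L. odd (bform L x x))"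

text \<open>An orthogonal basis of \<open>L \<otimes> \<rat>\<close>, with denominators cleared so that it lies in \<open>L\<close>.\<close>

definition has_signature :: "'a zlattice \<Rightarrow> nat \<Rightarrow> nat \<Rightarrow> bool" where
  "has_signature L p q \<longleftrightarrow> (\<exists>b. b \<in> {..<p+q} \<rightarrow> carrier L \<and>
     (\<forall>i<p+q. \<forall>j<p+q. i \<noteq> j \<longrightarrow> bform L (b i) (b j) = 0) \<and>
     (\<forall>i<p. bform L (b i) (b i) > 0) \<and>
     (\<forall>i. p \<le> i \<and> i < p+q \<longrightarrow> bform L (b i) (b i) < 0) \<and>
     (\<forall>x\<in>carrier L. \<exists>m::int. m \<noteq> 0 \<and> x [^]\<^bsub>L\<^esub> m \<in> generate L (b ` {..<p+q})))"

definition isometric :: "'a zlattice \<Rightarrow> 'b zlattice \<Rightarrow> bool" where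
  "isometric L M \<longleftrightarrow> (\<exists>h\<in>iso L M.
     \<forall>x\<in>carrier L. \<forall>y\<in>carrier L. bform M (h x) (h y) = bform L x y)"

definition sublattice_on :: "'a zlattice \<Rightarrow> 'a set \<Rightarrow> 'a zlattice" where
  "sublattice_on L A = L\<lparr>carrier := A\<rparr>"

definition orth_compl :: "'a zlattice \<Rightarrow> 'a set \<Rightarrow> 'a set" where
  "orth_compl L A = {x \<in> carrier L. \<forall>y\<in>A. bform L x y = 0}"

definition saturation :: "'a zlattice \<Rightarrow> 'a set \<Rightarrow> 'a set" where
  "saturation L A = {x \<in> carrier L. \<exists>m::int. m \<noteq> 0 \<and> x [^]\<^bsub>L\<^esub> m \<in> generate L A}"

definition rescale :: "int \<Rightarrow> 'a zlattice \<Rightarrow> 'a zlattice" where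
  "rescale n L = L\<lparr>bform := \<lambda>x y. n * bform L x y\<rparr>"

definition direct_sum :: "'a zlattice \<Rightarrow> 'b zlattice \<Rightarrow> ('a \<times> 'b) zlattice" where
  "direct_sum L M = \<lparr>carrier = carrier L \<times> carrier M,
     monoid.mult = (\<lambda>(x, x') (y, y'). (x \<otimes>\<^bsub>L\<^esub> y, x' \<otimes>\<^bsub>M\<^esub> y')),
     one = (\<one>\<^bsub>L\<^esub>, \<one>\<^bsub>M\<^esub>),
     bform = (\<lambda>(x, x') (y, y'). bform L x y + bform M x' y')\<rparr>"

text \<open>Vectors are integer sequences supported on the first \<open>p + q\<close> coordinates, of which the first
  \<open>p\<close> have positive square.\<close>

definition Z_lattice :: "nat \<Rightarrow> nat \<Rightarrow> (nat \<Rightarrow> int) zlattice" where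
  "Z_lattice p q = \<lparr>carrier = {x. \<forall>i\<ge>p+q. x i = 0},
     monoid.mult = (\<lambda>x y i. x i + y i), one = (\<lambda>i. 0),
     bform = (\<lambda>x y. (\<Sum>i<p. x i * y i) - (\<Sum>i=p..<p+q. x i * y i))\<rparr>"

definition D_lattice :: "nat \<Rightarrow> nat \<Rightarrow> (nat \<Rightarrow> int) zlattice" where
  "D_lattice p q = sublattice_on (Z_lattice p q)
     {x \<in> carrier (Z_lattice p q). even (\<Sum>i<p+q. x i)}"

definition unit_vec :: "nat \<Rightarrow> nat \<Rightarrow> int" where
  "unit_vec i = (\<lambda>j. if j = i then 1 else 0)"


section \<open>Complex manifolds\<close>

text \<open>The atlas need not be maximal. A chart is a pair of its domain and its coordinate map.\<close>

type_synonym ('a, 'n) chart = "'a set \<times> ('a \<Rightarrow> complex^'n)"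

record ('a, 'n) complex_space =
  top_of :: "'a topology"
  atlas :: "('a, 'n) chart set"

definition holo_on :: "(complex^'m \<Rightarrow> complex^'k) \<Rightarrow> (complex^'m) set \<Rightarrow> bool" where
  "holo_on F V \<longleftrightarrow> (\<forall>z\<in>V. \<exists>J. (F has_derivative (\<lambda>v. J *v v)) (at z))"

definition cjac :: "(complex^'m \<Rightarrow> complex^'k) \<Rightarrow> complex^'m \<Rightarrow> complex^'m^'k" where
  "cjac F z = (SOME J. (F has_derivative (\<lambda>v. J *v v)) (at z))"

definition complex_manifold :: "('a, 'n::finite) complex_space \<Rightarrow> bool" where
  "complex_manifold M \<longleftrightarrow> Hausdorff_space (top_of M) \<and>
     \<Union>(fst ` atlas M) = topspace (top_of M) \<and>
     (\<forall>(U, \<psi>)\<in>atlas M. openin (top_of M) U \<and> open (\<psi> ` U) \<and>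
        homeomorphic_map (subtopology (top_of M) U) (top_of_set (\<psi> ` U)) \<psi>) \<and>
     (\<forall>(U, \<psi>)\<in>atlas M. \<forall>(V, \<phi>)\<in>atlas M. holo_on (\<phi> \<circ> inv_into U \<psi>) (\<psi> ` (U \<inter> V)))"

definition compact_complex_manifold :: "('a, 'n::finite) complex_space \<Rightarrow> bool" where
  "compact_complex_manifold M \<longleftrightarrow> complex_manifold M \<and> topspace (top_of M) \<noteq> {} \<and>
     compact_space (top_of M) \<and> connected_space (top_of M)"

definition holo_map :: "('a, 'm::finite) complex_space \<Rightarrow> ('b, 'k::finite) complex_space \<Rightarrow> ('a \<Rightarrow> 'b) \<Rightarrow> bool" where
  "holo_map M N F \<longleftrightarrow> continuous_map (top_of M) (top_of N) F \<and>
     (\<forall>(U, \<psi>)\<in>atlas M. \<forall>(V, \<phi>)\<in>atlas N.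
        holo_on (\<phi> \<circ> F \<circ> inv_into U \<psi>) (\<psi> ` (U \<inter> F -` V)))"

definition immersion :: "('a, 'm::finite) complex_space \<Rightarrow> ('b, 'k::finite) complex_space \<Rightarrow> ('a \<Rightarrow> 'b) \<Rightarrow> bool" where
  "immersion M N F \<longleftrightarrow> (\<forall>(U, \<psi>)\<in>atlas M. \<forall>(V, \<phi>)\<in>atlas N. \<forall>x\<in>U \<inter> F -` V.
     inj ((*v) (cjac (\<phi> \<circ> F \<circ> inv_into U \<psi>) (\<psi> x))))"

definition holo_embedding ::
  "('a, 'm::finite) complex_space \<Rightarrow> ('b, 'k::finite) complex_space \<Rightarrow> ('a \<Rightarrow> 'b) \<Rightarrow> bool" where
  "holo_embedding M N F \<longleftrightarrow> holo_map M N F \<and> inj_on F (topspace (top_of M)) \<and> immersion M N F"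

definition proj_line :: "(complex option, 1) complex_space" where
  "proj_line = \<lparr>top_of = Alexandroff_compactification euclidean,
     atlas = {(range Some, \<lambda>x. \<chi> i. the x),
              (- {Some 0}, \<lambda>x. \<chi> i. case x of None \<Rightarrow> 0 | Some z \<Rightarrow> inverse z)}\<rparr>"

definition smooth_rational_curve :: "('a, 'n::finite) complex_space \<Rightarrow> 'a set \<Rightarrow> bool" where
  "smooth_rational_curve M R \<longleftrightarrow>
     (\<exists>f. holo_embedding proj_line M f \<and> R = f ` topspace (top_of proj_line))"

text \<open>The vertices of \<open>corner q r m\<close> are \<open>q, q + r u\<^sub>0, q + \<i> r u\<^sub>0, q + r u\<^sub>1, q + \<i> r u\<^sub>1, \<dots>\<close> with
  \<open>u\<close> the standard basis listed according to \<open>m\<close>: it is positively oriented for the complex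
  orientation, which does not depend on the order of the \<open>u\<^sub>k\<close>.\<close>

definition corner :: "complex^'n \<Rightarrow> real \<Rightarrow> ('n \<Rightarrow> nat) \<Rightarrow> (nat \<Rightarrow> real) \<Rightarrow> complex^'n" where
  "corner q r m t = q + (\<chi> k. of_real r * Complex (t (2 * m k + 1)) (t (2 * m k + 2)))"

definition positive_local_simplex ::
  "('a, 'n::finite) complex_space \<Rightarrow> 'a \<Rightarrow> ((nat \<Rightarrow> real) \<Rightarrow> 'a) \<Rightarrow> bool" where
  "positive_local_simplex M x s \<longleftrightarrow> (\<exists>(U, \<psi>)\<in>atlas M. \<exists>q r m. x \<in> U \<and> 0 < r \<and>
     bij_betw m (UNIV :: 'n set) {..<CARD('n)} \<and>
     corner q r m ` standard_simplex (2 * CARD('n)) \<subseteq> \<psi> ` U \<and>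
     \<psi> x \<in> corner q r m ` {t \<in> standard_simplex (2 * CARD('n)). \<forall>i\<le>2 * CARD('n). 0 < t i} \<and>
     s = restrict (inv_into U \<psi> \<circ> corner q r m) (standard_simplex (2 * CARD('n))))"

text \<open>Cycles representing the fundamental class for the complex orientation: they restrict to the
  local orientation class in \<open>H\<^sub>2\<^sub>n(M, M - x)\<close> at each point.\<close>

definition fundamental_cycle :: "('a, 'n::finite) complex_space \<Rightarrow> 'a chain \<Rightarrow> bool" where
  "fundamental_cycle M c \<longleftrightarrow> singular_relcycle (2 * CARD('n)) (top_of M) {} c \<and>
     (\<forall>x\<in>topspace (top_of M). \<forall>s. positive_local_simplex M x s \<longrightarrow>
        homologous_rel (2 * CARD('n)) (top_of M) (topspace (top_of M) - {x}) c (frag_of s))"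

definition holo_fun :: "('a, 'n::finite) complex_space \<Rightarrow> 'a set \<Rightarrow> ('a \<Rightarrow> complex) \<Rightarrow> bool" where
  "holo_fun M W f \<longleftrightarrow> (\<forall>(U, \<psi>)\<in>atlas M.
     holo_on (\<lambda>v. (\<chi> i. f (inv_into U \<psi> v)) :: complex^1) (\<psi> ` (U \<inter> W)))"

definition chart_gradient :: "('a, 'n::finite) chart \<Rightarrow> ('a \<Rightarrow> complex) \<Rightarrow> 'a \<Rightarrow> complex^'n" where
  "chart_gradient \<kappa> f x =
     cjac (\<lambda>v. (\<chi> i. f (inv_into (fst \<kappa>) (snd \<kappa>) v)) :: complex^1) (snd \<kappa> x) $ 1"

text \<open>A 2-form on a surface is given by its coefficients: on the chart \<open>\<kappa>\<close> with coordinates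
  \<open>z\<^sub>1, z\<^sub>2\<close> it is \<open>w \<kappa> dz\<^sub>1 \<and> dz\<^sub>2\<close>.\<close>

type_synonym 'a two_form = "('a, 2) chart \<Rightarrow> 'a \<Rightarrow> complex"

definition holo_two_form :: "('a, 2) complex_space \<Rightarrow> 'a two_form \<Rightarrow> bool" where
  "holo_two_form M w \<longleftrightarrow>
     (\<forall>\<kappa>\<in>atlas M. holo_fun M (fst \<kappa>) (w \<kappa>)) \<and>
     (\<forall>(U, \<psi>)\<in>atlas M. \<forall>(V, \<phi>)\<in>atlas M. \<forall>x\<in>U \<inter> V.
        w (U, \<psi>) x = w (V, \<phi>) x * det (cjac (\<phi> \<circ> inv_into U \<psi>) (\<psi> x)))"

definition simply_connected_top :: "'a topology \<Rightarrow> bool" where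
  "simply_connected_top X \<longleftrightarrow> path_connected_space X \<and>
     (\<forall>f. continuous_map (nsphere 1) X f \<longrightarrow>
        (\<exists>c\<in>topspace X. homotopic_with (\<lambda>_. True) (nsphere 1) X f (\<lambda>_. c)))"

definition K3_surface :: "('a, 2) complex_space \<Rightarrow> bool" where
  "K3_surface X \<longleftrightarrow> compact_complex_manifold X \<and> simply_connected_top (top_of X) \<and>
     (\<exists>w. holo_two_form X w \<and> (\<forall>\<kappa>\<in>atlas X. \<forall>x\<in>fst \<kappa>. w \<kappa> x \<noteq> 0))"

text \<open>Enriques surfaces are the quotients of K3 surfaces by fixed point free holomorphic involutions.
  Here \<open>p : X \<rightarrow> S\<close> is the universal cover and \<open>\<sigma>\<close> its deck involution.\<close>

definition Enriques_cover ::
  "('a, 2) complex_space \<Rightarrow> ('a \<Rightarrow> 'a) \<Rightarrow> ('a \<Rightarrow> 'b) \<Rightarrow> ('b, 2) complex_space \<Rightarrow> bool" where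
  "Enriques_cover X \<sigma> p S \<longleftrightarrow> K3_surface X \<and> compact_complex_manifold S \<and>
     holo_map X X \<sigma> \<and> (\<forall>x\<in>topspace (top_of X). \<sigma> x \<noteq> x \<and> \<sigma> (\<sigma> x) = x) \<and>
     holo_map X S p \<and> immersion X S p \<and> p ` topspace (top_of X) = topspace (top_of S) \<and>
     (\<forall>x\<in>topspace (top_of X). \<forall>y\<in>topspace (top_of X). p x = p y \<longleftrightarrow> y = x \<or> y = \<sigma> x)"


section \<open>The Picard group\<close>

text \<open>A line bundle is given by a trivialising cover \<open>U\<close> indexed by the points of the manifold
  (\<open>U x\<close> a neighbourhood of \<open>x\<close>) and transition functions \<open>g x y\<close> on \<open>U x \<inter> U y\<close>. A section is a
  family \<open>s x\<close> of functions on \<open>U x\<close> with \<open>s x = g x y \<cdot> s y\<close>.\<close>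

type_synonym 'a bundle_data = "('a \<Rightarrow> 'a set) \<times> ('a \<Rightarrow> 'a \<Rightarrow> 'a \<Rightarrow> complex)"

definition holo_unit :: "('a, 'n::finite) complex_space \<Rightarrow> 'a set \<Rightarrow> ('a \<Rightarrow> complex) \<Rightarrow> bool" where
  "holo_unit M W f \<longleftrightarrow> holo_fun M W f \<and> (\<forall>z\<in>W. f z \<noteq> 0)"

definition line_bundle :: "('a, 'n::finite) complex_space \<Rightarrow> 'a bundle_data \<Rightarrow> bool" where
  "line_bundle M = (\<lambda>(U, g). let T = topspace (top_of M) in
     (\<forall>x\<in>T. openin (top_of M) (U x) \<and> x \<in> U x) \<and>
     (\<forall>x\<in>T. \<forall>y\<in>T. holo_unit M (U x \<inter> U y) (g x y)) \<and>
     (\<forall>x\<in>T. \<forall>y\<in>T. \<forall>z\<in>T. \<forall>u\<in>U x \<inter> U y \<inter> U z. g x y u * g y z u = g x z u))"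

definition bundle_iso :: "('a, 'n::finite) complex_space \<Rightarrow> 'a bundle_data \<Rightarrow> 'a bundle_data \<Rightarrow> bool" where
  "bundle_iso M = (\<lambda>(U, g) (V, h). let T = topspace (top_of M) in
     \<exists>k. (\<forall>x\<in>T. \<forall>y\<in>T. holo_unit M (U x \<inter> V y) (k x y)) \<and>
       (\<forall>x\<in>T. \<forall>x'\<in>T. \<forall>y\<in>T. \<forall>y'\<in>T. \<forall>u\<in>U x \<inter> U x' \<inter> V y \<inter> V y'.
          k x' y' u * g x' x u = h y' y u * k x y u))"

definition bundle_tensor :: "'a bundle_data \<Rightarrow> 'a bundle_data \<Rightarrow> 'a bundle_data" where
  "bundle_tensor = (\<lambda>(U, g) (V, h). (\<lambda>x. U x \<inter> V x, \<lambda>x y u. g x y u * h x y u))"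

definition trivial_bundle :: "('a, 'n::finite) complex_space \<Rightarrow> 'a bundle_data" where
  "trivial_bundle M = (\<lambda>x. topspace (top_of M), \<lambda>x y u. 1)"

definition bundle_class :: "('a, 'n::finite) complex_space \<Rightarrow> 'a bundle_data \<Rightarrow> 'a bundle_data set" where
  "bundle_class M L = {N. line_bundle M N \<and> bundle_iso M N L}"

definition pic_group :: "('a, 'n::finite) complex_space \<Rightarrow> 'a bundle_data set monoid" where
  "pic_group M = \<lparr>carrier = bundle_class M ` Collect (line_bundle M),
     monoid.mult = (\<lambda>A B. {N. line_bundle M N \<and>
        (\<exists>L\<in>A. \<exists>K\<in>B. bundle_iso M N (bundle_tensor L K))}),
     one = bundle_class M (trivial_bundle M)\<rparr>"

definition holo_section ::
  "('a, 'n::finite) complex_space \<Rightarrow> 'a bundle_data \<Rightarrow> ('a \<Rightarrow> 'a \<Rightarrow> complex) \<Rightarrow> bool" where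
  "holo_section M = (\<lambda>(U, g) s. let T = topspace (top_of M) in
     (\<forall>x\<in>T. holo_fun M (U x) (s x)) \<and>
     (\<forall>x\<in>T. \<forall>y\<in>T. \<forall>u\<in>U x \<inter> U y. s x u = g x y u * s y u))"

definition zero_set :: "('a, 'n::finite) complex_space \<Rightarrow> ('a \<Rightarrow> 'a \<Rightarrow> complex) \<Rightarrow> 'a set" where
  "zero_set M s = {x \<in> topspace (top_of M). s x x = 0}"

definition simple_zeros :: "('a, 'n::finite) complex_space \<Rightarrow> ('a \<Rightarrow> 'a \<Rightarrow> complex) \<Rightarrow> bool" where
  "simple_zeros M s \<longleftrightarrow>
     (\<forall>x\<in>zero_set M s. \<forall>\<kappa>\<in>atlas M. x \<in> fst \<kappa> \<longrightarrow> chart_gradient \<kappa> (s x) x \<noteq> 0)"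

text \<open>The class of \<open>\<O>(R)\<close> for a smooth hypersurface \<open>R\<close>: the line bundles having a section that
  vanishes exactly on \<open>R\<close>, with multiplicity one.\<close>

definition divisor_class :: "('a, 'n::finite) complex_space \<Rightarrow> 'a set \<Rightarrow> 'a bundle_data set" where
  "divisor_class M R = {L. line_bundle M L \<and>
     (\<exists>s. holo_section M L s \<and> simple_zeros M s \<and> zero_set M s = R)}"

text \<open>On a projective surface the intersection form is the unique symmetric bilinear form on the
  Picard group for which smooth divisors meeting transversally have as intersection number the
  number of their common points (Hartshorne V.1.1).\<close>

definition is_intersection_form ::
  "('a, 2) complex_space \<Rightarrow> ('a bundle_data set \<Rightarrow> 'a bundle_data set \<Rightarrow> int) \<Rightarrow> bool" where
  "is_intersection_form M b \<longleftrightarrow> (let P = pic_group M in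
     (\<forall>x y. x \<notin> carrier P \<or> y \<notin> carrier P \<longrightarrow> b x y = 0) \<and>
     (\<forall>x\<in>carrier P. \<forall>y\<in>carrier P. b x y = b y x) \<and>
     (\<forall>x\<in>carrier P. \<forall>y\<in>carrier P. \<forall>z\<in>carrier P. b (x \<otimes>\<^bsub>P\<^esub> y) z = b x z + b y z) \<and>
     (\<forall>L K s t. line_bundle M L \<and> line_bundle M K \<and> holo_section M L s \<and> holo_section M K t \<and>
        simple_zeros M s \<and> simple_zeros M t \<and>
        (\<forall>x\<in>zero_set M s \<inter> zero_set M t. \<forall>\<kappa>\<in>atlas M. x \<in> fst \<kappa> \<longrightarrow>
           (let u = chart_gradient \<kappa> (s x) x; v = chart_gradient \<kappa> (t x) x
            in u $ 1 * v $ 2 - u $ 2 * v $ 1 \<noteq> 0))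
        \<longrightarrow> b (bundle_class M L) (bundle_class M K) = int (card (zero_set M s \<inter> zero_set M t))))"

text \<open>Not a lattice in the sense of \<open>is_lattice\<close>, since Picard groups may have torsion.\<close>

definition pic_lattice :: "('a, 2) complex_space \<Rightarrow> 'a bundle_data set zlattice" where
  "pic_lattice M = \<lparr>carrier = carrier (pic_group M), monoid.mult = monoid.mult (pic_group M),
     one = one (pic_group M), bform = (THE b. is_intersection_form M b)\<rparr>"

text \<open>Line bundles with a nonzero section are exactly those of effective divisors.\<close>

definition nef :: "('a, 2) complex_space \<Rightarrow> 'a bundle_data set \<Rightarrow> bool" where
  "nef M H \<longleftrightarrow> (\<forall>L s. line_bundle M L \<and> holo_section M L s \<and> zero_set M s \<noteq> topspace (top_of M)
     \<longrightarrow> bform (pic_lattice M) H (bundle_class M L) \<ge> 0)"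

text \<open>Since \<open>P\<close> may have torsion, primitive means that the quotient by \<open>A\<close> and the torsion of \<open>P\<close> is
  torsion free.\<close>

definition primitive_in :: "'a zlattice \<Rightarrow> 'a set \<Rightarrow> bool" where
  "primitive_in P A \<longleftrightarrow> (\<forall>x\<in>carrier P. \<forall>m::int. m \<noteq> 0 \<and> x [^]\<^bsub>P\<^esub> m \<in> A \<longrightarrow>
     (\<exists>y\<in>A. \<exists>k::int. k \<noteq> 0 \<and> (x \<otimes>\<^bsub>P\<^esub> inv\<^bsub>P\<^esub> y) [^]\<^bsub>P\<^esub> k = \<one>\<^bsub>P\<^esub>))"

text \<open>\<open>e\<^sub>1 + e\<^sub>2, e\<^sub>1 - e\<^sub>2, e\<^sub>3 + e\<^sub>4, e\<^sub>3 - e\<^sub>4, e\<^sub>5 + e\<^sub>6, e\<^sub>5 - e\<^sub>6\<close>, indexed by \<open>0, \<dots>, 5\<close>.\<close>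

definition root_vec :: "nat \<Rightarrow> nat \<Rightarrow> int" where
  "root_vec k = (\<lambda>j. let i = 2 * (k div 2) + 1 in
     if even k then unit_vec i j + unit_vec (i + 1) j else unit_vec i j - unit_vec (i + 1) j)"

text \<open>\<open>h\<close> is a \<open>D\<^sub>1\<^sub>,\<^sub>6\<close>-polarisation of \<open>S\<close> whose six rational curves are \<open>R 0, \<dots>, R 5\<close>.\<close>

definition D16_polarisation ::
  "('b, 2) complex_space \<Rightarrow> ((nat \<Rightarrow> int) \<Rightarrow> 'b bundle_data set) \<Rightarrow> (nat \<Rightarrow> 'b set) \<Rightarrow> bool" where
  "D16_polarisation S h R \<longleftrightarrow> (let D = D_lattice 1 6; P = pic_lattice S; H = h (\<lambda>j. 2 * unit_vec 0 j) in
     h \<in> hom D P \<and> inj_on h (carrier D) \<and>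
     (\<forall>x\<in>carrier D. \<forall>y\<in>carrier D. bform P (h x) (h y) = bform D x y) \<and>
     primitive_in P (h ` carrier D) \<and>
     (\<forall>k<6. smooth_rational_curve S (R k) \<and> h (root_vec k) = divisor_class S (R k)) \<and>
     nef S H \<and> bform P H H = 4)"


section \<open>Twisted cohomology\<close>

text \<open>Singular cochains with coefficients in a commutative ring are functions on singular simplices,
  extended by zero to all other functions.\<close>

type_synonym ('a, 'r) cochain = "((nat \<Rightarrow> real) \<Rightarrow> 'a) \<Rightarrow> 'r"

definition cochain_on :: "nat \<Rightarrow> 'a topology \<Rightarrow> ('a, 'r::comm_ring_1) cochain \<Rightarrow> bool" where
  "cochain_on n X \<phi> \<longleftrightarrow> (\<forall>s. \<not> singular_simplex n X s \<longrightarrow> \<phi> s = 0)"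

definition cochain_eval :: "('a, 'r::comm_ring_1) cochain \<Rightarrow> 'a chain \<Rightarrow> 'r" where
  "cochain_eval \<phi> c = (\<Sum>s\<in>Poly_Mapping.keys c. of_int (Poly_Mapping.lookup c s) * \<phi> s)"

definition coboundary ::
  "nat \<Rightarrow> 'a topology \<Rightarrow> ('a, 'r::comm_ring_1) cochain \<Rightarrow> ('a, 'r) cochain" where
  "coboundary n X \<phi> = (\<lambda>s. if singular_simplex (Suc n) X s
     then cochain_eval \<phi> (chain_boundary (Suc n) (frag_of s)) else 0)"

definition front_face :: "nat \<Rightarrow> ((nat \<Rightarrow> real) \<Rightarrow> 'a) \<Rightarrow> (nat \<Rightarrow> real) \<Rightarrow> 'a" where
  "front_face m s = restrict s (standard_simplex m)"

definition back_face :: "nat \<Rightarrow> nat \<Rightarrow> ((nat \<Rightarrow> real) \<Rightarrow> 'a) \<Rightarrow> (nat \<Rightarrow> real) \<Rightarrow> 'a" where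
  "back_face m n s =
     restrict (\<lambda>t. s (\<lambda>i. if i < m then 0 else t (i - m))) (standard_simplex n)"

definition cup :: "nat \<Rightarrow> nat \<Rightarrow> 'a topology \<Rightarrow>
    ('a, 'r::comm_ring_1) cochain \<Rightarrow> ('a, 'r) cochain \<Rightarrow> ('a, 'r) cochain" where
  "cup m n X \<phi> \<psi> = (\<lambda>s. if singular_simplex (m + n) X s
     then \<phi> (front_face m s) * \<psi> (back_face m n s) else 0)"

text \<open>Let \<open>X \<rightarrow> S\<close> be the double cover with deck involution \<open>\<sigma>\<close>. The local system \<open>\<int>\<^sub>-\<close> on \<open>S\<close> is the
  quotient of \<open>X \<times> \<int>\<close> by \<open>(x, n) \<mapsto> (\<sigma> x, -n)\<close>, so a cochain on \<open>S\<close> with coefficients in \<open>\<int>\<^sub>-\<close>, which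
  assigns to each singular simplex of \<open>S\<close> a section of the pullback of \<open>\<int>\<^sub>-\<close>, is a function on the
  lifted simplices that is odd under \<open>\<sigma>\<close>.\<close>

definition twisted_cochain :: "'a topology \<Rightarrow> ('a \<Rightarrow> 'a) \<Rightarrow> nat \<Rightarrow> ('a, int) cochain \<Rightarrow> bool" where
  "twisted_cochain X \<sigma> n \<phi> \<longleftrightarrow> cochain_on n X \<phi> \<and>
     (\<forall>s. singular_simplex n X s \<longrightarrow> \<phi> (simplex_map n \<sigma> s) = - \<phi> s)"

definition twisted_cocycle :: "'a topology \<Rightarrow> ('a \<Rightarrow> 'a) \<Rightarrow> nat \<Rightarrow> ('a, int) cochain \<Rightarrow> bool" where
  "twisted_cocycle X \<sigma> n \<phi> \<longleftrightarrow> twisted_cochain X \<sigma> n \<phi> \<and> coboundary n X \<phi> = (\<lambda>s. 0)"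

definition twisted_class2 ::
  "'a topology \<Rightarrow> ('a \<Rightarrow> 'a) \<Rightarrow> ('a, int) cochain \<Rightarrow> ('a, int) cochain set" where
  "twisted_class2 X \<sigma> \<phi> =
     {\<psi>. \<exists>\<eta>. twisted_cochain X \<sigma> 1 \<eta> \<and> \<psi> = (\<lambda>s. \<phi> s + coboundary 1 X \<eta> s)}"

text \<open>\<open>H\<^sup>2(S, \<int>\<^sub>-)\<close> with the cup product pairing to \<open>H\<^sup>4(S, \<int>) = \<int>\<close>. The product of two odd cochains is
  even, that is, a cochain on \<open>S\<close>, and the fundamental class of \<open>X\<close> maps to twice that of \<open>S\<close>.\<close>

definition twisted_H2 :: "('a, 2) complex_space \<Rightarrow> ('a \<Rightarrow> 'a) \<Rightarrow> ('a, int) cochain set zlattice" where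
  "twisted_H2 X \<sigma> = \<lparr>carrier = twisted_class2 (top_of X) \<sigma> ` Collect (twisted_cocycle (top_of X) \<sigma> 2),
     monoid.mult = (\<lambda>A B. {\<lambda>s. \<phi> s + \<psi> s | \<phi> \<psi>. \<phi> \<in> A \<and> \<psi> \<in> B}),
     one = twisted_class2 (top_of X) \<sigma> (\<lambda>s. 0),
     bform = (\<lambda>A B. THE n. \<forall>\<phi>\<in>A. \<forall>\<psi>\<in>B. \<forall>c. fundamental_cycle X c \<longrightarrow>
        cochain_eval (cup 2 2 (top_of X) \<phi> \<psi>) c = 2 * n)\<rparr>"

text \<open>Let \<open>g\<close> be a lift to \<open>X\<close> of an embedding of the projective line into \<open>S\<close>. The two lifts \<open>g\<close> and
  \<open>\<sigma> \<circ> g\<close> correspond to the two orientations of the restriction of \<open>\<int>\<^sub>-\<close> to the curve, and the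
  evaluation of \<open>\<int>\<^sub>-\<close>-valued classes on the oriented curve is evaluation on its lift. The class of
  the curve is the Poincare dual of this functional.\<close>

definition twisted_curve_class ::
  "('a, 2) complex_space \<Rightarrow> ('a \<Rightarrow> 'a) \<Rightarrow> (complex option \<Rightarrow> 'a) \<Rightarrow> ('a, int) cochain set" where
  "twisted_curve_class X \<sigma> g = (THE A. A \<in> carrier (twisted_H2 X \<sigma>) \<and>
     (\<forall>B\<in>carrier (twisted_H2 X \<sigma>). \<forall>\<psi>\<in>B. \<forall>c. fundamental_cycle proj_line c \<longrightarrow>
        bform (twisted_H2 X \<sigma>) A B = cochain_eval \<psi> (chain_map 2 g c)))"

definition distinguished_sublattice ::
  "('a, 2) complex_space \<Rightarrow> ('a \<Rightarrow> 'a) \<Rightarrow> (nat \<Rightarrow> complex option \<Rightarrow> 'a) \<Rightarrow> ('a, int) cochain set set" where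
  "distinguished_sublattice X \<sigma> g =
     saturation (twisted_H2 X \<sigma>) ((\<lambda>k. twisted_curve_class X \<sigma> (g k)) ` {..<6})"


section \<open>The Hodge structure\<close>

definition triangle :: "(real \<times> real) set" where
  "triangle = {(u, v). 0 \<le> u \<and> 0 \<le> v \<and> u + v \<le> 1}"

definition barycentric :: "real \<times> real \<Rightarrow> nat \<Rightarrow> real" where
  "barycentric = (\<lambda>(u, v) i. if i = 0 then 1 - u - v else if i = 1 then u else if i = 2 then v else 0)"

text \<open>Continuously differentiable up to the boundary of the triangle.\<close>

definition C1_simplex2 :: "('a, 'n::finite) complex_space \<Rightarrow> ((nat \<Rightarrow> real) \<Rightarrow> 'a) \<Rightarrow> bool" where
  "C1_simplex2 M s \<longleftrightarrow> singular_simplex 2 (top_of M) s \<and>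
     (\<forall>t\<in>triangle. \<exists>(U, \<psi>)\<in>atlas M. \<exists>N. \<exists>F. \<exists>D :: real \<times> real \<Rightarrow> (real \<times> real) \<Rightarrow>\<^sub>L (complex^'n).
        open N \<and> t \<in> N \<and>
        (\<forall>y\<in>N. (F has_derivative blinfun_apply (D y)) (at y)) \<and> continuous_on N D \<and>
        (\<forall>y\<in>N \<inter> triangle. s (barycentric y) \<in> U \<and> F y = \<psi> (s (barycentric y))))"

text \<open>The integrand does not depend on the choice of the chart \<open>\<kappa>\<close>.\<close>

definition form_integral ::
  "('a, 2) complex_space \<Rightarrow> 'a two_form \<Rightarrow> ((nat \<Rightarrow> real) \<Rightarrow> 'a) \<Rightarrow> complex" where
  "form_integral X w s = integral triangle (\<lambda>t.
     let \<kappa> = (SOME \<kappa>. \<kappa> \<in> atlas X \<and> s (barycentric t) \<in> fst \<kappa>);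
         DF = frechet_derivative (snd \<kappa> \<circ> s \<circ> barycentric) (at t)
     in w \<kappa> (s (barycentric t)) * (DF (1, 0) $ 1 * DF (0, 1) $ 2 - DF (1, 0) $ 2 * DF (0, 1) $ 1))"

text \<open>\<open>\<theta>\<close> is a singular cocycle in the de Rham class of the holomorphic, hence closed, form \<open>w\<close>.\<close>

definition represents_form ::
  "('a, 2) complex_space \<Rightarrow> 'a two_form \<Rightarrow> ('a, complex) cochain \<Rightarrow> bool" where
  "represents_form X w \<theta> \<longleftrightarrow> cochain_on 2 (top_of X) \<theta> \<and> coboundary 2 (top_of X) \<theta> = (\<lambda>s. 0) \<and>
     (\<forall>s. C1_simplex2 X s \<longrightarrow> \<theta> s = form_integral X w s)"

text \<open>\<open>\<sigma>\<^sup>* w = - w\<close>\<close>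

definition anti_invariant :: "('a, 2) complex_space \<Rightarrow> ('a \<Rightarrow> 'a) \<Rightarrow> 'a two_form \<Rightarrow> bool" where
  "anti_invariant X \<sigma> w \<longleftrightarrow> (\<forall>(U, \<psi>)\<in>atlas X. \<forall>(V, \<phi>)\<in>atlas X. \<forall>x\<in>U \<inter> \<sigma> -` V.
     w (V, \<phi>) (\<sigma> x) * det (cjac (\<phi> \<circ> \<sigma> \<circ> inv_into U \<psi>) (\<psi> x)) = - w (U, \<psi>) x)"

text \<open>\<open>H\<^sup>1\<^sup>,\<^sup>1(S, \<int>\<^sub>-)\<close>. The part \<open>H\<^sup>2\<^sup>,\<^sup>0\<close> of \<open>H\<^sup>2(S, \<int>\<^sub>-) \<otimes> \<complex>\<close> is spanned by the anti-invariant holomorphic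
  2-forms on \<open>X\<close>, and \<open>H\<^sup>1\<^sup>,\<^sup>1\<close> is the orthogonal complement of \<open>H\<^sup>2\<^sup>,\<^sup>0\<close> and its conjugate; for integral
  classes, orthogonality to one implies orthogonality to the other.\<close>

definition twisted_H11 :: "('a, 2) complex_space \<Rightarrow> ('a \<Rightarrow> 'a) \<Rightarrow> ('a, int) cochain set set" where
  "twisted_H11 X \<sigma> = {A \<in> carrier (twisted_H2 X \<sigma>).
     \<forall>w \<theta>. holo_two_form X w \<and> anti_invariant X \<sigma> w \<and> represents_form X w \<theta> \<longrightarrow>
       (\<forall>\<phi>\<in>A. \<forall>c. fundamental_cycle X c \<longrightarrow>
          cochain_eval (cup 2 2 (top_of X) (\<lambda>s. of_int (\<phi> s)) \<theta>) c = 0)}"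

definition transcendental_lattice ::
  "('a, 2) complex_space \<Rightarrow> ('a \<Rightarrow> 'a) \<Rightarrow> ('a, int) cochain set zlattice" where
  "transcendental_lattice X \<sigma> =
     sublattice_on (twisted_H2 X \<sigma>) (orth_compl (twisted_H2 X \<sigma>) (twisted_H11 X \<sigma>))"

definition generic_transcendental_lattice ::
  "('a, 2) complex_space \<Rightarrow> ('a \<Rightarrow> 'a) \<Rightarrow> (nat \<Rightarrow> complex option \<Rightarrow> 'a) \<Rightarrow> ('a, int) cochain set zlattice" where
  "generic_transcendental_lattice X \<sigma> g =
     sublattice_on (twisted_H2 X \<sigma>) (orth_compl (twisted_H2 X \<sigma>) (distinguished_sublattice X \<sigma> g))"

end

theory Submission
  imports Defs
begin

text \<open>Only the lattice theory of the statement matters. Let \<open>L\<close> be the odd unimodular lattice of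
  signature \<open>(2, 10)\<close>, \<open>e\<^sub>1, \<dots>, e\<^sub>6\<close> the orthogonal vectors of square \<open>-1\<close> in \<open>D\<^sub>6(-1) \<otimes> \<rat>\<close>, and \<open>T\<close> the
  orthogonal complement of \<open>D\<^sub>6(-1)\<close>. The neighbour of \<open>L\<close> generated by \<open>e\<^sub>1\<close> and the \<open>x \<in> L\<close> with integral
  \<open>x \<cdot> e\<^sub>1\<close> is again unimodular and contains all \<open>e\<^sub>i\<close>, so the complement \<open>M\<close> of the \<open>e\<^sub>i\<close> in it is
  unimodular of signature \<open>(2, 4)\<close>, and \<open>T = {y \<in> M. u \<cdot> y even}\<close> for some \<open>u \<in> M\<close> with
  \<open>u\<^sup>2 \<equiv> 2 mod 4\<close>.

  Hermite's reduction shows that a unimodular lattice of rank at most 5, or indefinite of rank 6, has a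
  nonzero vector of square \<open>0\<close> or \<open>\<plusminus>1\<close>. Splitting off such vectors gives \<open>M\<close> an orthonormal
  basis. The parities of the coordinates of \<open>u\<close> are then, up to order, \<open>(1,1;0,0,0,0)\<close>,
  \<open>(1,0;1,1,1,0)\<close>, \<open>(0,0;1,1,0,0)\<close>, or all odd. In the last case \<open>u\<close> is characteristic, which makes
  \<open>L\<close> even. Reflections in vectors of square \<open>-2\<close> turn the third pattern into the second and the second
  into the first, for which \<open>T\<close> is visibly \<open>\<int>\<^sup>2(2) \<oplus> \<int>\<^sup>4(-1)\<close>.\<close>

section \<open>Hermite reduction of indefinite forms\<close>

text \<open>The reduction has to settle rank 6, and this shapes its form. If all nonzero vectors
  have squares of absolute value at least 2, reduction in rank \<open>n\<close> bounds the last
  Gram-Schmidt square below by \<open>2 * (3/4)^(n-1)\<close>, while unimodularity bounds it above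
  by \<open>1/2\<close>. The two clash up to rank 5 but narrowly fail to in rank 6; hence the factor
  \<open>4/3\<close> for a change of sign is carried through the induction.

  The neighbour is needed because \<open>D_6(-1)\<close> has discriminant 4 and cannot be split off
  an integral lattice orthogonally over the integers as a unimodular summand, whereas the six unit
  vectors can. The vector \<open>u\<close> comes from some \<open>s\<close> in \<open>L\<close>
  pairing half-integrally with the unit vectors: it is the projection of \<open>2 s\<close> to their
  complement, so the parity of its pairings records which vectors of \<open>M\<close> belong to
  \<open>L\<close>, and six odd squares give the class of its own square.

  Gram-Schmidt vectors and the halved roots leave the lattice, so all of this takes place in a real
  vector space, into which the abstract group is embedded by its pairings with an orthogonal
  basis.\<close>

locale sym_form =
  fixes B :: "'v::euclidean_space \<Rightarrow> 'v \<Rightarrow> real"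
  assumes bilinear: "bilinear B" and commute: "B x y = B y x"
begin

lemma form_simps [simp]:
  "B (x + y) z = B x z + B y z" "B x (y + z) = B x y + B x z"
  "B (x - y) z = B x z - B y z" "B x (y - z) = B x y - B x z"
  "B (t *\<^sub>R x) y = t * B x y" "B x (t *\<^sub>R y) = t * B x y"
  "B (- x) y = - B x y" "B x (- y) = - B x y"
  "B 0 y = 0" "B x 0 = 0"
  using bilinear
  by (simp_all add: bilinear_ladd bilinear_radd bilinear_lsub bilinear_rsub bilinear_lmul
      bilinear_rmul bilinear_lneg bilinear_rneg bilinear_lzero bilinear_rzero)

lemma form_sum_left: "B (\<Sum>i\<in>I. f i) y = (\<Sum>i\<in>I. B (f i) y)"
  by (induction I rule: infinite_finite_induct) auto

lemma form_sum_right: "B y (\<Sum>i\<in>I. f i) = (\<Sum>i\<in>I. B y (f i))"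
  by (induction I rule: infinite_finite_induct) auto

definition additive_subgroup :: "'v set \<Rightarrow> bool" where
  "additive_subgroup N \<longleftrightarrow> 0 \<in> N \<and> (\<forall>x\<in>N. \<forall>y\<in>N. x + y \<in> N \<and> x - y \<in> N)"

definition definite :: "'v set \<Rightarrow> bool" where
  "definite S \<longleftrightarrow> (\<forall>z\<in>S. z \<noteq> 0 \<longrightarrow> B z z > 0) \<or> (\<forall>z\<in>S. z \<noteq> 0 \<longrightarrow> B z z < 0)"

definition proj :: "'v \<Rightarrow> 'v \<Rightarrow> 'v" where
  "proj e z = z - (B z e / B e e) *\<^sub>R e"

lemma additive_subgroup_scale:
  assumes N: "additive_subgroup N" and x: "x \<in> N" and k: "k \<in> \<int>"
  shows "k *\<^sub>R x \<in> N"
proof -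
  have nat: "real n *\<^sub>R x \<in> N" for n
    by (induction n) (use N x in \<open>auto simp: additive_subgroup_def scaleR_left_distrib\<close>)
  obtain m where m: "k = of_int m"
    using k by (auto elim: Ints_cases)
  show ?thesis
  proof (cases "m \<ge> 0")
    case True
    then show ?thesis
      using nat[of "nat m"] m by simp
  next
    case False
    then have "k *\<^sub>R x = 0 - real (nat (- m)) *\<^sub>R x"
      using m by simp
    then show ?thesis
      using nat[of "nat (- m)"] N by (metis additive_subgroup_def)
  qed
qed

lemma proj_orth: "B e e \<noteq> 0 \<Longrightarrow> B (proj e z) e = 0"
  by (simp add: proj_def)

lemma linear_proj: "linear (proj e)"
  by (rule linearI) (simp_all add: proj_def algebra_simps add_divide_distrib)

lemma span_insert_proj:
  assumes "e \<in> \<Lambda>"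
  shows "span (insert e (proj e ` \<Lambda>)) = span \<Lambda>"
proof (rule span_eq[THEN iffD2], intro conjI subsetI)
  fix z assume "z \<in> insert e (proj e ` \<Lambda>)"
  then show "z \<in> span \<Lambda>"
    using assms by (auto simp: proj_def intro!: span_diff span_scale intro: span_base)
next
  fix z assume "z \<in> \<Lambda>"
  then have "z = proj e z + (B z e / B e e) *\<^sub>R e" "proj e z \<in> span (insert e (proj e ` \<Lambda>))"
    by (auto simp: proj_def intro: span_base)
  then show "z \<in> span (insert e (proj e ` \<Lambda>))"
    by (metis insertI1 span_add span_base span_scale)
qed

lemma orth_span:
  assumes "\<And>y. y \<in> S \<Longrightarrow> B y e = 0" and "z \<in> span S"
  shows "B z e = 0"
  using assms(2)
proof (induction rule: span_induct)
  case base
  show ?case by (auto simp: subspace_def)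
next
  case (step x)
  then show ?case using assms(1) by simp
qed

text \<open>The span of the projections is orthogonal to \<open>e\<close>, while \<open>e\<close> is
  not orthogonal to itself. All ranks are counted as real dimensions through this identity.\<close>

lemma dim_span_proj:
  assumes e: "e \<in> \<Lambda>" and ne: "B e e \<noteq> 0"
  shows "dim (span \<Lambda>) = Suc (dim (span (proj e ` \<Lambda>)))"
proof -
  have "e \<notin> span (proj e ` \<Lambda>)"
    using orth_span[of "proj e ` \<Lambda>" e e] proj_orth[OF ne] ne by auto
  then have "dim (insert e (proj e ` \<Lambda>)) = Suc (dim (proj e ` \<Lambda>))"
    by (simp add: dim_insert)
  then show ?thesis
    using span_insert_proj[OF e] by (metis dim_span)
qed

text \<open>A common denominator \<open>K\<close> makes the numbers
  \<open>K * \<bar>B y y\<bar>\<close> natural, so a least one exists. Bounded denominators thus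
  take the place of topological discreteness.\<close>

lemma exists_minimal:
  assumes K: "0 < (K::int)" "\<And>x y. x \<in> \<Lambda> \<Longrightarrow> y \<in> \<Lambda> \<Longrightarrow> of_int K * B x y \<in> \<int>"
    and ne: "\<exists>x\<in>\<Lambda>. x \<noteq> 0"
  obtains x where "x \<in> \<Lambda>" "x \<noteq> 0" "\<And>y. y \<in> \<Lambda> \<Longrightarrow> y \<noteq> 0 \<Longrightarrow> \<bar>B x x\<bar> \<le> \<bar>B y y\<bar>"
proof -
  define f where "f y = nat \<lfloor>of_int K * \<bar>B y y\<bar>\<rfloor>" for y
  have f: "real (f y) = of_int K * \<bar>B y y\<bar>" if "y \<in> \<Lambda>" for y
  proof -
    have "\<bar>of_int K * B y y\<bar> \<in> \<int>"
      using K(2)[OF that that] by (rule Ints_abs)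
    then have "of_int K * \<bar>B y y\<bar> \<in> \<int>"
      using K(1) by (simp add: abs_mult)
    then obtain i where i: "of_int K * \<bar>B y y\<bar> = of_int i"
      by (auto elim: Ints_cases)
    then have "0 \<le> i"
      using K(1) by (smt (verit) abs_ge_zero mult_nonneg_nonneg of_int_0_le_iff of_int_less_0_iff)
    then show ?thesis
      unfolding f_def i by simp
  qed
  obtain x where x: "x \<in> \<Lambda> \<and> x \<noteq> 0" "\<And>y. y \<in> \<Lambda> \<and> y \<noteq> 0 \<Longrightarrow> f x \<le> f y"
    using ne ex_has_least_nat[of "\<lambda>x. x \<in> \<Lambda> \<and> x \<noteq> 0" _ f] by blast
  have "\<bar>B x x\<bar> \<le> \<bar>B y y\<bar>" if "y \<in> \<Lambda>" "y \<noteq> 0" for y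
  proof -
    have "of_int K * \<bar>B x x\<bar> \<le> of_int K * \<bar>B y y\<bar>"
      using x that f[of x] f[of y] by (metis of_nat_le_iff)
    then show ?thesis using K(1) by simp
  qed
  with x show ?thesis using that by blast
qed

text \<open>The vector \<open>c\<close> is the last Gram-Schmidt vector of a reduced basis. Each Gram-Schmidt norm
  is at least \<open>3/4\<close> of the preceding one, and at least equal to it where the sign changes; this is the
  gain of \<open>4/3\<close> for indefinite forms.\<close>

lemma hermite_reduction:
  assumes "additive_subgroup \<Lambda>" and "\<And>y. y \<in> \<Lambda> \<Longrightarrow> y \<noteq> 0 \<Longrightarrow> B y y \<noteq> 0"
    and "\<exists>K::int. K > 0 \<and> (\<forall>x\<in>\<Lambda>. \<forall>y\<in>\<Lambda>. of_int K * B x y \<in> \<int>)"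
    and "\<exists>x\<in>\<Lambda>. x \<noteq> 0" and "dim (span \<Lambda>) \<le> Suc n" and "0 \<le> m"
    and "\<And>y. y \<in> \<Lambda> \<Longrightarrow> y \<noteq> 0 \<Longrightarrow> m \<le> \<bar>B y y\<bar>"
  shows "\<exists>c k. k \<noteq> 0 \<and> of_int k *\<^sub>R c \<in> \<Lambda> \<and> B c c \<noteq> 0 \<and> (\<forall>y\<in>\<Lambda>. B c y / B c c \<in> \<int>) \<and>
    (3/4)^n * m \<le> \<bar>B c c\<bar> \<and> ((3/4)^n * m * (4/3) \<le> \<bar>B c c\<bar> \<or> definite (span \<Lambda>))"
  using assms
proof (induction n arbitrary: \<Lambda> m rule: less_induct)
  case (less n)
  note grp = less.prems(1) and aniso = less.prems(2) and m0 = less.prems(6) and mle = less.prems(7)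
  obtain K :: int where K: "K > 0" "\<And>x y. x \<in> \<Lambda> \<Longrightarrow> y \<in> \<Lambda> \<Longrightarrow> of_int K * B x y \<in> \<int>"
    using less.prems(3) by blast
  obtain x where x: "x \<in> \<Lambda>" "x \<noteq> 0" and
    xmin: "\<And>y. y \<in> \<Lambda> \<Longrightarrow> y \<noteq> 0 \<Longrightarrow> \<bar>B x x\<bar> \<le> \<bar>B y y\<bar>"
    using exists_minimal[OF K less.prems(4)] by blast
  define a where "a = B x x"
  have a: "a \<noteq> 0" using aniso x by (simp add: a_def)
  have mx: "m \<le> \<bar>a\<bar>" using mle x by (simp add: a_def)
  \<comment> \<open>The induction descends to the projection along a shortest vector. This group
    need not lie in \<Lambda>, and the form is in general only rational on it, which is why a common
    denominator is assumed instead of integrality.\<close>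
  define \<Lambda>' where "\<Lambda>' = proj x ` \<Lambda>"
  have dim: "dim (span \<Lambda>) = Suc (dim (span \<Lambda>'))"
    unfolding \<Lambda>'_def using dim_span_proj x a by (auto simp: a_def)
  have orth: "B z x = 0" if "z \<in> span \<Lambda>'" for z
    using orth_span[OF _ that, of x] proj_orth[of x] a by (auto simp: \<Lambda>'_def a_def)
  have span_decomp: "\<exists>t. z - t *\<^sub>R x \<in> span \<Lambda>'" if "z \<in> span \<Lambda>" for z
    using that span_insert_proj[OF x(1)] unfolding \<Lambda>'_def by (metis span_breakdown_eq)
  have reduce: "\<exists>\<theta>. \<bar>\<theta>\<bar> \<le> 1/2 \<and> proj x y + \<theta> *\<^sub>R x \<in> \<Lambda> \<and> \<theta> = B y x / a - round (B y x / a)"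
    if y: "y \<in> \<Lambda>" for y
  proof -
    let ?t = "B y x / a"
    have "y - of_int (round ?t) *\<^sub>R x \<in> \<Lambda>"
      using additive_subgroup_scale[OF grp x(1)] y grp by (auto simp: additive_subgroup_def)
    moreover have "y - of_int (round ?t) *\<^sub>R x = proj x y + (?t - round ?t) *\<^sub>R x"
      by (simp add: proj_def a_def algebra_simps)
    moreover have "\<bar>?t - round ?t\<bar> \<le> 1/2"
      using of_int_round_abs_le[of ?t] by (simp add: abs_minus_commute)
    ultimately show ?thesis by metis
  qed
  have sq: "\<theta> * \<theta> \<le> 1/4" if "\<bar>\<theta>\<bar> \<le> 1/2" for \<theta> :: real
  proof -
    have "\<bar>\<theta>\<bar> * \<bar>\<theta>\<bar> \<le> (1/2) * (1/2)"
      using that by (intro mult_mono) auto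
    then show ?thesis by simp
  qed
  have pow_le: "(3/4)^i \<le> (1::real)" for i by (simp add: power_le_one)
  show ?case
  proof (cases "\<exists>z\<in>\<Lambda>'. z \<noteq> 0")
    case False
    \<comment> \<open>In rank one the remainder is a multiple of \<open>x\<close> whose square is at
      most a quarter of that of \<open>x\<close>. Minimality makes it vanish, so \<open>x\<close>
      itself serves as \<open>c\<close>.\<close>
    have mult: "B x y / a \<in> \<int>" if y: "y \<in> \<Lambda>" for y
    proof -
      obtain \<theta> where \<theta>: "\<bar>\<theta>\<bar> \<le> 1/2" "proj x y + \<theta> *\<^sub>R x \<in> \<Lambda>" "\<theta> = B y x / a - round (B y x / a)"
        using reduce[OF y] by blast
      have "proj x y = 0" using False y by (auto simp: \<Lambda>'_def)
      then have mem: "\<theta> *\<^sub>R x \<in> \<Lambda>" using \<theta>(2) by simp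
      have "\<theta> = 0"
      proof (rule ccontr)
        assume "\<theta> \<noteq> 0"
        then have "\<bar>a\<bar> \<le> \<bar>\<theta> * \<theta> * a\<bar>"
          using xmin[OF mem] x by (simp add: a_def mult.assoc)
        moreover have "\<bar>\<theta> * \<theta> * a\<bar> \<le> 1/4 * \<bar>a\<bar>"
          using mult_right_mono[OF sq[OF \<theta>(1)], of "\<bar>a\<bar>"] by (simp add: abs_mult)
        ultimately show False using a by simp
      qed
      then show ?thesis
        using \<theta>(3) by (metis Ints_of_int commute eq_iff_diff_eq_0)
    qed
    have line: "\<exists>t. z = t *\<^sub>R x" if "z \<in> span \<Lambda>" for z
    proof -
      have "\<Lambda>' \<subseteq> {0}" using False by blast
      then have "span \<Lambda>' \<subseteq> {0}" by (metis span_0 span_mono span_singleton subset_singleton_iff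
            span_empty order_refl span_insert_0)
      then show ?thesis using span_decomp[OF that] by fastforce
    qed
    have sq_line: "\<exists>t. B z z = t * t * a \<and> (z \<noteq> 0 \<longrightarrow> t * t > 0)" if z: "z \<in> span \<Lambda>" for z
    proof -
      obtain t where "z = t *\<^sub>R x" using line[OF z] by blast
      then show ?thesis
        by (intro exI[of _ t]) (auto simp: a_def zero_less_mult_iff)
    qed
    have "definite (span \<Lambda>)"
    proof (cases "a > 0")
      case True
      then have "\<forall>z\<in>span \<Lambda>. z \<noteq> 0 \<longrightarrow> B z z > 0"
        using sq_line by (metis mult_pos_pos)
      then show ?thesis by (simp add: definite_def)
    next
      case False
      then have "\<forall>z\<in>span \<Lambda>. z \<noteq> 0 \<longrightarrow> B z z < 0"
        using sq_line a by (metis linorder_neqE_linordered_idom mult_pos_neg)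
      then show ?thesis by (simp add: definite_def)
    qed
    moreover have "(3/4)^n * m \<le> \<bar>a\<bar>"
      using mult_right_mono[OF pow_le[of n] m0] mx by simp
    ultimately show ?thesis
      using mult x a by (intro exI[of _ x] exI[of _ 1]) (auto simp: a_def)
  next
    case True
    have "dim (span \<Lambda>') \<noteq> 0"
      using True by (auto simp: dim_eq_0 dest: span_base)
    then obtain n' where n': "n = Suc n'"
      using dim less.prems(5) by (cases n) auto
    \<comment> \<open>The integer \<open>a' = K * a\<close> maps \<Lambda>' back into \<Lambda>: in
      \<open>a' *\<^sub>R proj x y\<close> the coefficient of \<open>x\<close> is the integer
      \<open>- K * B y x\<close>.\<close>
    obtain a' where a': "of_int K * a = of_int a'"
      using K(2)[OF x(1) x(1)] by (auto simp: a_def elim: Ints_cases)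
    then have "a' \<noteq> 0"
      using K(1) a by (metis mult_eq_0_iff of_int_0_eq_iff order_less_irrefl)
    have clear: "of_int a' *\<^sub>R z \<in> \<Lambda>" if z: "z \<in> \<Lambda>'" for z
    proof -
      obtain y where y: "y \<in> \<Lambda>" "z = proj x y" using z by (auto simp: \<Lambda>'_def)
      have "of_int a' *\<^sub>R z = of_int a' *\<^sub>R y - (of_int K * B y x) *\<^sub>R x"
        unfolding y proj_def using a by (simp add: a'[symmetric] a_def[symmetric] algebra_simps)
      then show ?thesis
        using additive_subgroup_scale[OF grp] y(1) x(1) K(2) grp
        by (auto simp: additive_subgroup_def)
    qed
    have grp': "additive_subgroup \<Lambda>'"
      using grp unfolding additive_subgroup_def \<Lambda>'_def
      by (auto simp: linear_0[OF linear_proj] linear_add[OF linear_proj, symmetric]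
          linear_diff[OF linear_proj, symmetric] intro: image_eqI[where x = 0])
    have aniso': "B z z \<noteq> 0" if "z \<in> \<Lambda>'" "z \<noteq> 0" for z
      using aniso[OF clear[OF that(1)]] that(2) \<open>a' \<noteq> 0\<close> by auto
    have K': "\<exists>K::int. K > 0 \<and> (\<forall>y\<in>\<Lambda>'. \<forall>z\<in>\<Lambda>'. of_int K * B y z \<in> \<int>)"
    proof (intro exI[of _ "K * a' * a'"] conjI ballI)
      show "K * a' * a' > 0"
        using K(1) mult_pos_pos[OF K(1), of "a' * a'"] \<open>a' \<noteq> 0\<close>
        by (auto simp: mult.assoc zero_less_mult_iff)
      fix y z assume yz: "y \<in> \<Lambda>'" "z \<in> \<Lambda>'"
      show "of_int (K * a' * a') * B y z \<in> \<int>"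
        using K(2)[OF clear[OF yz(1)] clear[OF yz(2)]] by (simp add: mult_ac)
    qed
    obtain d where d: "d \<in> \<Lambda>'" "d \<noteq> 0" and
      dmin: "\<And>y. y \<in> \<Lambda>' \<Longrightarrow> y \<noteq> 0 \<Longrightarrow> \<bar>B d d\<bar> \<le> \<bar>B y y\<bar>"
    proof -
      obtain K2 :: int where K2: "K2 > 0" "\<And>x y. x \<in> \<Lambda>' \<Longrightarrow> y \<in> \<Lambda>' \<Longrightarrow> of_int K2 * B x y \<in> \<int>"
        using K' by blast
      show ?thesis using exists_minimal[OF K2 True] that by blast
    qed
    define b where "b = B d d"
    obtain y where y: "y \<in> \<Lambda>" "d = proj x y" using d by (auto simp: \<Lambda>'_def)
    obtain \<theta> where \<theta>: "\<bar>\<theta>\<bar> \<le> 1/2" "d + \<theta> *\<^sub>R x \<in> \<Lambda>"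
      using reduce[OF y(1)] y(2) by blast
    have dx: "B d x = 0" using orth[OF span_base[OF d(1)]] .
    have "d + \<theta> *\<^sub>R x \<noteq> 0"
    proof
      assume "d + \<theta> *\<^sub>R x = 0"
      then have "B (d + \<theta> *\<^sub>R x) d = 0" by simp
      then show False using dx commute[of x d] aniso'[OF d] by simp
    qed
    \<comment> \<open>The size-reduced lift of \<open>d\<close> to \<Lambda> is compared with the
      shortest vector \<open>x\<close>.\<close>
    from xmin[OF \<theta>(2) this] have ab: "\<bar>a\<bar> \<le> \<bar>b + \<theta> * \<theta> * a\<bar>"
      using dx commute[of x d] by (simp add: a_def b_def mult.assoc)
    define r where "r = \<theta> * \<theta> * a"
    have abr: "\<bar>a\<bar> \<le> \<bar>b + r\<bar>" using ab by (simp add: r_def)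
    have r: "\<bar>r\<bar> \<le> 1/4 * \<bar>a\<bar>"
      using mult_right_mono[OF sq[OF \<theta>(1)], of "\<bar>a\<bar>"] by (simp add: r_def abs_mult)
    have b34: "3/4 * \<bar>a\<bar> \<le> \<bar>b\<bar>"
      using abr r by linarith
    \<comment> \<open>With opposite signs \<open>r\<close> works against \<open>b\<close>. As
      \<open>r\<close> is smaller in size than \<open>a\<close>, the inequality can only hold if
      \<open>b\<close> alone reaches the size of \<open>a\<close>, and no factor \<open>3/4\<close>
      is lost.\<close>
    have bopp: "\<bar>a\<bar> \<le> \<bar>b\<bar>" if "a * b < 0"
    proof (cases "a > 0")
      case True
      then have "b < 0" "0 \<le> r" using that by (auto simp: mult_less_0_iff r_def)
      then show ?thesis using abr r True by linarith
    next
      case False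
      then have "b > 0" "r \<le> 0" "a < 0"
        using that a by (auto simp: mult_less_0_iff r_def mult_nonneg_nonpos)
      then show ?thesis using abr r by linarith
    qed
    \<comment> \<open>The induction hypothesis is used with the minimum \<open>\<bar>b\<bar>\<close>
      of \<Lambda>' in place of \<open>m\<close>, so each level costs at most one factor
      \<open>3/4\<close>.\<close>
    obtain c k where c: "k \<noteq> 0" "of_int k *\<^sub>R c \<in> \<Lambda>'" "B c c \<noteq> 0"
      "\<forall>y\<in>\<Lambda>'. B c y / B c c \<in> \<int>" "(3/4)^n' * \<bar>b\<bar> \<le> \<bar>B c c\<bar>"
      "(3/4)^n' * \<bar>b\<bar> * (4/3) \<le> \<bar>B c c\<bar> \<or> definite (span \<Lambda>')"
      using less.IH[of n' \<Lambda>' "\<bar>b\<bar>", OF _ grp' aniso' K' True] dim less.prems(5) dmin n'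
      unfolding b_def by auto
    have "of_int k * B c x = 0"
      using orth[OF span_base[OF c(2)]] by simp
    then have cx: "B c x = 0" using c(1) by simp
    have int: "B c y / B c c \<in> \<int>" if "y \<in> \<Lambda>" for y
    proof -
      have "B c (proj x y) = B c y" using cx by (simp add: proj_def)
      then show ?thesis using c(4) that by (force simp: \<Lambda>'_def)
    qed
    have mult: "of_int (a' * k) *\<^sub>R c \<in> \<Lambda>"
      using clear[OF c(2)] by (simp add: mult.commute)
    have mb: "m * (3/4) \<le> \<bar>b\<bar>" using b34 mx by simp
    have p0: "0 \<le> (3/4::real)^n'" by simp
    have pm: "(3/4)^n * m \<le> (3/4)^n' * \<bar>b\<bar>"
    proof -
      have "(3/4)^n * m = (3/4)^n' * (m * (3/4))" unfolding n' by simp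
      then show ?thesis using mult_left_mono[OF mb p0] by linarith
    qed
    have bound: "(3/4)^n * m \<le> \<bar>B c c\<bar>"
      using pm c(5) by linarith
    \<comment> \<open>The gain arises from a change of sign at this level or is inherited from the
      projection. If neither happens, the projection is definite with the sign of \<open>a\<close>,
      and adding the orthogonal vector \<open>x\<close> keeps it definite.\<close>
    have "(3/4)^n * m * (4/3) \<le> \<bar>B c c\<bar> \<or> definite (span \<Lambda>)"
    proof (cases "a * b < 0")
      case True
      then have "m \<le> \<bar>b\<bar>" using bopp mx by simp
      then have "(3/4)^n' * m \<le> (3/4)^n' * \<bar>b\<bar>" by (rule mult_left_mono[OF _ p0])
      then have "(3/4)^n' * m \<le> \<bar>B c c\<bar>" using c(5) by linarith
      then show ?thesis unfolding n' by (simp add: mult.commute)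
    next
      case False
      then have sgn: "a * b > 0"
        using a aniso'[OF d] by (simp add: b_def less_le)
      show ?thesis using c(6)
      proof
        assume "(3/4)^n' * \<bar>b\<bar> * (4/3) \<le> \<bar>B c c\<bar>"
        then show ?thesis
          using pm by linarith
      next
        assume def: "definite (span \<Lambda>')"
        have val: "\<exists>t w. z = w + t *\<^sub>R x \<and> w \<in> span \<Lambda>' \<and> B z z = B w w + t * t * a"
          if z: "z \<in> span \<Lambda>" for z
        proof -
          obtain t where t: "z - t *\<^sub>R x \<in> span \<Lambda>'" using span_decomp[OF z] by blast
          define w where "w = z - t *\<^sub>R x"
          have zw: "z = w + t *\<^sub>R x" "w \<in> span \<Lambda>'" using t by (simp_all add: w_def)
          then have "B w x = 0" "B x w = 0" using orth commute by metis+
          then have "B z z = B w w + t * t * a" by (simp add: zw(1) a_def)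
          with zw show ?thesis by blast
        qed
        have dspan: "d \<in> span \<Lambda>'" using d(1) by (rule span_base)
        consider (pos) "\<forall>z\<in>span \<Lambda>'. z \<noteq> 0 \<longrightarrow> 0 < B z z"
          | (neg) "\<forall>z\<in>span \<Lambda>'. z \<noteq> 0 \<longrightarrow> B z z < 0"
          using def unfolding definite_def by blast
        then show ?thesis
        proof cases
          case pos
          then have "b > 0" using d(2) dspan unfolding b_def by blast
          then have "a > 0" using sgn by (simp add: zero_less_mult_iff)
          have "0 < B z z" if "z \<in> span \<Lambda>" "z \<noteq> 0" for z
          proof -
            obtain t w where tw: "z = w + t *\<^sub>R x" "w \<in> span \<Lambda>'" "B z z = B w w + t * t * a"
              using val[OF \<open>z \<in> span \<Lambda>\<close>] by blast
            show ?thesis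
            proof (cases "w = 0")
              case True
              then have "t \<noteq> 0" using tw that by auto
              then have "0 < t * t * a" using \<open>a > 0\<close> by (auto simp: zero_less_mult_iff)
              then show ?thesis using tw(3) True by simp
            next
              case False
              then have "0 < B w w" using pos tw by blast
              moreover have "0 \<le> t * t * a" using \<open>a > 0\<close> by simp
              ultimately show ?thesis using tw(3) by simp
            qed
          qed
          then show ?thesis unfolding definite_def by blast
        next
          case neg
          then have "b < 0" using d(2) dspan unfolding b_def by blast
          then have "a < 0" using sgn by (simp add: zero_less_mult_iff)
          have "B z z < 0" if "z \<in> span \<Lambda>" "z \<noteq> 0" for z
          proof -
            obtain t w where tw: "z = w + t *\<^sub>R x" "w \<in> span \<Lambda>'" "B z z = B w w + t * t * a"
              using val[OF \<open>z \<in> span \<Lambda>\<close>] by blast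
            show ?thesis
            proof (cases "w = 0")
              case True
              then have "t \<noteq> 0" using tw that by auto
              then have "t * t * a < 0" using \<open>a < 0\<close> by (auto simp: mult_less_0_iff zero_less_mult_iff)
              then show ?thesis using tw(3) True by simp
            next
              case False
              then have "B w w < 0" using neg tw by blast
              moreover have "t * t * a \<le> 0" using \<open>a < 0\<close> by (simp add: mult_nonneg_nonpos)
              ultimately show ?thesis using tw(3) by simp
            qed
          qed
          then show ?thesis unfolding definite_def by blast
        qed
      qed
    qed
    then show ?thesis
      using bound int mult c(1,3) \<open>a' \<noteq> 0\<close>
      by (intro exI[of _ c] exI[of _ "a' * k"]) auto
  qed
qed

end

section \<open>Unimodular subgroups\<close>

context sym_form
begin

text \<open>The functional \<open>f\<close> is a function on the whole space that is constrained on
  \<open>N\<close> only, so representability applies to functions such as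
  \<open>\<lambda>y. B c y / B c c\<close>.\<close>

definition unimodular_in :: "'v set \<Rightarrow> bool" where
  "unimodular_in N \<longleftrightarrow> additive_subgroup N \<and> (\<forall>x\<in>N. \<forall>y\<in>N. B x y \<in> \<int>) \<and>
     (\<forall>x\<in>N. (\<forall>y\<in>N. B x y = 0) \<longrightarrow> x = 0) \<and>
     (\<forall>f. (\<forall>x\<in>N. f x \<in> \<int>) \<and> (\<forall>x\<in>N. \<forall>y\<in>N. f (x + y) = f x + f y) \<longrightarrow>
        (\<exists>w\<in>N. \<forall>y\<in>N. B w y = f y))"

definition has_unit_norm :: "'v set \<Rightarrow> bool" where
  "has_unit_norm N \<longleftrightarrow> (\<exists>v\<in>N. \<bar>B v v\<bar> = 1)"

lemma unimodular_in_simps: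
  assumes "unimodular_in N"
  shows "0 \<in> N" "x \<in> N \<Longrightarrow> y \<in> N \<Longrightarrow> x + y \<in> N" "x \<in> N \<Longrightarrow> y \<in> N \<Longrightarrow> x - y \<in> N"
    "x \<in> N \<Longrightarrow> y \<in> N \<Longrightarrow> B x y \<in> \<int>" "k \<in> \<int> \<Longrightarrow> x \<in> N \<Longrightarrow> k *\<^sub>R x \<in> N"
  using assms additive_subgroup_scale by (auto simp: unimodular_in_def additive_subgroup_def)

lemma unimodular_in_represent:
  assumes "unimodular_in N" and "\<And>x. x \<in> N \<Longrightarrow> f x \<in> \<int>"
    and "\<And>x y. x \<in> N \<Longrightarrow> y \<in> N \<Longrightarrow> f (x + y) = f x + f y"
  obtains w where "w \<in> N" "\<And>y. y \<in> N \<Longrightarrow> B w y = f y"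
proof -
  have "(\<forall>x\<in>N. f x \<in> \<int>) \<and> (\<forall>x\<in>N. \<forall>y\<in>N. f (x + y) = f x + f y) \<longrightarrow>
      (\<exists>w\<in>N. \<forall>y\<in>N. B w y = f y)"
    using assms(1) unfolding unimodular_in_def by (elim conjE allE[of _ f]) assumption
  then show ?thesis using assms(2,3) that by blast
qed

lemma unimodular_in_nondegenerate:
  "unimodular_in N \<Longrightarrow> x \<in> N \<Longrightarrow> (\<And>y. y \<in> N \<Longrightarrow> B x y = 0) \<Longrightarrow> x = 0"
  by (auto simp: unimodular_in_def)

text \<open>For unimodular \<open>N\<close>, the dual vector \<open>c / c\<^sup>2\<close> of the last Gram-Schmidt vector lies in \<open>N\<close>, so its norm
  \<open>1 / c\<^sup>2\<close> is also bounded below by the minimum of \<open>N\<close>.\<close>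

lemma unimodular_short_vector:
  assumes N: "unimodular_in N" and ne: "\<exists>x\<in>N. x \<noteq> 0"
    and dim: "dim (span N) \<le> 5 \<or> dim (span N) \<le> 6 \<and> \<not> definite (span N)"
  shows "has_unit_norm N \<or> (\<exists>x\<in>N. x \<noteq> 0 \<and> B x x = 0)"
proof (rule ccontr)
  assume no: "\<not> ?thesis"
  have two: "2 \<le> \<bar>B x x\<bar>" if x: "x \<in> N" "x \<noteq> 0" for x
  proof -
    obtain k where k: "B x x = of_int k"
      using unimodular_in_simps(4)[OF N x(1) x(1)] by (auto elim: Ints_cases)
    have "k \<noteq> 0" "\<bar>k\<bar> \<noteq> 1"
      using no x k by (auto simp: has_unit_norm_def)
    then show ?thesis using k by linarith
  qed
  have K: "\<exists>K::int. K > 0 \<and> (\<forall>x\<in>N. \<forall>y\<in>N. of_int K * B x y \<in> \<int>)"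
    using unimodular_in_simps(4)[OF N] by (intro exI[of _ 1]) auto
  have aniso: "B x x \<noteq> 0" if "x \<in> N" "x \<noteq> 0" for x
    using two that by fastforce
  have grp: "additive_subgroup N" using N by (simp add: unimodular_in_def)
  obtain c k where c: "(k::int) \<noteq> 0" "of_int k *\<^sub>R c \<in> N" "B c c \<noteq> 0"
    "\<And>y. y \<in> N \<Longrightarrow> B c y / B c c \<in> \<int>" "(3/4)^4 * 2 \<le> \<bar>B c c\<bar>"
  proof (cases "dim (span N) \<le> 5")
    case True
    then show ?thesis
      using hermite_reduction[of N 4 2, OF grp aniso K ne _ _ two] that by auto
  next
    case False
    then have "dim (span N) \<le> Suc 5" "\<not> definite (span N)" using dim by auto
    \<comment> \<open>The gain for a change of sign brings rank 6 back to the bound for rank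
      5.\<close>
    moreover have "(3/4)^5 * 2 * (4/3) = (3/4)^4 * (2::real)" by (simp add: power_def)
    ultimately show ?thesis
      using hermite_reduction[of N 5 2, OF grp aniso K ne _ _ two] that by auto
  qed
  obtain w where w: "w \<in> N" "\<And>y. y \<in> N \<Longrightarrow> B w y = B c y / B c c"
    using unimodular_in_represent[OF N, of "\<lambda>y. B c y / B c c"] c(4)
    by (auto simp: add_divide_distrib)
  \<comment> \<open>Only a multiple of \<open>c\<close> is known to lie in \<open>N\<close>, so the
    pairing with \<open>w\<close> is read off from that multiple.\<close>
  have "of_int k * B w c = of_int k"
    using w(2)[OF c(2)] c(3) by simp
  then have "B w c = 1" using c(1) by simp
  then have ww: "B w w = 1 / B c c" using w(2)[OF w(1)] commute by metis
  then have "w \<noteq> 0" using c(3) by auto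
  then have "2 \<le> 1 / \<bar>B c c\<bar>" using two[OF w(1)] ww by simp
  then have "\<bar>B c c\<bar> \<le> 1/2" using c(3) by (simp add: field_simps)
  \<comment> \<open>The lower bound \<open>2 * (3/4)^4 = 81/128\<close> exceeds \<open>1/2\<close>;
    without the gain, rank 6 would yield only \<open>2 * (3/4)^5 = 243/512\<close>.\<close>
  with c(5) show False by (simp add: power_def)
qed

text \<open>A functional on the image is pulled back along the self-adjoint idempotent \<pi>,
  represented in \<open>N\<close>, and the representing vector is projected. Splitting off a unit
  vector and splitting off a hyperbolic plane are both of this kind.\<close>

lemma unimodular_in_image:
  assumes N: "unimodular_in N" and lin: "linear \<pi>" and mem: "\<And>x. x \<in> N \<Longrightarrow> \<pi> x \<in> N"
    and adj: "\<And>x y. B (\<pi> x) y = B x (\<pi> y)" and idem: "\<And>x. \<pi> (\<pi> x) = \<pi> x"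
  shows "unimodular_in (\<pi> ` N)"
  unfolding unimodular_in_def
proof (intro conjI allI impI ballI)
  show "additive_subgroup (\<pi> ` N)"
    using unimodular_in_simps[OF N] unfolding additive_subgroup_def
    by (auto simp: linear_0[OF lin] linear_add[OF lin, symmetric]
          linear_diff[OF lin, symmetric] intro: image_eqI[where x = 0])
next
  fix x y assume "x \<in> \<pi> ` N" "y \<in> \<pi> ` N"
  then show "B x y \<in> \<int>" using mem unimodular_in_simps(4)[OF N] by blast
next
  fix x assume x: "x \<in> \<pi> ` N" "\<forall>y\<in>\<pi> ` N. B x y = 0"
  then have "\<pi> x = x" "x \<in> N" using idem mem by auto
  moreover have "B x y = 0" if "y \<in> N" for y
    using adj[of x y] \<open>\<pi> x = x\<close> x(2) that by auto
  ultimately show "x = 0" using unimodular_in_nondegenerate[OF N] by blast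
next
  fix f :: "'v \<Rightarrow> real"
  assume f: "(\<forall>x\<in>\<pi> ` N. f x \<in> \<int>) \<and> (\<forall>x\<in>\<pi> ` N. \<forall>y\<in>\<pi> ` N. f (x + y) = f x + f y)"
  obtain w where w: "w \<in> N" "\<And>y. y \<in> N \<Longrightarrow> B w y = f (\<pi> y)"
    using unimodular_in_represent[OF N, of "f \<circ> \<pi>"] f by (auto simp: linear_add[OF lin])
  have "B (\<pi> w) y = f y" if y: "y \<in> \<pi> ` N" for y
  proof -
    have "\<pi> y = y" "y \<in> N" using y idem mem by auto
    then show ?thesis using adj w(2) by metis
  qed
  then show "\<exists>w\<in>\<pi> ` N. \<forall>y\<in>\<pi> ` N. B w y = f y" using w(1) by blast
qed

lemma proj_image:
  assumes "B e e \<noteq> 0" and "\<And>x. x \<in> N \<Longrightarrow> proj e x \<in> N"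
  shows "proj e ` N = {x \<in> N. B x e = 0}"
proof -
  have "x \<in> proj e ` N" if "x \<in> N" "B x e = 0" for x
    using that by (intro image_eqI[of _ _ x]) (simp_all add: proj_def)
  then show ?thesis using assms proj_orth by auto
qed

lemma proj_adjoint: "B (proj e x) y = B x (proj e y)"
  by (simp add: proj_def commute[of e y])

lemma proj_idem: "B e e \<noteq> 0 \<Longrightarrow> proj e (proj e x) = proj e x"
  using proj_orth by (simp add: proj_def[of e "proj e x"])

lemma unit_split:
  assumes N: "unimodular_in N" and e: "e \<in> N" "\<bar>B e e\<bar> = 1"
  shows "unimodular_in {x \<in> N. B x e = 0}"
    and "dim (span N) = Suc (dim (span {x \<in> N. B x e = 0}))"
proof -
  have ne: "B e e \<noteq> 0" using e by auto
  have mem: "proj e x \<in> N" if x: "x \<in> N" for x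
  proof -
    have "B x e / B e e \<in> \<int>"
      using unimodular_in_simps(4)[OF N x e(1)] e(2) by (auto simp: abs_if split: if_splits)
    then show ?thesis
      unfolding proj_def by (intro unimodular_in_simps[OF N] x e(1))
  qed
  show "unimodular_in {x \<in> N. B x e = 0}"
    using unimodular_in_image[OF N linear_proj mem proj_adjoint proj_idem[OF ne]]
      proj_image[OF ne mem] by simp
  show "dim (span N) = Suc (dim (span {x \<in> N. B x e = 0}))"
    using dim_span_proj[OF e(1) ne] proj_image[OF ne mem] by simp
qed

lemma hyperbolic_split:
  assumes N: "unimodular_in N" and x: "x \<in> N" "B x x = 0" and y: "y \<in> N" "B y y = 0"
    and xy: "B x y = 1"
  shows "unimodular_in {z \<in> N. B z x = 0 \<and> B z y = 0}"
    and "dim (span N) = Suc (Suc (dim (span {z \<in> N. B z x = 0 \<and> B z y = 0})))"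
proof -
  define \<pi> where "\<pi> z = z - B z y *\<^sub>R x - B z x *\<^sub>R y" for z
  have yx: "B y x = 1" using xy commute by metis
  have lin: "linear \<pi>" by (rule linearI) (simp_all add: \<pi>_def algebra_simps)
  have mem: "\<pi> z \<in> N" if "z \<in> N" for z
    unfolding \<pi>_def by (intro unimodular_in_simps[OF N] that x(1) y(1))
  have adj: "B (\<pi> z) w = B z (\<pi> w)" for z w
    by (simp add: \<pi>_def commute[of x w] commute[of y w] mult.commute)
  have orth: "B (\<pi> z) x = 0" "B (\<pi> z) y = 0" for z
    using x y xy yx by (simp_all add: \<pi>_def)
  have idem: "\<pi> (\<pi> z) = \<pi> z" for z
    unfolding \<pi>_def[of "\<pi> z"] using orth by simp
  have "z \<in> \<pi> ` N" if "z \<in> N" "B z x = 0" "B z y = 0" for z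
    using that by (intro image_eqI[of _ _ z]) (simp_all add: \<pi>_def)
  then have im: "\<pi> ` N = {z \<in> N. B z x = 0 \<and> B z y = 0}"
    using mem orth by auto
  show "unimodular_in {z \<in> N. B z x = 0 \<and> B z y = 0}"
    using unimodular_in_image[OF N lin mem adj idem] im by simp
  \<comment> \<open>The rank formula concerns projections along vectors of nonzero square, so \<pi>
    is factored through those along \<open>x + y\<close> and \<open>x - y\<close>. The intermediate
    image may leave \<open>N\<close>, which does not affect the dimension count.\<close>
  have s: "B (x + y) (x + y) = 2" "B (x - y) (x - y) = -2" "B (x - y) (x + y) = 0"
    using x y xy yx by simp_all
  have "x - y \<in> proj (x + y) ` N"
    using x y unimodular_in_simps[OF N] s(3)
    by (intro image_eqI[of _ _ "x - y"]) (auto simp: proj_def)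
  moreover have "x + y \<in> N" by (intro unimodular_in_simps[OF N] x(1) y(1))
  ultimately have "dim (span N) = Suc (Suc (dim (span (proj (x - y) ` proj (x + y) ` N))))"
    using dim_span_proj s by simp
  also have "proj (x - y) (proj (x + y) z) = \<pi> z" for z
  proof -
    have p: "proj (x + y) z = z - ((B z x + B z y) / 2) *\<^sub>R (x + y)"
      unfolding proj_def s(1) by simp
    have "B (x + y) (x - y) = 0" using s(3) commute by metis
    then have "B (proj (x + y) z) (x - y) = B z x - B z y"
      unfolding p by (simp only: form_simps(3,5)) simp
    then have "proj (x - y) (proj (x + y) z) =
        z - ((B z x + B z y) / 2) *\<^sub>R (x + y) + ((B z x - B z y) / 2) *\<^sub>R (x - y)"
      unfolding proj_def[of "x - y"] s(2) p by simp
    also have "\<dots> = z - (((B z x + B z y) / 2 - (B z x - B z y) / 2)) *\<^sub>R x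
        - ((B z x + B z y) / 2 + (B z x - B z y) / 2) *\<^sub>R y"
      by (simp only: algebra_simps)
    also have "\<dots> = \<pi> z" unfolding \<pi>_def by (simp add: field_simps)
    finally show ?thesis .
  qed
  then have "proj (x - y) ` proj (x + y) ` N = \<pi> ` N" by (simp add: image_image)
  finally show "dim (span N) = Suc (Suc (dim (span {z \<in> N. B z x = 0 \<and> B z y = 0})))"
    using im by simp
qed

text \<open>The values of \<open>B x\<close> on \<open>N\<close> are the multiples of the least
  positive one, \<open>n\<close>. By unimodularity the functional \<open>B x / n\<close> is
  represented in \<open>N\<close>; its representing vector is again isotropic and attains the value
  1.\<close>

lemma primitive_isotropic:
  assumes N: "unimodular_in N" and x: "x \<in> N" "x \<noteq> 0" "B x x = 0"
  obtains x' y where "x' \<in> N" "y \<in> N" "B x' x' = 0" "B x' y = 1"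
proof -
  define P where "P n \<longleftrightarrow> 0 < n \<and> (\<exists>y\<in>N. B x y = real n)" for n
  obtain y0 where y0: "y0 \<in> N" "B x y0 \<noteq> 0"
    using unimodular_in_nondegenerate[OF N x(1)] x(2) by blast
  obtain k0 where k0: "B x y0 = of_int k0"
    using unimodular_in_simps(4)[OF N x(1) y0(1)] by (auto elim: Ints_cases)
  have "P (nat \<bar>k0\<bar>)"
  proof (cases "k0 > 0")
    case True
    then show ?thesis using y0 k0 unfolding P_def by auto
  next
    case False
    then have "B x (0 - y0) = real (nat \<bar>k0\<bar>)" "k0 \<noteq> 0" using y0 k0 by auto
    moreover have "0 - y0 \<in> N" by (intro unimodular_in_simps[OF N] y0(1))
    ultimately show ?thesis unfolding P_def by (metis zero_less_nat_eq zero_less_abs_iff)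
  qed
  define n where "n = (LEAST n. P n)"
  have "P n" unfolding n_def by (rule LeastI, fact)
  then obtain y where y: "y \<in> N" "B x y = real n" and n: "n > 0" by (auto simp: P_def)
  have dvd: "B x z / real n \<in> \<int>" if z: "z \<in> N" for z
  proof -
    obtain k where k: "B x z = of_int k"
      using unimodular_in_simps(4)[OF N x(1) z] by (auto elim: Ints_cases)
    define w where "w = z - of_int (k div int n) *\<^sub>R y"
    have w: "w \<in> N" unfolding w_def by (intro unimodular_in_simps[OF N] z y(1) Ints_of_int)
    have "real_of_int (k mod int n) = of_int k - of_int (k div int n) * real n"
      by (metis minus_div_mult_eq_mod of_int_diff of_int_mult of_int_of_nat_eq)
    then have "B x w = of_int (k mod int n)"
      using k y(2) by (simp add: w_def)
    moreover have "0 \<le> k mod int n" "k mod int n < int n" using n by simp_all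
    ultimately have Bw: "B x w = real (nat (k mod int n))" "nat (k mod int n) < n" by auto
    have "\<not> P (nat (k mod int n))"
      using Bw(2) not_less_Least unfolding n_def by blast
    then have "k mod int n = 0" using w Bw \<open>0 \<le> k mod int n\<close> unfolding P_def by auto
    then obtain q where "k = int n * q" by (auto simp: mod_eq_0_iff_dvd)
    then show ?thesis using k n by simp
  qed
  obtain x' where x': "x' \<in> N" "\<And>z. z \<in> N \<Longrightarrow> B x' z = B x z / real n"
    using unimodular_in_represent[OF N, of "\<lambda>z. B x z / real n"] dvd by (auto simp: add_divide_distrib)
  have "B x' x' = B x x' / real n" using x' by blast
  also have "B x x' = B x' x" by (rule commute)
  also have "B x' x = B x x / real n" using x' x by blast
  finally have "B x' x' = 0" using x by simp
  moreover have "B x' y = 1" using x' y n by simp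
  ultimately show ?thesis using that x' y by blast
qed

text \<open>Subtracting multiples of \<open>x'\<close> from \<open>y\<close> changes the square of
  \<open>y\<close> by even integers, so it can be made 0 or 1, and 1 is excluded.\<close>

lemma unit_norm_or_hyperbolic:
  assumes N: "unimodular_in N" and x: "x \<in> N" "x \<noteq> 0" "B x x = 0"
    and odd: "\<not> has_unit_norm N"
  obtains x' y where "x' \<in> N" "y \<in> N" "B x' x' = 0" "B y y = 0" "B x' y = 1"
proof -
  obtain x' y where xy: "x' \<in> N" "y \<in> N" "B x' x' = 0" "B x' y = 1"
    using primitive_isotropic[OF N x] by blast
  obtain k where k: "B y y = of_int k"
    using unimodular_in_simps(4)[OF N xy(2) xy(2)] by (auto elim: Ints_cases)
  define z where "z = y - of_int (k div 2) *\<^sub>R x'"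
  have z: "z \<in> N" unfolding z_def by (intro unimodular_in_simps[OF N] xy Ints_of_int)
  have "real_of_int (k mod 2) = of_int k - of_int (k div 2) * 2"
    by (metis minus_div_mult_eq_mod of_int_diff of_int_mult of_int_numeral)
  then have "B z z = of_int (k mod 2)"
    unfolding z_def using xy k commute[of y x'] by simp
  moreover have "k mod 2 = 0 \<or> k mod 2 = 1" by auto
  moreover have "B z z \<noteq> 1" using odd z by (auto simp: has_unit_norm_def)
  ultimately have "B z z = 0" by auto
  moreover have "B x' z = 1" using xy by (simp add: z_def)
  ultimately show ?thesis using that xy z by blast
qed

end

lemma half_integers_diff:
  fixes a b :: real
  assumes "2 * a \<in> \<int>" "a \<notin> \<int>" "2 * b \<in> \<int>" "b \<notin> \<int>"
  shows "a - b \<in> \<int>"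
proof -
  obtain k l where k: "2 * a = of_int k" and l: "2 * b = of_int l"
    using assms by (auto elim!: Ints_cases)
  have odd: "odd n" if "2 * c = of_int n" "c \<notin> \<int>" for n :: int and c :: real
  proof
    assume "even n"
    then obtain q where "n = 2 * q" by (auto elim: evenE)
    then have "c = of_int q" using that(1) by simp
    then show False using that(2) by simp
  qed
  have "even (k - l)" using odd[OF k assms(2)] odd[OF l assms(4)] by simp
  then obtain q where "k - l = 2 * q" by (rule evenE)
  then have "of_int k - of_int l = (2 * of_int q :: real)" by (metis of_int_diff of_int_mult of_int_numeral)
  then have "a - b = of_int q" using k l by linarith
  then show ?thesis by simp
qed

section \<open>Orthonormal bases up to rank six\<close>

context sym_form
begin

lemma dim_span_pos:
  fixes N :: "'v set"
  shows "dim (span N) \<noteq> 0 \<Longrightarrow> \<exists>x\<in>N. x \<noteq> 0"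
proof (rule ccontr)
  assume "dim (span N) \<noteq> 0" "\<not> (\<exists>x\<in>N. x \<noteq> 0)"
  then have "N \<subseteq> {0}" by auto
  then have "dim N = 0" by simp
  then show False using \<open>dim (span N) \<noteq> 0\<close> by simp
qed

text \<open>If the complement of a unit vector \<open>w\<close> is even, it contains a hyperbolic pair \<open>x, y\<close>, and
  \<open>w + x\<close> is a unit vector orthogonal to the unit vector \<open>w + x - w\<^sup>2 y\<close>.\<close>

lemma unit_norm_complement:
  assumes N: "unimodular_in N" and odd: "has_unit_norm N"
    and dim: "2 \<le> dim (span N)" "dim (span N) \<le> 6"
  shows "\<exists>v\<in>N. \<bar>B v v\<bar> = 1 \<and> has_unit_norm {x \<in> N. B x v = 0}"
proof -
  obtain w where w: "w \<in> N" "\<bar>B w w\<bar> = 1" using odd by (auto simp: has_unit_norm_def)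
  define N' where "N' = {x \<in> N. B x w = 0}"
  have N': "unimodular_in N'" "dim (span N) = Suc (dim (span N'))"
    unfolding N'_def using unit_split[OF N w] by blast+
  show ?thesis
  proof (cases "has_unit_norm N'")
    case True
    then show ?thesis using w unfolding N'_def by blast
  next
    case False
    have "\<exists>x\<in>N'. x \<noteq> 0" using dim_span_pos[of N'] N'(2) dim by linarith
    \<comment> \<open>The complement of \<open>w\<close> has rank at most 5, where the reduction
      argument works in every signature.\<close>
    then have "\<exists>x\<in>N'. x \<noteq> 0 \<and> B x x = 0"
      using unimodular_short_vector[OF N'(1)] N'(2) dim False by auto
    then obtain x y where xy: "x \<in> N'" "y \<in> N'" "B x x = 0" "B y y = 0" "B x y = 1"
      using unit_norm_or_hyperbolic[OF N'(1) _ _ _ False] by metis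
    have orth: "B x w = 0" "B y w = 0" "B w x = 0" "B w y = 0" "B y x = 1"
      and mem: "x \<in> N" "y \<in> N"
      using xy commute by (auto simp: N'_def)
    define v where "v = w + x - B w w *\<^sub>R y"
    have "v \<in> N" unfolding v_def by (intro unimodular_in_simps[OF N] w(1) mem)
    moreover have "B v v = - B w w" unfolding v_def using xy orth by simp
    moreover have "B (w + x) v = 0" "B (w + x) (w + x) = B w w"
      unfolding v_def using xy orth by simp_all
    moreover have "w + x \<in> N" by (intro unimodular_in_simps[OF N] w(1) mem)
    ultimately have "has_unit_norm {x \<in> N. B x v = 0}"
      using w(2) unfolding has_unit_norm_def by (intro bexI[of _ "w + x"]) auto
    then show ?thesis using \<open>v \<in> N\<close> \<open>B v v = - B w w\<close> w(2) by (intro bexI[of _ v]) auto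
  qed
qed

text \<open>Each unit vector split off must leave a unit vector in its complement, or the induction
  would get stuck. Squares of absolute value 1 are their own inverses, so the coordinate is a
  product instead of a quotient.\<close>

lemma orthonormal_basis:
  assumes "unimodular_in N" and "dim (span N) = n" and "n \<le> 6" and "n = 0 \<or> has_unit_norm N"
  shows "\<exists>f. (\<forall>i<n. f i \<in> N \<and> \<bar>B (f i) (f i)\<bar> = 1) \<and> (\<forall>i<n. \<forall>j<n. i \<noteq> j \<longrightarrow> B (f i) (f j) = 0) \<and>
    (\<forall>x\<in>N. x = (\<Sum>i<n. (B x (f i) * B (f i) (f i)) *\<^sub>R f i))"
  using assms
proof (induction n arbitrary: N)
  case 0
  then have "\<forall>x\<in>N. x = 0" using span_base by (auto simp: dim_eq_0)
  then show ?case by auto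
next
  case (Suc m)
  note N = Suc.prems(1)
  obtain v where v: "v \<in> N" "\<bar>B v v\<bar> = 1" "m = 0 \<or> has_unit_norm {x \<in> N. B x v = 0}"
  proof (cases "m = 0")
    case True
    then show ?thesis using that Suc.prems(4) by (auto simp: has_unit_norm_def)
  next
    case False
    then show ?thesis
      using unit_norm_complement[OF N] Suc.prems that by auto
  qed
  define N' where "N' = {x \<in> N. B x v = 0}"
  have "unimodular_in N'" "dim (span N') = m"
    using unit_split[OF N v(1,2)] Suc.prems(2) unfolding N'_def by auto
  then obtain f where f: "\<And>i. i < m \<Longrightarrow> f i \<in> N' \<and> \<bar>B (f i) (f i)\<bar> = 1"
    "\<And>i j. i < m \<Longrightarrow> j < m \<Longrightarrow> i \<noteq> j \<Longrightarrow> B (f i) (f j) = 0"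
    "\<And>x. x \<in> N' \<Longrightarrow> x = (\<Sum>i<m. (B x (f i) * B (f i) (f i)) *\<^sub>R f i)"
    using Suc.IH[of N'] v(3) Suc.prems(3) unfolding N'_def by auto
  have fv: "B (f i) v = 0" "B v (f i) = 0" if "i < m" for i
    using f(1)[OF that] commute by (auto simp: N'_def)
  define g where "g = f(m := v)"
  have exp: "x = (\<Sum>i<Suc m. (B x (g i) * B (g i) (g i)) *\<^sub>R g i)" if x: "x \<in> N" for x
  proof -
    define z where "z = x - (B x v * B v v) *\<^sub>R v"
    have "B v v * B v v = 1" using v(2) by (auto simp: abs_if split: if_splits)
    then have "B z v = 0" unfolding z_def by (simp add: mult.assoc)
    moreover have "z \<in> N" unfolding z_def
      by (intro unimodular_in_simps[OF N] x v(1) Ints_mult)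
    ultimately have "z = (\<Sum>i<m. (B z (f i) * B (f i) (f i)) *\<^sub>R f i)"
      using f(3) by (auto simp: N'_def)
    also have "\<dots> = (\<Sum>i<m. (B x (g i) * B (g i) (g i)) *\<^sub>R g i)"
      using fv by (intro sum.cong) (auto simp: g_def z_def)
    finally show ?thesis by (simp add: z_def g_def algebra_simps)
  qed
  have "g i \<in> N \<and> \<bar>B (g i) (g i)\<bar> = 1" if "i < Suc m" for i
    using f(1)[of i] v that by (auto simp: g_def N'_def less_Suc_eq)
  moreover have "B (g i) (g j) = 0" if "i < Suc m" "j < Suc m" "i \<noteq> j" for i j
    using f(2)[of i j] fv[of i] fv[of j] that by (auto simp: g_def less_Suc_eq)
  ultimately show ?case using exp by blast
qed

lemma hyperbolic_plane_exists:
  assumes N: "unimodular_in N" and "\<not> has_unit_norm N" and "\<exists>x\<in>N. x \<noteq> 0"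
    and "dim (span N) \<le> 5 \<or> dim (span N) \<le> 6 \<and> \<not> definite (span N)"
  obtains x y where "x \<in> N" "y \<in> N" "B x x = 0" "B y y = 0" "B x y = 1"
proof -
  obtain z where "z \<in> N" "z \<noteq> 0" "B z z = 0"
    using unimodular_short_vector[OF N assms(3,4)] assms(2) by blast
  then show ?thesis
    using unit_norm_or_hyperbolic[OF N _ _ _ assms(2)] that by blast
qed

text \<open>Otherwise three hyperbolic planes split off, and the vectors \<open>x + y\<close> in
  them are three orthogonal vectors of positive square. Indefiniteness yields the first plane; the
  remainders have ranks 4 and 2, within the range of the reduction.\<close>

lemma has_unit_norm_rank6:
  assumes N: "unimodular_in N" and dim: "dim (span N) = 6" and indef: "\<not> definite (span N)"
    and pos: "\<And>a b c. B a a > 0 \<Longrightarrow> B b b > 0 \<Longrightarrow> B c c > 0 \<Longrightarrow>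
      B a b = 0 \<Longrightarrow> B a c = 0 \<Longrightarrow> B b c = 0 \<Longrightarrow> False"
  shows "has_unit_norm N"
proof (rule ccontr)
  assume even: "\<not> has_unit_norm N"
  obtain x1 y1 where 1: "x1 \<in> N" "y1 \<in> N" "B x1 x1 = 0" "B y1 y1 = 0" "B x1 y1 = 1"
    by (rule hyperbolic_plane_exists[OF N even dim_span_pos]) (use dim indef in auto)
  define N1 where "N1 = {z \<in> N. B z x1 = 0 \<and> B z y1 = 0}"
  have N1: "unimodular_in N1" "dim (span N1) = 4"
    using hyperbolic_split[OF N 1(1,3,2,4,5)] dim unfolding N1_def by auto
  have even1: "\<not> has_unit_norm N1"
    using even unfolding has_unit_norm_def N1_def by blast
  obtain x2 y2 where 2: "x2 \<in> N1" "y2 \<in> N1" "B x2 x2 = 0" "B y2 y2 = 0" "B x2 y2 = 1"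
    by (rule hyperbolic_plane_exists[OF N1(1) even1 dim_span_pos]) (use N1(2) in auto)
  define N2 where "N2 = {z \<in> N1. B z x2 = 0 \<and> B z y2 = 0}"
  have N2: "unimodular_in N2" "dim (span N2) = 2"
    using hyperbolic_split[OF N1(1) 2(1,3,2,4,5)] N1(2) unfolding N2_def by auto
  have even2: "\<not> has_unit_norm N2"
    using even1 unfolding has_unit_norm_def N2_def by blast
  obtain x3 y3 where 3: "x3 \<in> N2" "y3 \<in> N2" "B x3 x3 = 0" "B y3 y3 = 0" "B x3 y3 = 1"
    by (rule hyperbolic_plane_exists[OF N2(1) even2 dim_span_pos]) (use N2(2) in auto)
  have c: "B y1 x1 = 1" "B y2 x2 = 1" "B y3 x3 = 1"
    using 1(5) 2(5) 3(5) commute by metis+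
  show False
    using pos[of "x3 + y3" "x2 + y2" "x1 + y1"] 1 2 3 c by (simp add: N1_def N2_def)
qed

section \<open>Neighbours in the sense of Kneser\<close>

definition neighbour :: "'v set \<Rightarrow> 'v \<Rightarrow> 'v set" where
  "neighbour L e = {x. \<exists>l\<in>L. B l e \<in> \<int> \<and> (x = l \<or> x = l + e)}"

text \<open>If \<open>e\<close> paired integrally with all of \<open>L\<close>, it would agree as a
  functional with some \<open>w\<close> in \<open>L\<close>. Nondegeneracy concerns vectors of
  \<open>L\<close>, hence the comparison of \<open>2 w\<close> with \<open>2 e\<close>.\<close>

lemma half_pairing_exists:
  assumes L: "unimodular_in L" and e: "2 *\<^sub>R e \<in> L" "e \<notin> L"
  shows "\<exists>s\<in>L. B s e \<notin> \<int>"
proof (rule ccontr)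
  assume "\<not> ?thesis"
  then have int: "B e x \<in> \<int>" if "x \<in> L" for x using that commute by metis
  obtain w where w: "w \<in> L" "\<And>y. y \<in> L \<Longrightarrow> B w y = B e y"
    using unimodular_in_represent[OF L, of "B e"] int by auto
  have "2 *\<^sub>R w - 2 *\<^sub>R e \<in> L" by (intro unimodular_in_simps[OF L] e w) auto
  then have "2 *\<^sub>R w - 2 *\<^sub>R e = 0"
    by (rule unimodular_in_nondegenerate[OF L]) (simp add: w(2))
  then show False using w(1) e(2) by simp
qed

text \<open>The neighbour contains \<open>2 L\<close>, so a functional \<open>f\<close> on it
  induces \<open>x \<mapsto> f (2 x)\<close> on \<open>L\<close>, and half of the vector
  \<open>w\<close> representing the latter represents \<open>f\<close>. What remains is to place
  \<open>w / 2\<close> in the neighbour, by writing it as \<open>v + h\<close> with \<open>v\<close>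
  in \<open>L\<close> and \<open>h\<close> equal to 0 or \<open>e\<close>.\<close>

lemma neighbour_unimodular:
  assumes L: "unimodular_in L" and e: "2 *\<^sub>R e \<in> L" "e \<notin> L" "B e e \<in> \<int>"
  shows "unimodular_in (neighbour L e)"
proof -
  note Li = unimodular_in_simps[OF L]
  obtain s where s: "s \<in> L" "B s e \<notin> \<int>" using half_pairing_exists[OF L e(1,2)] by blast
  have half: "2 * B x e \<in> \<int>" if "x \<in> L" for x
    using Li(4)[OF that e(1)] by simp
  have e0: "e \<in> neighbour L e"
    unfolding neighbour_def using Li(1) by force
  have mem: "l \<in> neighbour L e" if "l \<in> L" "B l e \<in> \<int>" for l
    using that by (auto simp: neighbour_def)
  have dbl: "2 *\<^sub>R x \<in> neighbour L e" if "x \<in> L" for x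
    using Li(5)[OF _ that, of 2] half[OF that] by (intro mem) auto
  \<comment> \<open>This is why two cosets suffice in the definition: \<open>2 e\<close> falls back
    into the first one.\<close>
  have e2: "B (2 *\<^sub>R e) e \<in> \<int>" using e(3) by simp
  show ?thesis
    unfolding unimodular_in_def
  proof (intro conjI allI impI ballI)
    have "x + y \<in> neighbour L e \<and> x - y \<in> neighbour L e"
      if xy: "x \<in> neighbour L e" "y \<in> neighbour L e" for x y
    proof -
      obtain l m where l: "l \<in> L" "B l e \<in> \<int>" "x = l \<or> x = l + e"
        and m: "m \<in> L" "B m e \<in> \<int>" "y = m \<or> y = m + e"
        using xy by (auto simp: neighbour_def)
      have A: "l + m \<in> L \<and> B (l + m) e \<in> \<int>" "l - m \<in> L \<and> B (l - m) e \<in> \<int>"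
        "(l + m) + 2 *\<^sub>R e \<in> L \<and> B ((l + m) + 2 *\<^sub>R e) e \<in> \<int>"
        "(l - m) - 2 *\<^sub>R e \<in> L \<and> B ((l - m) - 2 *\<^sub>R e) e \<in> \<int>"
        using l m e(1) e2 Li(2,3) by auto
      have "x + y = l + m \<or> x + y = (l + m) + e \<or> x + y = (l + m) + 2 *\<^sub>R e"
        "x - y = l - m \<or> x - y = (l - m) + e \<or> x - y = ((l - m) - 2 *\<^sub>R e) + e"
        using l(3) m(3) by (auto simp: scaleR_2)
      then show ?thesis using A unfolding neighbour_def by blast
    qed
    moreover have "0 \<in> neighbour L e" using mem[OF Li(1)] by simp
    ultimately show "additive_subgroup (neighbour L e)"
      by (simp add: additive_subgroup_def)
  next
    fix x y assume "x \<in> neighbour L e" "y \<in> neighbour L e"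
    then obtain l m where lm: "l \<in> L" "B l e \<in> \<int>" "x = l \<or> x = l + e"
      "m \<in> L" "B m e \<in> \<int>" "y = m \<or> y = m + e"
      by (auto simp: neighbour_def)
    moreover have "B e m = B m e" by (rule commute)
    ultimately show "B x y \<in> \<int>"
      using Li(4)[OF lm(1,4)] e(3) by auto
  next
    fix x assume x: "x \<in> neighbour L e" "\<forall>y\<in>neighbour L e. B x y = 0"
    have "B (2 *\<^sub>R x) z = 0" if "z \<in> L" for z
      using x(2) dbl[OF that] by fastforce
    moreover have "2 *\<^sub>R x \<in> L"
      using x(1) e(1) Li(5)[of 2] Li(2) by (auto simp: neighbour_def scaleR_right_distrib)
    ultimately show "x = 0" using unimodular_in_nondegenerate[OF L] by fastforce
  next
    fix f :: "'v \<Rightarrow> real"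
    assume f: "(\<forall>x\<in>neighbour L e. f x \<in> \<int>) \<and>
      (\<forall>x\<in>neighbour L e. \<forall>y\<in>neighbour L e. f (x + y) = f x + f y)"
    then have fint: "\<And>x. x \<in> neighbour L e \<Longrightarrow> f x \<in> \<int>"
      and fadd: "\<And>x y. x \<in> neighbour L e \<Longrightarrow> y \<in> neighbour L e \<Longrightarrow> f (x + y) = f x + f y"
      by auto
    obtain w where w: "w \<in> L" "\<And>x. x \<in> L \<Longrightarrow> B w x = f (2 *\<^sub>R x)"
      using unimodular_in_represent[OF L, of "\<lambda>x. f (2 *\<^sub>R x)"] fint fadd dbl
      by (auto simp: scaleR_right_distrib)
    have fdbl: "f (2 *\<^sub>R x) = 2 * f x" if "x \<in> neighbour L e" for x
      using fadd[OF that that] by (simp add: scaleR_2)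
    have wl: "B w l = 2 * f l" if "l \<in> L" "B l e \<in> \<int>" for l
      using w(2)[OF that(1)] fdbl[OF mem[OF that]] by simp
    have we: "B w e = 2 * f e"
      using wl[OF e(1) e2] fdbl[OF e0] by simp
    have wy: "B ((1/2) *\<^sub>R w) y = f y" if y: "y \<in> neighbour L e" for y
    proof -
      obtain l where l: "l \<in> L" "B l e \<in> \<int>" "y = l \<or> y = l + e"
        using y by (auto simp: neighbour_def)
      then show ?thesis using wl[OF l(1,2)] we fadd[OF mem[OF l(1,2)] e0] by auto
    qed
    \<comment> \<open>A single test on \<open>s\<close> decides: half-integers differ by integers,
      so every vector of \<open>L\<close> pairs integrally with \<open>e\<close> either itself or
      after subtracting \<open>s\<close>.\<close>
    define h where "h = (if B w s / 2 \<in> \<int> then 0 else e)"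
    have h0: "h = 0 \<or> h = e" by (auto simp: h_def)
    have hs: "B w s / 2 - B h s \<in> \<int>"
    proof (cases "B w s / 2 \<in> \<int>")
      case False
      have "2 * B e s \<in> \<int>" "B e s \<notin> \<int>" using half[OF s(1)] s(2) commute by metis+
      moreover have "2 * (B w s / 2) \<in> \<int>" using Li(4)[OF w(1) s(1)] by simp
      ultimately show ?thesis using half_integers_diff False by (simp add: h_def)
    qed (simp add: h_def)
    have hl: "B w l / 2 - B h l \<in> \<int>" if "l \<in> L" "B l e \<in> \<int>" for l
      using wl[OF that] fint[OF mem[OF that]] that(2) h0 commute[of e l] by auto
    have int: "B w x / 2 - B h x \<in> \<int>" if x: "x \<in> L" for x
    proof (cases "B x e \<in> \<int>")
      case False
      then have "B (x - s) e \<in> \<int>" using half_integers_diff half s x by simp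
      then have "B w (x - s) / 2 - B h (x - s) \<in> \<int>" using hl Li(3)[OF x s(1)] by blast
      then have "(B w (x - s) / 2 - B h (x - s)) + (B w s / 2 - B h s) \<in> \<int>"
        using hs by (rule Ints_add)
      then show ?thesis by (simp add: diff_divide_distrib)
    qed (use hl x in blast)
    obtain v where v: "v \<in> L" "\<And>x. x \<in> L \<Longrightarrow> B v x = B w x / 2 - B h x"
      using unimodular_in_represent[OF L, of "\<lambda>x. B w x / 2 - B h x"] int by (auto simp: add_divide_distrib)
    have h2: "2 *\<^sub>R h \<in> L" using h0 e(1) Li(1) by auto
    have "2 *\<^sub>R v - w + 2 *\<^sub>R h \<in> L"
      by (intro Li v w h2) auto
    then have "2 *\<^sub>R v - w + 2 *\<^sub>R h = 0"
      by (rule unimodular_in_nondegenerate[OF L]) (simp add: v(2))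
    then have "w = 2 *\<^sub>R v + 2 *\<^sub>R h" by (metis diff_add_eq eq_iff_diff_eq_0)
    then have wv: "(1/2) *\<^sub>R w = v + h" by (simp add: scaleR_right_distrib)
    have "B v e = f e - B h e" using wy[OF e0] wv by simp
    moreover have "B h e \<in> \<int>" using h0 e(3) by auto
    ultimately have "B v e \<in> \<int>" using fint[OF e0] by simp
    then have "v + h \<in> neighbour L e"
      using v(1) h0 unfolding neighbour_def by auto
    then show "\<exists>w\<in>neighbour L e. \<forall>y\<in>neighbour L e. B w y = f y"
      using wy unfolding wv by blast
  qed
qed

lemma orth_family_split:
  assumes "unimodular_in N" and "\<And>i. i < n \<Longrightarrow> e i \<in> N \<and> \<bar>B (e i) (e i)\<bar> = 1"
    and "\<And>i j. i < n \<Longrightarrow> j < n \<Longrightarrow> i \<noteq> j \<Longrightarrow> B (e i) (e j) = 0"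
  shows "unimodular_in {x \<in> N. \<forall>i<n. B x (e i) = 0} \<and>
    dim (span N) = n + dim (span {x \<in> N. \<forall>i<n. B x (e i) = 0})"
  using assms
proof (induction n)
  case (Suc n)
  define N' where "N' = {x \<in> N. \<forall>i<n. B x (e i) = 0}"
  have N': "unimodular_in N'" "dim (span N) = n + dim (span N')"
    using Suc.IH Suc.prems unfolding N'_def by auto
  have "e n \<in> N'" "\<bar>B (e n) (e n)\<bar> = 1" using Suc.prems by (auto simp: N'_def)
  note sp = unit_split[OF N'(1) this]
  have "{x \<in> N'. B x (e n) = 0} = {x \<in> N. \<forall>i<Suc n. B x (e i) = 0}"
    by (auto simp: N'_def less_Suc_eq)
  then show ?case using sp N'(2) by simp
qed simp

end

lemma odd_square_mod8:
  fixes k :: int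
  assumes "odd k"
  shows "\<exists>m. k * k = 8 * m + 1"
proof -
  obtain q where q: "k = 2 * q + 1" using assms by (rule oddE)
  have "even (q * (q + 1))" by simp
  then obtain m where "q * (q + 1) = 2 * m" by (rule evenE)
  then have "k * k = 8 * m + 1" unfolding q by (simp add: algebra_simps)
  then show ?thesis by blast
qed

lemma even_square_mod4:
  fixes k :: int
  assumes "even k"
  shows "\<exists>m. k * k = 4 * m"
proof -
  obtain q where q: "k = 2 * q" using assms by (rule evenE)
  have "k * k = 4 * (q * q)" unfolding q by simp
  then show ?thesis by blast
qed

lemma half_of_int: "real_of_int k / 2 \<in> \<int> \<longleftrightarrow> even k"
proof
  assume "real_of_int k / 2 \<in> \<int>"
  then obtain m where "real_of_int k / 2 = of_int m" by (auto elim: Ints_cases)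
  then have "real_of_int k = of_int (2 * m)" by simp
  then have "k = 2 * m" by (simp only: of_int_eq_iff)
  then show "even k" by simp
qed (auto elim!: evenE)

text \<open>Sorting by a two-valued key. It will bring the basis vectors with odd pairing to the
  front, so that only the numbers of odd coordinates matter.\<close>

lemma list_sorted_by_predicate:
  assumes "finite S"
  obtains xs where "distinct xs" "set xs = S" "sorted_wrt (\<lambda>i j. P j \<longrightarrow> P i) xs"
proof -
  define key where "key i = (if P i then 0 else 1 :: nat)" for i
  obtain ys where ys: "set ys = S" "distinct ys" using finite_distinct_list[OF assms] by blast
  have "sorted_wrt (\<lambda>i j. key i \<le> key j) (sort_key key ys)"
    using sorted_sort_key[of key ys] by (simp add: sorted_map)
  then have "sorted_wrt (\<lambda>i j. P j \<longrightarrow> P i) (sort_key key ys)"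
    by (rule sorted_wrt_mono_rel[rotated]) (auto simp: key_def split: if_splits)
  then show ?thesis using that[of "sort_key key ys"] ys by simp
qed

section \<open>Definite subspaces and inertia\<close>

context sym_form
begin

text \<open>The factor \<epsilon> treats both signs at once. A vector of nonzero square orthogonal
  to the previous span lies outside it and contributes a square of the same sign.\<close>

lemma definite_span_orth:
  assumes "finite F" and "\<And>z. z \<in> span S \<Longrightarrow> z \<noteq> 0 \<Longrightarrow> \<epsilon> * B z z > 0"
    and "\<And>v. v \<in> F \<Longrightarrow> \<epsilon> * B v v > 0"
    and "\<And>v w. v \<in> F \<Longrightarrow> w \<in> F \<Longrightarrow> v \<noteq> w \<Longrightarrow> B v w = 0"
    and "\<And>v w. v \<in> F \<Longrightarrow> w \<in> S \<Longrightarrow> B w v = 0"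
  shows "dim (S \<union> F) = dim S + card F \<and> (\<forall>z\<in>span (S \<union> F). z \<noteq> 0 \<longrightarrow> \<epsilon> * B z z > 0)"
  using assms
proof (induction F rule: finite_induct)
  case (insert v F)
  define G where "G = S \<union> F"
  have IH: "dim G = dim S + card F" "\<And>z. z \<in> span G \<Longrightarrow> z \<noteq> 0 \<Longrightarrow> \<epsilon> * B z z > 0"
    using insert unfolding G_def by auto
  have orthG: "B w v = 0" if "w \<in> G" for w
    using that insert.hyps(2) insert.prems(3)[of w v] insert.prems(4)[of v w] by (auto simp: G_def)
  have orth: "B z v = 0" if "z \<in> span G" for z
    using orth_span[OF orthG that] .
  have v: "\<epsilon> * B v v > 0" using insert.prems(2) by simp
  then have "v \<notin> span G" using orth by force
  then have "dim (insert v G) = dim S + card (insert v F)"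
    using IH(1) insert.hyps by (simp add: dim_insert)
  moreover have "\<epsilon> * B z z > 0" if z: "z \<in> span (insert v G)" "z \<noteq> 0" for z
  proof -
    obtain t where t: "z - t *\<^sub>R v \<in> span G" using z(1) span_breakdown_eq by blast
    define w where "w = z - t *\<^sub>R v"
    have w: "w \<in> span G" "z = w + t *\<^sub>R v" using t by (simp_all add: w_def)
    have "B w v = 0" using orth w(1) by blast
    then have "B v w = 0" using commute by metis
    then have eq: "\<epsilon> * B z z = \<epsilon> * B w w + (t * t) * (\<epsilon> * B v v)"
      using \<open>B w v = 0\<close> unfolding w(2) by (simp add: algebra_simps)
    show ?thesis
    proof (cases "w = 0")
      case True
      then have "t \<noteq> 0" using w(2) z(2) by auto
      then have "t * t > 0" by (auto simp: zero_less_mult_iff)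
      then have "t * t * (\<epsilon> * B v v) > 0" using v by (rule mult_pos_pos)
      moreover have "\<epsilon> * B w w = 0" using True by simp
      ultimately show ?thesis using eq by linarith
    next
      case False
      have "(t * t) * (\<epsilon> * B v v) \<ge> 0" using v by simp
      then show ?thesis using eq IH(2)[OF w(1) False] by linarith
    qed
  qed
  moreover have "S \<union> insert v F = insert v G" by (simp add: G_def)
  ultimately show ?case by simp
qed auto

text \<open>A positive and a negative definite subspace meet only in 0. This inequality takes the
  role of Sylvester's law of inertia.\<close>

lemma definite_dim_bound:
  fixes P Q :: "'v set"
  assumes "subspace P" "subspace Q"
    and "\<And>z. z \<in> P \<Longrightarrow> z \<noteq> 0 \<Longrightarrow> B z z > 0" and "\<And>z. z \<in> Q \<Longrightarrow> z \<noteq> 0 \<Longrightarrow> B z z < 0"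
  shows "dim P + dim Q \<le> DIM('v)"
proof -
  have "P \<inter> Q \<subseteq> {0}"
  proof
    fix z assume "z \<in> P \<inter> Q"
    then show "z \<in> {0}" using assms(3)[of z] assms(4)[of z] by fastforce
  qed
  then have "dim (P \<inter> Q) = 0" by simp
  then have "dim P + dim Q = dim {x + y |x y. x \<in> P \<and> y \<in> Q}"
    using dim_sums_Int[OF assms(1,2)] by linarith
  then show ?thesis using dim_subset_UNIV by simp
qed

section \<open>Frames, and reflections in vectors of square -2\<close>

definition frame24 :: "'v set \<Rightarrow> 'v \<Rightarrow> 'v \<Rightarrow> 'v \<Rightarrow> 'v \<Rightarrow> 'v \<Rightarrow> 'v \<Rightarrow> bool" where
  "frame24 M p q a b c d \<longleftrightarrow> {p, q, a, b, c, d} \<subseteq> M \<and>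
     B p p = 1 \<and> B q q = 1 \<and> B a a = -1 \<and> B b b = -1 \<and> B c c = -1 \<and> B d d = -1 \<and>
     B p q = 0 \<and> B p a = 0 \<and> B p b = 0 \<and> B p c = 0 \<and> B p d = 0 \<and>
     B q a = 0 \<and> B q b = 0 \<and> B q c = 0 \<and> B q d = 0 \<and>
     B a b = 0 \<and> B a c = 0 \<and> B a d = 0 \<and> B b c = 0 \<and> B b d = 0 \<and> B c d = 0 \<and>
     (\<forall>x\<in>M. x = B x p *\<^sub>R p + B x q *\<^sub>R q - B x a *\<^sub>R a - B x b *\<^sub>R b - B x c *\<^sub>R c - B x d *\<^sub>R d)"

text \<open>The coordinate along a vector of square 2 is half the pairing, so its integrality has to
  be demanded; along a vector of square -1 it is minus the pairing and integral in any integral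
  lattice.\<close>

definition target_frame :: "'v set \<Rightarrow> 'v \<Rightarrow> 'v \<Rightarrow> 'v \<Rightarrow> 'v \<Rightarrow> 'v \<Rightarrow> 'v \<Rightarrow> bool" where
  "target_frame T p q a b c d \<longleftrightarrow> {p, q, a, b, c, d} \<subseteq> T \<and>
     B p p = 2 \<and> B q q = 2 \<and> B a a = -1 \<and> B b b = -1 \<and> B c c = -1 \<and> B d d = -1 \<and>
     B p q = 0 \<and> B p a = 0 \<and> B p b = 0 \<and> B p c = 0 \<and> B p d = 0 \<and>
     B q a = 0 \<and> B q b = 0 \<and> B q c = 0 \<and> B q d = 0 \<and>
     B a b = 0 \<and> B a c = 0 \<and> B a d = 0 \<and> B b c = 0 \<and> B b d = 0 \<and> B c d = 0 \<and>
     (\<forall>x\<in>T. B x p / 2 \<in> \<int> \<and> B x q / 2 \<in> \<int> \<and>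
       x = (B x p / 2) *\<^sub>R p + (B x q / 2) *\<^sub>R q - B x a *\<^sub>R a - B x b *\<^sub>R b - B x c *\<^sub>R c - B x d *\<^sub>R d)"

lemma frame24_sym:
  assumes "frame24 M p q a b c d"
  shows "B q p = 0" "B a p = 0" "B b p = 0" "B c p = 0" "B d p = 0" "B a q = 0" "B b q = 0"
    "B c q = 0" "B d q = 0" "B b a = 0" "B c a = 0" "B d a = 0" "B c b = 0" "B d b = 0" "B d c = 0"
  using assms unfolding frame24_def by (metis commute)+

lemma frame24_rotate: "frame24 M p q a b c d \<Longrightarrow> frame24 M p q a c d b"
  using frame24_sym[of M p q a b c d] by (auto simp: frame24_def algebra_simps)

text \<open>For \<open>r\<close> of square -2 the reflection has integral coefficient
  \<open>B z r\<close>, so it is an isometric involution of \<open>M\<close>. Applying it to the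
  expansion of \<open>\<sigma> x\<close> gives that of \<open>x\<close> in the reflected
  frame.\<close>

lemma frame24_reflect:
  assumes M: "unimodular_in M" and fr: "frame24 M p q a b c d" and r: "r \<in> M" "B r r = - 2"
  defines "\<sigma> \<equiv> \<lambda>z. z + B z r *\<^sub>R r"
  shows "frame24 M (\<sigma> p) (\<sigma> q) (\<sigma> a) (\<sigma> b) (\<sigma> c) (\<sigma> d)"
proof -
  have iso: "B (\<sigma> x) (\<sigma> y) = B x y" for x y
    using r(2) commute[of r y] by (simp add: \<sigma>_def algebra_simps)
  have mem: "\<sigma> x \<in> M" if "x \<in> M" for x
    unfolding \<sigma>_def by (intro unimodular_in_simps[OF M] that r(1))
  have inv: "\<sigma> (\<sigma> x) = x" for x
    using r(2) by (simp add: \<sigma>_def algebra_simps)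
  have lin: "linear \<sigma>" by (rule linearI) (simp_all add: \<sigma>_def algebra_simps)
  note lin_simps = linear_add[OF lin] linear_diff[OF lin] linear_scale[OF lin]
  have exp: "x = B x (\<sigma> p) *\<^sub>R \<sigma> p + B x (\<sigma> q) *\<^sub>R \<sigma> q - B x (\<sigma> a) *\<^sub>R \<sigma> a - B x (\<sigma> b) *\<^sub>R \<sigma> b
      - B x (\<sigma> c) *\<^sub>R \<sigma> c - B x (\<sigma> d) *\<^sub>R \<sigma> d" if x: "x \<in> M" for x
  proof -
    have "\<sigma> x = B (\<sigma> x) p *\<^sub>R p + B (\<sigma> x) q *\<^sub>R q - B (\<sigma> x) a *\<^sub>R a - B (\<sigma> x) b *\<^sub>R b
        - B (\<sigma> x) c *\<^sub>R c - B (\<sigma> x) d *\<^sub>R d"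
      using fr mem[OF x] unfolding frame24_def by blast
    then have "\<sigma> (\<sigma> x) = \<sigma> (B (\<sigma> x) p *\<^sub>R p + B (\<sigma> x) q *\<^sub>R q - B (\<sigma> x) a *\<^sub>R a - B (\<sigma> x) b *\<^sub>R b
        - B (\<sigma> x) c *\<^sub>R c - B (\<sigma> x) d *\<^sub>R d)" by (rule arg_cong)
    moreover have "B (\<sigma> x) z = B x (\<sigma> z)" for z
      using iso[of "\<sigma> x" z] inv[of x] iso[of x "\<sigma> z"] inv[of z] by metis
    ultimately show ?thesis unfolding inv lin_simps by simp
  qed
  show ?thesis
    unfolding frame24_def iso
    using fr mem exp unfolding frame24_def by (intro conjI ballI) auto
qed

lemma frame24_ints:
  assumes "unimodular_in M" "frame24 M p q a b c d" "x \<in> M"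
  obtains k1 k2 k3 k4 k5 k6 where
    "B x p = of_int k1" "B x q = of_int k2" "B x a = of_int k3" "B x b = of_int k4"
    "B x c = of_int k5" "B x d = of_int k6"
proof -
  have "B x z \<in> \<int>" if "z \<in> {p, q, a, b, c, d}" for z
    using unimodular_in_simps(4)[OF assms(1,3)] assms(2) that unfolding frame24_def by blast
  from this[of p] this[of q] this[of a] this[of b] this[of c] this[of d] that
  show ?thesis by (auto elim!: Ints_cases)
qed

lemma frame24_pair:
  assumes "frame24 M p q a b c d" "x \<in> M"
  shows "B u x = B x p * B u p + B x q * B u q - B x a * B u a - B x b * B u b
    - B x c * B u c - B x d * B u d"
proof -
  have "B u x = B u (B x p *\<^sub>R p + B x q *\<^sub>R q - B x a *\<^sub>R a - B x b *\<^sub>R b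
        - B x c *\<^sub>R c - B x d *\<^sub>R d)"
    using assms unfolding frame24_def by metis
  then show ?thesis by simp
qed

text \<open>With \<open>u\<close> odd on \<open>p\<close> and \<open>q\<close> and even on the rest,
  evenness of \<open>B u x\<close> says that the first two coordinates of \<open>x\<close> have even
  sum. Such pairs are spanned by the orthogonal vectors \<open>p + q\<close> and
  \<open>p - q\<close> of square 2.\<close>

lemma target_frame_20:
  assumes M: "unimodular_in M" and fr: "frame24 M p q a b c d" and u: "u \<in> M"
    and k: "B u p = of_int k1" "odd k1" "B u q = of_int k2" "odd k2" "B u a = of_int k3" "even k3"
      "B u b = of_int k4" "even k4" "B u c = of_int k5" "even k5" "B u d = of_int k6" "even k6"
  shows "target_frame {y \<in> M. B u y / 2 \<in> \<int>} (p + q) (p - q) a b c d"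
proof -
  have mem: "p \<in> M" "q \<in> M" "a \<in> M" "b \<in> M" "c \<in> M" "d \<in> M"
    using fr by (auto simp: frame24_def)
  have mem2: "p + q \<in> M" "p - q \<in> M" by (intro unimodular_in_simps[OF M] mem)+
  have ev: "even (k1 + k2)" "even (k1 - k2)" using k by auto
  have par: "B u (p + q) / 2 \<in> \<int>" "B u (p - q) / 2 \<in> \<int>" "B u a / 2 \<in> \<int>" "B u b / 2 \<in> \<int>"
    "B u c / 2 \<in> \<int>" "B u d / 2 \<in> \<int>"
    using ev[folded half_of_int] k(6,8,10,12)[folded half_of_int] k by simp_all
  have exp: "B x (p + q) / 2 \<in> \<int> \<and> B x (p - q) / 2 \<in> \<int> \<and>
      x = (B x (p + q) / 2) *\<^sub>R (p + q) + (B x (p - q) / 2) *\<^sub>R (p - q)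
        - B x a *\<^sub>R a - B x b *\<^sub>R b - B x c *\<^sub>R c - B x d *\<^sub>R d"
    if x: "x \<in> M" "B u x / 2 \<in> \<int>" for x
  proof -
    obtain n1 n2 n3 n4 n5 n6 where n: "B x p = of_int n1" "B x q = of_int n2" "B x a = of_int n3"
      "B x b = of_int n4" "B x c = of_int n5" "B x d = of_int n6"
      using frame24_ints[OF M fr x(1)] .
    have "B u x = of_int (n1 * k1 + n2 * k2 - n3 * k3 - n4 * k4 - n5 * k5 - n6 * k6)"
      unfolding frame24_pair[OF fr x(1)] n using k by simp
    then have "even (n1 * k1 + n2 * k2 - n3 * k3 - n4 * k4 - n5 * k5 - n6 * k6)"
      using x(2) by (metis half_of_int)
    then have ev: "even (n1 + n2)" "even (n1 - n2)" using k by auto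
    have "(B x (p + q) / 2) *\<^sub>R (p + q) + (B x (p - q) / 2) *\<^sub>R (p - q)
        = ((B x p + B x q) / 2 + (B x p - B x q) / 2) *\<^sub>R p
          + ((B x p + B x q) / 2 - (B x p - B x q) / 2) *\<^sub>R q"
      by (simp add: algebra_simps)
    also have "\<dots> = B x p *\<^sub>R p + B x q *\<^sub>R q" by (simp add: field_simps)
    finally have "x = (B x (p + q) / 2) *\<^sub>R (p + q) + (B x (p - q) / 2) *\<^sub>R (p - q)
        - B x a *\<^sub>R a - B x b *\<^sub>R b - B x c *\<^sub>R c - B x d *\<^sub>R d"
      using fr x(1) unfolding frame24_def by simp
    moreover have "B x (p + q) / 2 \<in> \<int>" "B x (p - q) / 2 \<in> \<int>"
      using ev[folded half_of_int] n by simp_all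
    ultimately show ?thesis by blast
  qed
  show ?thesis
    unfolding target_frame_def
  proof (intro conjI)
    show "{p + q, p - q, a, b, c, d} \<subseteq> {y \<in> M. B u y / 2 \<in> \<int>}"
      using mem mem2 par by blast
    show "\<forall>x\<in>{y \<in> M. B u y / 2 \<in> \<int>}. B x (p + q) / 2 \<in> \<int> \<and> B x (p - q) / 2 \<in> \<int> \<and>
      x = (B x (p + q) / 2) *\<^sub>R (p + q) + (B x (p - q) / 2) *\<^sub>R (p - q)
        - B x a *\<^sub>R a - B x b *\<^sub>R b - B x c *\<^sub>R c - B x d *\<^sub>R d"
      using exp by blast
  qed (use fr frame24_sym[OF fr] in \<open>simp_all add: frame24_def\<close>)
qed

lemma target_frame_13:
  assumes M: "unimodular_in M" and fr: "frame24 M p q a b c d" and u: "u \<in> M"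
    and k: "B u p = of_int k1" "odd k1" "B u q = of_int k2" "even k2" "B u a = of_int k3" "odd k3"
      "B u b = of_int k4" "odd k4" "B u c = of_int k5" "odd k5" "B u d = of_int k6" "even k6"
  shows "\<exists>p q a b c d. target_frame {y \<in> M. B u y / 2 \<in> \<int>} p q a b c d"
proof -
  have mem: "q \<in> M" "a \<in> M" "b \<in> M" "c \<in> M" using fr by (auto simp: frame24_def)
  \<comment> \<open>The square is \<open>1 - 3 = -2\<close>, and \<open>r\<close> pairs oddly with
    \<open>u\<close>; so the reflection flips the parities at \<open>q\<close>, \<open>a\<close>,
    \<open>b\<close>, \<open>c\<close> and keeps those at \<open>p\<close> and
    \<open>d\<close>.\<close>
  define r where "r = q + a + b + c"
  have r: "r \<in> M" unfolding r_def by (intro unimodular_in_simps[OF M] mem)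
  have Br: "B r r = - 2" "B p r = 0" "B q r = 1" "B a r = - 1" "B b r = - 1" "B c r = - 1" "B d r = 0"
    using fr frame24_sym[OF fr] by (simp_all add: r_def frame24_def)
  define l where "l = k2 + k3 + k4 + k5"
  have ur: "B u r = of_int l" unfolding r_def l_def using k by simp
  have l: "odd l" unfolding l_def using k by simp
  show ?thesis
    using target_frame_20[OF M frame24_reflect[OF M fr r Br(1)] u,
        of k1 "k2 + l" "k3 - l" "k4 - l" "k5 - l" k6] Br ur k l by fastforce
qed

lemma target_frame_02:
  assumes M: "unimodular_in M" and fr: "frame24 M p q a b c d" and u: "u \<in> M"
    and k: "B u p = of_int k1" "even k1" "B u q = of_int k2" "even k2" "B u a = of_int k3" "odd k3"
      "B u b = of_int k4" "odd k4" "B u c = of_int k5" "even k5" "B u d = of_int k6" "even k6"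
  shows "\<exists>p q a b c d. target_frame {y \<in> M. B u y / 2 \<in> \<int>} p q a b c d"
proof -
  have mem: "p \<in> M" "b \<in> M" "c \<in> M" "d \<in> M" using fr by (auto simp: frame24_def)
  \<comment> \<open>Flipping the parities at \<open>p\<close>, \<open>b\<close>, \<open>c\<close>,
    \<open>d\<close> turns (0,0;1,1,0,0) into (1,0;1,0,1,1); the rotation then moves the even entry
    \<open>b\<close> to the end.\<close>
  define r where "r = p + b + c + d"
  have r: "r \<in> M" unfolding r_def by (intro unimodular_in_simps[OF M] mem)
  have Br: "B r r = - 2" "B p r = 1" "B q r = 0" "B a r = 0" "B b r = - 1" "B c r = - 1" "B d r = - 1"
    using fr frame24_sym[OF fr] by (simp_all add: r_def frame24_def)
  define l where "l = k1 + k4 + k5 + k6"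
  have ur: "B u r = of_int l" unfolding r_def l_def using k by simp
  have l: "odd l" unfolding l_def using k by simp
  show ?thesis
    by (rule target_frame_13[OF M frame24_rotate[OF frame24_reflect[OF M fr r Br(1)]] u,
        of "k1 + l" k2 k3 "k5 - l" "k6 - l" "k4 - l"])
      (use Br ur k l in auto)
qed

end

section \<open>The complement of a sublattice of type \<open>D\<^sub>6\<close>\<close>

text \<open>The vectors \<open>e i - e 0\<close> and \<open>2 e 0\<close> generate
  \<open>D_6(-1)\<close>, and the absence of \<open>e 0\<close> from \<open>L\<close> is what its
  being saturated contributes. The definite subspaces \<open>P\<close> and \<open>Q\<close> carry
  the signature.\<close>

locale D6_sublattice = sym_form B for B :: "'v::euclidean_space \<Rightarrow> 'v \<Rightarrow> real" +
  fixes L P Q :: "'v set" and e :: "nat \<Rightarrow> 'v"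
  assumes dim12: "DIM('v) = 12"
    and L: "unimodular_in L" and span_L: "span L = UNIV" and odd_L: "\<exists>x\<in>L. B x x / 2 \<notin> \<int>"
    and P: "subspace P" "dim P = 2" "\<And>z. z \<in> P \<Longrightarrow> z \<noteq> 0 \<Longrightarrow> B z z > 0"
    and Q: "subspace Q" "dim Q = 10" "\<And>z. z \<in> Q \<Longrightarrow> z \<noteq> 0 \<Longrightarrow> B z z < 0"
    and e_orth: "\<And>i j. i < 6 \<Longrightarrow> j < 6 \<Longrightarrow> B (e i) (e j) = (if i = j then - 1 else 0)"
    and e_diff: "\<And>i. i < 6 \<Longrightarrow> e i - e 0 \<in> L"
    and e_dbl: "2 *\<^sub>R e 0 \<in> L" and e_not: "e 0 \<notin> L"
begin

definition M :: "'v set" where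
  "M = {x \<in> neighbour L (e 0). \<forall>i<6. B x (e i) = 0}"

lemma neighbour_L: "unimodular_in (neighbour L (e 0))"
  using neighbour_unimodular[OF L e_dbl e_not] e_orth[of 0 0] by simp

lemma L_neighbour: "x \<in> L \<Longrightarrow> B x (e 0) \<in> \<int> \<Longrightarrow> x \<in> neighbour L (e 0)"
  by (auto simp: neighbour_def)

lemma e_neighbour: "i < 6 \<Longrightarrow> e i \<in> neighbour L (e 0)"
  using e_diff[of i] e_orth[of i 0] e_orth[of 0 0]
  unfolding neighbour_def by (intro CollectI bexI[of _ "e i - e 0"]) auto

lemma unimodular_M: "unimodular_in M"
  and dim_M: "dim (span M) = 6"
proof -
  have "L \<subseteq> span (neighbour L (e 0))"
  proof
    fix x assume x: "x \<in> L"
    have "2 * B x (e 0) \<in> \<int>"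
      using unimodular_in_simps(4)[OF L x e_dbl] by simp
    then have "2 *\<^sub>R x \<in> neighbour L (e 0)"
      by (intro L_neighbour[OF unimodular_in_simps(5)[OF L _ x]]) auto
    then have "(1/2) *\<^sub>R (2 *\<^sub>R x) \<in> span (neighbour L (e 0))"
      by (intro span_scale span_base)
    then show "x \<in> span (neighbour L (e 0))" by simp
  qed
  then have "span (neighbour L (e 0)) = UNIV"
    using span_L span_minimal[OF _ subspace_span] by blast
  then have "dim (span (neighbour L (e 0))) = 12" using dim12 by simp
  moreover have "unimodular_in M \<and> dim (span (neighbour L (e 0))) = 6 + dim (span M)"
    unfolding M_def by (rule orth_family_split[OF neighbour_L]) (use e_neighbour e_orth in auto)
  ultimately show "unimodular_in M" "dim (span M) = 6" by auto
qed

lemma orth_family_bounds: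
  assumes "finite F" and "\<And>v w. v \<in> F \<Longrightarrow> w \<in> F \<Longrightarrow> v \<noteq> w \<Longrightarrow> B v w = 0"
  shows "(\<And>v. v \<in> F \<Longrightarrow> B v v > 0) \<Longrightarrow> card F \<le> 2"
    and "(\<And>v. v \<in> F \<Longrightarrow> B v v < 0) \<Longrightarrow> card F \<le> 10"
proof -
  assume pos: "\<And>v. v \<in> F \<Longrightarrow> B v v > 0"
  have "dim F = card F" "\<And>z. z \<in> span F \<Longrightarrow> z \<noteq> 0 \<Longrightarrow> B z z > 0"
    using definite_span_orth[OF assms(1), of "{}" 1] pos assms(2) by auto
  then show "card F \<le> 2"
    using definite_dim_bound[OF subspace_span Q(1), of F] Q(2,3) dim12 by simp
next
  assume neg: "\<And>v. v \<in> F \<Longrightarrow> B v v < 0"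
  have "dim F = card F" "\<And>z. z \<in> span F \<Longrightarrow> z \<noteq> 0 \<Longrightarrow> B z z < 0"
    using definite_span_orth[OF assms(1), of "{}" "- 1"] neg assms(2) by auto
  then show "card F \<le> 10"
    using definite_dim_bound[OF P(1) subspace_span, of F] P(2,3) dim12 by simp
qed

lemma e_inj: "inj_on e {..<6}"
proof (rule inj_onI)
  fix i j assume ij: "i \<in> {..<6}" "j \<in> {..<6}" "e i = e j"
  then show "i = j" using e_orth[of i j] e_orth[of i i] by (auto split: if_splits)
qed

text \<open>A positive definite \<open>M\<close> of rank 6 would be too large beside
  \<open>Q\<close>. A negative definite one would form, with the six \<open>e i\<close>, a negative
  definite space of dimension 12 and leave no room for \<open>P\<close>.\<close>

lemma indefinite_M: "\<not> definite (span M)"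
proof
  assume "definite (span M)"
  then consider (pos) "\<And>z. z \<in> span M \<Longrightarrow> z \<noteq> 0 \<Longrightarrow> B z z > 0"
    | (neg) "\<And>z. z \<in> span M \<Longrightarrow> z \<noteq> 0 \<Longrightarrow> B z z < 0"
    unfolding definite_def by blast
  then show False
  proof cases
    case pos
    have "dim (span M) + dim Q \<le> DIM('v)"
      by (rule definite_dim_bound[OF subspace_span Q(1) pos Q(3)])
    then show False using dim_M Q(2) dim12 by simp
  next
    case neg
    have "dim (M \<union> e ` {..<6}) = dim M + card (e ` {..<6}) \<and>
      (\<forall>z\<in>span (M \<union> e ` {..<6}). z \<noteq> 0 \<longrightarrow> (- 1) * B z z > 0)"
    proof (rule definite_span_orth)
      show "\<And>z. z \<in> span M \<Longrightarrow> z \<noteq> 0 \<Longrightarrow> 0 < - 1 * B z z" using neg by simp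
    qed (use e_orth in \<open>auto simp: M_def\<close>)
    then have dim': "dim (span (M \<union> e ` {..<6})) = 12" and
      neg': "\<And>z. z \<in> span (M \<union> e ` {..<6}) \<Longrightarrow> z \<noteq> 0 \<Longrightarrow> B z z < 0"
      using dim_M card_image[OF e_inj] by auto
    have "dim P + dim (span (M \<union> e ` {..<6})) \<le> DIM('v)"
      by (rule definite_dim_bound[OF P(1) subspace_span P(3) neg'])
    then show False using dim' P(2) dim12 by simp
  qed
qed

lemma exists_half_pairing:
  obtains s K where "s \<in> L" "\<And>i. i < 6 \<Longrightarrow> odd (K i :: int) \<and> 2 * B s (e i) = of_int (K i)"
proof -
  obtain s where s: "s \<in> L" "B s (e 0) \<notin> \<int>" using half_pairing_exists[OF L e_dbl e_not] by blast
  have "2 * B s (e 0) \<in> \<int>"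
    using unimodular_in_simps(4)[OF L s(1) e_dbl] by simp
  then obtain K0 where K0: "2 * B s (e 0) = of_int K0" by (auto elim: Ints_cases)
  have "B s (e 0) = of_int K0 / 2" using K0 by simp
  then have oddK0: "odd K0" using s(2) half_of_int by metis
  have "\<exists>k. odd k \<and> 2 * B s (e i) = of_int k" if i: "i < 6" for i
  proof -
    obtain m where m: "B s (e i - e 0) = of_int m"
      using unimodular_in_simps(4)[OF L s(1) e_diff[OF i]] by (auto elim: Ints_cases)
    have "2 * B s (e i) = of_int (K0 + 2 * m)" using K0 m by simp
    moreover have "odd (K0 + 2 * m)" using oddK0 by simp
    ultimately show ?thesis by blast
  qed
  then have "\<exists>K. \<forall>i<6. odd (K i) \<and> 2 * B s (e i) = real_of_int (K i)" by metis
  then show ?thesis using that s(1) by blast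
qed

text \<open>Counting fixes the signs of an orthonormal basis: at most two vectors are positive, and
  at most four negative because the six \<open>e i\<close> use up part of the ten. The side
  conditions sort the vectors so that odd pairings with \<open>u\<close> come first.\<close>

lemma M_frame:
  fixes u :: 'v
  obtains p q a b c d where "frame24 M p q a b c d"
    "B u q / 2 \<notin> \<int> \<longrightarrow> B u p / 2 \<notin> \<int>" "B u b / 2 \<notin> \<int> \<longrightarrow> B u a / 2 \<notin> \<int>"
    "B u c / 2 \<notin> \<int> \<longrightarrow> B u b / 2 \<notin> \<int>" "B u d / 2 \<notin> \<int> \<longrightarrow> B u c / 2 \<notin> \<int>"
proof -
  have "has_unit_norm M"
  proof (rule has_unit_norm_rank6[OF unimodular_M dim_M indefinite_M])
    fix a b c assume *: "B a a > 0" "B b b > 0" "B c c > 0" "B a b = 0" "B a c = 0" "B b c = 0"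
    then have "a \<noteq> b" "a \<noteq> c" "b \<noteq> c" by auto
    moreover have "B b a = 0" "B c a = 0" "B c b = 0" using * commute by metis+
    moreover have "card {a, b, c} \<le> 2"
      by (rule orth_family_bounds(1)) (use * calculation in auto)
    ultimately show False by simp
  qed
  then have "6 = (0::nat) \<or> has_unit_norm M" by simp
  from orthonormal_basis[OF unimodular_M dim_M order_refl this]
  obtain f :: "nat \<Rightarrow> 'v" where f0: "\<forall>i<6. f i \<in> M \<and> \<bar>B (f i) (f i)\<bar> = 1"
    "\<forall>i<6. \<forall>j<6. i \<noteq> j \<longrightarrow> B (f i) (f j) = 0"
    "\<forall>x\<in>M. x = (\<Sum>i<6. (B x (f i) * B (f i) (f i)) *\<^sub>R f i)"
    by blast
  have f: "\<And>i. i < 6 \<Longrightarrow> f i \<in> M" "\<And>i. i < 6 \<Longrightarrow> \<bar>B (f i) (f i)\<bar> = 1"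
    "\<And>i j. i < 6 \<Longrightarrow> j < 6 \<Longrightarrow> i \<noteq> j \<Longrightarrow> B (f i) (f j) = 0"
    "\<And>x. x \<in> M \<Longrightarrow> x = (\<Sum>i<6. (B x (f i) * B (f i) (f i)) *\<^sub>R f i)"
    using f0 by blast+
  have pm: "B (f i) (f i) = 1 \<or> B (f i) (f i) = - 1" if "i < 6" for i
    using f(2)[OF that] by linarith
  have inj: "inj_on f {..<6}"
  proof (rule inj_onI)
    fix i j assume ij: "i \<in> {..<6}" "j \<in> {..<6}" "f i = f j"
    then show "i = j" using f(2)[of i] f(3)[of i j] by fastforce
  qed
  define S where "S = {i. i < 6 \<and> B (f i) (f i) = 1}"
  define T where "T = {i. i < 6 \<and> B (f i) (f i) = - 1}"
  have fin: "finite S" "finite T" by (simp_all add: S_def T_def)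
  have ST: "S \<union> T = {..<6}" "S \<inter> T = {}"
    using pm by (auto simp: S_def T_def)
  have S2: "card (f ` S) \<le> 2"
    by (rule orth_family_bounds(1)) (use f(3) fin in \<open>auto simp: S_def\<close>)
  have im: "card (f ` S) = card S" "card (f ` T) = card T"
    by (intro card_image inj_on_subset[OF inj], use ST(1) in blast)+
  have fe: "B (f i) (e j) = 0" "B (e j) (f i) = 0" if "i < 6" "j < 6" for i j
    using f(1)[OF that(1)] that(2) commute[of "e j"] by (auto simp: M_def)
  have T10: "card (f ` T \<union> e ` {..<6}) \<le> 10"
  proof (rule orth_family_bounds(2))
    fix v w assume "v \<in> f ` T \<union> e ` {..<6}" "w \<in> f ` T \<union> e ` {..<6}" "v \<noteq> w"
    then show "B v w = 0" using f(3) fe e_orth unfolding T_def by auto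
  next
    fix v assume "v \<in> f ` T \<union> e ` {..<6}"
    then show "B v v < 0" using e_orth by (auto simp: T_def)
  qed (use fin in auto)
  have "f i \<noteq> e j" if "i \<in> T" "j < 6" for i j
    using fe[of i j] that by (auto simp: T_def)
  then have "f ` T \<inter> e ` {..<6} = {}" by auto
  then have T6: "card (f ` T \<union> e ` {..<6}) = card (f ` T) + 6"
    using fin card_image[OF e_inj] by (simp add: card_Un_disjoint)
  have "card S + card T = 6"
    using card_Un_disjoint[OF fin ST(2)] ST(1) by simp
  then have card: "card S = 2" "card T = 4" using S2 im T10 T6 by linarith+
  obtain xs where xs: "distinct xs" "set xs = S"
    "sorted_wrt (\<lambda>i j. B u (f j) / 2 \<notin> \<int> \<longrightarrow> B u (f i) / 2 \<notin> \<int>) xs"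
    using list_sorted_by_predicate[OF fin(1)] .
  obtain ys where ys: "distinct ys" "set ys = T"
    "sorted_wrt (\<lambda>i j. B u (f j) / 2 \<notin> \<int> \<longrightarrow> B u (f i) / 2 \<notin> \<int>) ys"
    using list_sorted_by_predicate[OF fin(2)] .
  have "length xs = 2" "length ys = 4"
    using distinct_card[OF xs(1)] distinct_card[OF ys(1)] xs(2) ys(2) card by auto
  then obtain i1 i2 j1 j2 j3 j4 where l: "xs = [i1, i2]" "ys = [j1, j2, j3, j4]"
    by (auto simp: numeral_eq_Suc length_Suc_conv)
  have mem: "i1 \<in> S" "i2 \<in> S" "j1 \<in> T" "j2 \<in> T" "j3 \<in> T" "j4 \<in> T"
    using xs(2) ys(2) l by auto
  have lt: "i1 < 6" "i2 < 6" "j1 < 6" "j2 < 6" "j3 < 6" "j4 < 6"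
    and nrm: "B (f i1) (f i1) = 1" "B (f i2) (f i2) = 1" "B (f j1) (f j1) = - 1"
      "B (f j2) (f j2) = - 1" "B (f j3) (f j3) = - 1" "B (f j4) (f j4) = - 1"
    using mem by (auto simp: S_def T_def)
  have ne: "i1 \<noteq> i2" "i1 \<noteq> j1" "i1 \<noteq> j2" "i1 \<noteq> j3" "i1 \<noteq> j4" "i2 \<noteq> j1" "i2 \<noteq> j2" "i2 \<noteq> j3" "i2 \<noteq> j4"
    "j1 \<noteq> j2" "j1 \<noteq> j3" "j1 \<noteq> j4" "j2 \<noteq> j3" "j2 \<noteq> j4" "j3 \<noteq> j4"
    using mem ST(2) xs(1) ys(1) l by auto
  have set6: "{..<6} = {i1, i2, j1, j2, j3, j4}"
    using ST(1) xs(2) ys(2) l by auto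
  have "frame24 M (f i1) (f i2) (f j1) (f j2) (f j3) (f j4)"
    unfolding frame24_def
  proof (intro conjI ballI)
    fix x assume "x \<in> M"
    then have "x = (\<Sum>i<6. (B x (f i) * B (f i) (f i)) *\<^sub>R f i)" by (rule f(4))
    also have "\<dots> = B x (f i1) *\<^sub>R f i1 + B x (f i2) *\<^sub>R f i2 - B x (f j1) *\<^sub>R f j1
        - B x (f j2) *\<^sub>R f j2 - B x (f j3) *\<^sub>R f j3 - B x (f j4) *\<^sub>R f j4"
      unfolding set6 using ne nrm by simp
    finally show "x = B x (f i1) *\<^sub>R f i1 + B x (f i2) *\<^sub>R f i2 - B x (f j1) *\<^sub>R f j1
        - B x (f j2) *\<^sub>R f j2 - B x (f j3) *\<^sub>R f j3 - B x (f j4) *\<^sub>R f j4" .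
  qed (use f(1,3) lt ne nrm in auto)
  then show ?thesis using that xs(3) ys(3) unfolding l by simp
qed

lemma sum_neighbour:
  assumes "n \<le> 6"
  shows "(\<Sum>i<n. of_int (K i) *\<^sub>R e i) \<in> neighbour L (e 0)"
  using assms
proof (induction n)
  case 0
  show ?case using unimodular_in_simps(1)[OF neighbour_L] by simp
next
  case (Suc n)
  then show ?case
    by (simp, intro unimodular_in_simps[OF neighbour_L] e_neighbour Ints_of_int) auto
qed

lemma form_sum_e: "j < 6 \<Longrightarrow> B (\<Sum>i<6. t i *\<^sub>R e i) (e j) = - t j"
proof -
  assume j: "j < 6"
  have "B (\<Sum>i<6. t i *\<^sub>R e i) (e j) = (\<Sum>i<6. if i = j then - t i else 0)"
    unfolding form_sum_left using e_orth j by (intro sum.cong) auto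
  then show ?thesis using j by simp
qed

text \<open>The sum is the projection of \<open>x\<close> to the complement of the
  \<open>e i\<close>; the sign is \<open>+\<close> because their squares are -1.\<close>

lemma L_in_neighbour_M:
  assumes "x \<in> L" "B x (e 0) \<in> \<int>"
  obtains c where "\<And>i. i < 6 \<Longrightarrow> B x (e i) = of_int (c i)" "x + (\<Sum>i<6. of_int (c i) *\<^sub>R e i) \<in> M"
proof -
  have "\<exists>k. B x (e i) = of_int k" if "i < 6" for i
  proof -
    have "B x (e i - e 0) + B x (e 0) \<in> \<int>"
      using unimodular_in_simps(4)[OF L assms(1) e_diff[OF that]] assms(2) by (rule Ints_add)
    then show ?thesis by (auto elim: Ints_cases)
  qed
  then have "\<exists>c. \<forall>i<6. B x (e i) = real_of_int (c i)" by metis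
  then obtain c where c: "\<And>i. i < 6 \<Longrightarrow> B x (e i) = of_int (c i)" by blast
  have "x + (\<Sum>i<6. of_int (c i) *\<^sub>R e i) \<in> neighbour L (e 0)"
    by (rule unimodular_in_simps(2)[OF neighbour_L L_neighbour[OF assms] sum_neighbour[OF order_refl]])
  moreover have "B (x + (\<Sum>i<6. of_int (c i) *\<^sub>R e i)) (e j) = 0" if "j < 6" for j
    using c[OF that] form_sum_e[OF that, of "\<lambda>i. of_int (c i)"] by simp
  ultimately show ?thesis using that c by (simp add: M_def)
qed

theorem target_frame_exists:
  "\<exists>p q a b c d. target_frame {x \<in> L. \<forall>i<6. B x (e i) = 0} p q a b c d"
proof -
  obtain s K where s: "s \<in> L" and K: "\<And>i. i < 6 \<Longrightarrow> odd (K i :: int)"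
    "\<And>i. i < 6 \<Longrightarrow> 2 * B s (e i) = of_int (K i)"
    using exists_half_pairing by metis
  \<comment> \<open>On \<open>M\<close>, \<open>u\<close> pairs like \<open>2 s\<close>, so evenness
    of \<open>B u y\<close> means integrality of \<open>B s y\<close>. This holds for
    \<open>y\<close> in \<open>L\<close> and fails on its translate by \<open>e 0\<close>.\<close>
  define u where "u = 2 *\<^sub>R s + (\<Sum>i<6. of_int (K i) *\<^sub>R e i)"
  have "2 *\<^sub>R s \<in> neighbour L (e 0)"
    using K(2)[of 0] by (intro L_neighbour[OF unimodular_in_simps(5)[OF L _ s]]) auto
  then have "u \<in> neighbour L (e 0)"
    unfolding u_def by (rule unimodular_in_simps(2)[OF neighbour_L _ sum_neighbour[OF order_refl]])
  moreover have "B u (e j) = 0" if "j < 6" for j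
    using K(2)[OF that] form_sum_e[OF that, of "\<lambda>i. of_int (K i)"] by (simp add: u_def)
  ultimately have u: "u \<in> M" by (simp add: M_def)
  have uy: "B u y = 2 * B s y" if "y \<in> M" for y
  proof -
    have "B (e i) y = 0" if "i < 6" for i
      using \<open>y \<in> M\<close> that commute[of "e i" y] by (simp add: M_def)
    then show ?thesis by (simp add: u_def form_sum_left)
  qed
  have uu: "B u u = 4 * B s s + (\<Sum>i<6. of_int (K i * K i))"
  proof -
    have "B s u = 2 * B s s + (\<Sum>i<6. of_int (K i) * B s (e i))"
      by (simp add: u_def form_sum_right)
    then have "B u u = 4 * B s s + (\<Sum>i<6. of_int (K i) * (2 * B s (e i)))"
      using uy[OF u] by (simp add: sum_distrib_left algebra_simps)
    also have "(\<Sum>i<6. of_int (K i) * (2 * B s (e i))) = (\<Sum>i<6. real_of_int (K i * K i))"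
      using K(2) by (intro sum.cong) auto
    finally show ?thesis .
  qed
  have "\<forall>i. \<exists>r. i < 6 \<longrightarrow> K i * K i = 8 * r + 1" using K(1) odd_square_mod8 by blast
  from choice[OF this] obtain m where m: "\<And>i. i < 6 \<Longrightarrow> K i * K i = 8 * m i + 1"
    by blast
  have "(\<Sum>i<6. K i * K i) = (\<Sum>i<6. 8 * m i + 1)" by (intro sum.cong refl m) simp
  also have "\<dots> = 8 * (\<Sum>i<6. m i) + 6" by (simp add: sum.distrib sum_distrib_left)
  finally have sumK: "(\<Sum>i<6. K i * K i) = 8 * (\<Sum>i<6. m i) + 6" .
  obtain \<kappa> where \<kappa>: "B s s = of_int \<kappa>"
    using unimodular_in_simps(4)[OF L s s] by (auto elim: Ints_cases)
  \<comment> \<open>Kept modulo 8, not just 4: if all coordinates of \<open>u\<close> are odd, this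
    has to reveal the parity of \<kappa>.\<close>
  have uu8: "B u u = of_int (4 * \<kappa> + 8 * (\<Sum>i<6. m i) + 6)"
    unfolding uu \<kappa> of_int_sum[symmetric] sumK by simp
  have T: "{x \<in> L. \<forall>i<6. B x (e i) = 0} = {y \<in> M. B u y / 2 \<in> \<int>}"
  proof (intro equalityI subsetI)
    fix x assume x: "x \<in> {x \<in> L. \<forall>i<6. B x (e i) = 0}"
    then have "x \<in> M" unfolding M_def using L_neighbour by simp
    then show "x \<in> {y \<in> M. B u y / 2 \<in> \<int>}"
      using x uy unimodular_in_simps(4)[OF L s] by simp
  next
    fix y assume y: "y \<in> {y \<in> M. B u y / 2 \<in> \<int>}"
    then obtain l where l: "l \<in> L" "y = l \<or> y = l + e 0"
      by (auto simp: M_def neighbour_def)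
    have "y \<noteq> l + e 0"
    proof
      assume yl: "y = l + e 0"
      have "B s y \<in> \<int>" using y uy[of y] by simp
      then have "B s l + B s (e 0) \<in> \<int>" unfolding yl by simp
      then have "B s (e 0) \<in> \<int>" using unimodular_in_simps(4)[OF L s l(1)]
        by (metis Ints_diff add_diff_cancel_left')
      moreover have "B s (e 0) = of_int (K 0) / 2" using K(2)[of 0] by simp
      ultimately show False using K(1)[of 0] half_of_int by simp
    qed
    then show "y \<in> {x \<in> L. \<forall>i<6. B x (e i) = 0}" using y l by (auto simp: M_def)
  qed
  obtain p q a b c d where fr: "frame24 M p q a b c d"
    and srt: "B u q / 2 \<notin> \<int> \<longrightarrow> B u p / 2 \<notin> \<int>" "B u b / 2 \<notin> \<int> \<longrightarrow> B u a / 2 \<notin> \<int>"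
    "B u c / 2 \<notin> \<int> \<longrightarrow> B u b / 2 \<notin> \<int>" "B u d / 2 \<notin> \<int> \<longrightarrow> B u c / 2 \<notin> \<int>"
    using M_frame .
  obtain k1 k2 k3 k4 k5 k6 where k: "B u p = of_int k1" "B u q = of_int k2" "B u a = of_int k3"
    "B u b = of_int k4" "B u c = of_int k5" "B u d = of_int k6"
    using frame24_ints[OF unimodular_M fr u] .
  have par: "odd k2 \<longrightarrow> odd k1" "odd k4 \<longrightarrow> odd k3" "odd k5 \<longrightarrow> odd k4" "odd k6 \<longrightarrow> odd k5"
    using srt unfolding k half_of_int by auto
  have "real_of_int (k1 * k1 + k2 * k2 - k3 * k3 - k4 * k4 - k5 * k5 - k6 * k6) = B u u"
    unfolding frame24_pair[OF fr u] k by simp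
  then have sq: "k1 * k1 + k2 * k2 - k3 * k3 - k4 * k4 - k5 * k5 - k6 * k6
      = 4 * \<kappa> + 8 * (\<Sum>i<6. m i) + 6"
    unfolding uu8 of_int_eq_iff .
  \<comment> \<open>The square of \<open>u\<close> would be \<open>2 - 4\<close> modulo 8, making
    the square \<kappa> of \<open>s\<close> even, and \<open>u\<close> would be characteristic in
    \<open>M\<close>. Evenness then passes to the vectors of \<open>L\<close> pairing integrally
    with \<open>e 0\<close>, and by translation with \<open>s\<close> to all of
    \<open>L\<close>.\<close>
  have not_all_odd: "\<not> (odd k1 \<and> odd k2 \<and> odd k3 \<and> odd k4 \<and> odd k5 \<and> odd k6)"
  proof
    assume all: "odd k1 \<and> odd k2 \<and> odd k3 \<and> odd k4 \<and> odd k5 \<and> odd k6"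
    then obtain m1 m2 m3 m4 m5 m6 where sqs: "k1 * k1 = 8 * m1 + 1" "k2 * k2 = 8 * m2 + 1"
      "k3 * k3 = 8 * m3 + 1" "k4 * k4 = 8 * m4 + 1" "k5 * k5 = 8 * m5 + 1" "k6 * k6 = 8 * m6 + 1"
      using odd_square_mod8 by meson
    then have "\<kappa> = 2 * (m1 + m2 - m3 - m4 - m5 - m6 - (\<Sum>i<6. m i) - 1)"
      using sq unfolding sqs by simp
    then have "even \<kappa>" by simp
    have char: "(B u y - B y y) / 2 \<in> \<int>" if y: "y \<in> M" for y
    proof -
      obtain n1 n2 n3 n4 n5 n6 where n: "B y p = of_int n1" "B y q = of_int n2" "B y a = of_int n3"
        "B y b = of_int n4" "B y c = of_int n5" "B y d = of_int n6"
        using frame24_ints[OF unimodular_M fr y] .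
      define N where "N = n1 * (k1 - n1) + n2 * (k2 - n2) - n3 * (k3 - n3) - n4 * (k4 - n4)
        - n5 * (k5 - n5) - n6 * (k6 - n6)"
      have "B u y - B y y = of_int N"
        unfolding frame24_pair[OF fr y, of u] frame24_pair[OF fr y, of y] k n N_def
        by (simp add: algebra_simps)
      \<comment> \<open>For odd \<open>k\<close> one of the factors of \<open>n * (k - n)\<close> is
        even.\<close>
      moreover have "even N" using all by (auto simp: N_def)
      ultimately show ?thesis by (simp add: half_of_int)
    qed
    have even0: "B x x / 2 \<in> \<int>" if x: "x \<in> L" "B x (e 0) \<in> \<int>" for x
    proof -
      obtain c where c: "\<And>i. i < 6 \<Longrightarrow> B x (e i) = of_int (c i)"
        "x + (\<Sum>i<6. of_int (c i) *\<^sub>R e i) \<in> M"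
        using L_in_neighbour_M[OF x] by blast
      define y where "y = x + (\<Sum>i<6. of_int (c i) *\<^sub>R e i)"
      have y: "y \<in> M" using c(2) by (simp add: y_def)
      have ye: "B y (e i) = 0" if "i < 6" for i using y that by (simp add: M_def)
      have "B y y = B y x + (\<Sum>i<6. of_int (c i) * B y (e i))"
        unfolding y_def by (simp add: form_sum_right)
      also have "(\<Sum>i<6. of_int (c i) * B y (e i)) = 0" using ye by simp
      also have "B y x = B x y" by (rule commute)
      also have "B x y = B x x + (\<Sum>i<6. of_int (c i * c i))"
        using c(1) unfolding y_def by (simp add: form_sum_right)
      finally have yy: "B y y = B x x + (\<Sum>i<6. of_int (c i * c i))" by simp
      \<comment> \<open>The corrections caused by projecting \<open>x\<close> to \<open>y\<close>
        collect in \<open>Z\<close>; its terms are even because \<open>K i\<close> is odd.\<close>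
      define Z where "Z = (\<Sum>i<6. c i * (K i - c i))"
      have "B s y = B s x + (\<Sum>i<6. of_int (c i) * B s (e i))"
        by (simp add: y_def form_sum_right)
      then have "B u y = 2 * B s x + (\<Sum>i<6. of_int (c i) * (2 * B s (e i)))"
        using uy[OF y] by (simp add: sum_distrib_left algebra_simps)
      also have "(\<Sum>i<6. of_int (c i) * (2 * B s (e i))) = (\<Sum>i<6. real_of_int (c i * K i))"
        using K(2) by (intro sum.cong) auto
      finally have "B u y - B y y = 2 * B s x - B x x + of_int Z"
        using yy by (simp add: Z_def algebra_simps sum_subtractf)
      then have eq: "B s x + of_int Z / 2 - (B u y - B y y) / 2 = B x x / 2"
        by (simp add: field_simps)
      have "even Z"
        unfolding Z_def using K(1) by (intro dvd_sum) auto
      then have "of_int Z / 2 \<in> (\<int> :: real set)"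
        by (simp only: half_of_int)
      with unimodular_in_simps(4)[OF L s x(1)] char[OF y]
      have "B s x + of_int Z / 2 - (B u y - B y y) / 2 \<in> \<int>"
        by (intro Ints_add Ints_diff)
      then show ?thesis using eq by (rule back_subst)
    qed
    have "B x x / 2 \<in> \<int>" if x: "x \<in> L" for x
    proof (cases "B x (e 0) \<in> \<int>")
      case False
      have "2 * B x (e 0) \<in> \<int>" "2 * B s (e 0) \<in> \<int>"
        using unimodular_in_simps(4)[OF L x e_dbl] unimodular_in_simps(4)[OF L s e_dbl] by simp_all
      moreover have s0: "B s (e 0) = of_int (K 0) / 2" using K(2)[of 0] by simp
      have "B s (e 0) \<notin> \<int>" unfolding s0 half_of_int using K(1)[of 0] by simp
      ultimately have "B (x - s) (e 0) \<in> \<int>" using False half_integers_diff by simp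
      moreover have xs: "x - s \<in> L" by (intro unimodular_in_simps[OF L] x s)
      ultimately have "B (x - s) (x - s) / 2 \<in> \<int>" using even0 by blast
      moreover have "B (x - s) s \<in> \<int>" using unimodular_in_simps(4)[OF L xs s] .
      moreover have "B s s / 2 \<in> \<int>" using \<open>even \<kappa>\<close> by (simp add: \<kappa> half_of_int)
      ultimately have int: "B (x - s) (x - s) / 2 + B (x - s) s + B s s / 2 \<in> \<int>"
        by (intro Ints_add)
      have "B (x - s) (x - s) / 2 + B (x - s) s + B s s / 2 = B x x / 2"
        by (simp add: commute[of s x] field_simps)
      with int show ?thesis by (rule back_subst)
    qed (use even0 x in blast)
    then show False using odd_L by blast
  qed
  have mod4: "\<exists>r. k * k = 4 * r + (if odd k then 1 else 0)" for k :: int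
  proof (cases "odd k")
    case True
    then obtain r where "k * k = 8 * r + 1" using odd_square_mod8 by blast
    then show ?thesis using True by (intro exI[of _ "2 * r"]) simp
  next
    case False
    then show ?thesis using even_square_mod4[of k] by simp
  qed
  obtain r1 r2 r3 r4 r5 r6 where r: "k1 * k1 = 4 * r1 + (if odd k1 then 1 else 0)"
    "k2 * k2 = 4 * r2 + (if odd k2 then 1 else 0)" "k3 * k3 = 4 * r3 + (if odd k3 then 1 else 0)"
    "k4 * k4 = 4 * r4 + (if odd k4 then 1 else 0)" "k5 * k5 = 4 * r5 + (if odd k5 then 1 else 0)"
    "k6 * k6 = 4 * r6 + (if odd k6 then 1 else 0)"
    using mod4 by meson
  define z where "z = r1 + r2 - r3 - r4 - r5 - r6 - \<kappa> - 2 * (\<Sum>i<6. m i) - 1"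
  \<comment> \<open>Modulo 4 a square is 0 or 1 according to parity, so the count of odd positive
    coordinates minus that of odd negative ones is 2 modulo 4. With at most two and four of them
    this leaves (2,0), (1,3), (0,2) and the excluded (2,4).\<close>
  have cnt: "4 * z + (if odd k1 then 1 else 0) + (if odd k2 then 1 else 0)
      - (if odd k3 then 1 else 0) - (if odd k4 then 1 else 0)
      - (if odd k5 then 1 else 0) - (if odd k6 then 1 else 0) = 2"
    using sq unfolding r z_def by (simp only: algebra_simps)
  consider "odd k1 \<and> odd k2 \<and> even k3 \<and> even k4 \<and> even k5 \<and> even k6"
    | "odd k1 \<and> even k2 \<and> odd k3 \<and> odd k4 \<and> odd k5 \<and> even k6"
    | "even k1 \<and> even k2 \<and> odd k3 \<and> odd k4 \<and> even k5 \<and> even k6"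
  proof -
    have "4 * z = 2 - (if odd k1 then 1 else 0) - (if odd k2 then 1 else 0)
      + (if odd k3 then 1 else 0) + (if odd k4 then 1 else 0)
      + (if odd k5 then 1 else 0) + (if odd k6 then 1 else 0)"
      using cnt by simp
    then show ?thesis using that par not_all_odd
      by (cases "odd k1"; cases "odd k2"; cases "odd k3"; cases "odd k4"; cases "odd k5"; cases "odd k6")
        (simp_all, presburger+)
  qed
  then show ?thesis
  proof cases
    case 1
    then show ?thesis
      unfolding T using target_frame_20[OF unimodular_M fr u k(1) _ k(2) _ k(3) _ k(4) _ k(5) _ k(6)]
      by blast
  next
    case 2
    then show ?thesis
      unfolding T using target_frame_13[OF unimodular_M fr u k(1) _ k(2) _ k(3) _ k(4) _ k(5) _ k(6)]
      by blast
  next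
    case 3
    then show ?thesis
      unfolding T using target_frame_02[OF unimodular_M fr u k(1) _ k(2) _ k(3) _ k(4) _ k(5) _ k(6)]
      by blast
  qed
qed

end

section \<open>Embedding an abstract lattice into a real vector space\<close>

locale zlattice_form = comm_group G for G :: "'c zlattice" (structure) +
  assumes bform_commute: "x \<in> carrier G \<Longrightarrow> y \<in> carrier G \<Longrightarrow> bform G x y = bform G y x"
    and bform_mult: "x \<in> carrier G \<Longrightarrow> y \<in> carrier G \<Longrightarrow> z \<in> carrier G \<Longrightarrow>
      bform G (x \<otimes> y) z = bform G x z + bform G y z"
begin

lemma bform_mult_right:
  "x \<in> carrier G \<Longrightarrow> y \<in> carrier G \<Longrightarrow> z \<in> carrier G \<Longrightarrow>
    bform G z (x \<otimes> y) = bform G z x + bform G z y"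
  using bform_mult[of x y z] bform_commute[of z] by simp

lemma bform_one: "y \<in> carrier G \<Longrightarrow> bform G \<one> y = 0"
  using bform_mult[of \<one> \<one> y] by simp

lemma bform_inv: "x \<in> carrier G \<Longrightarrow> y \<in> carrier G \<Longrightarrow> bform G (inv x) y = - bform G x y"
  using bform_mult[of x "inv x" y] bform_one[of y] by simp

lemma bform_nat_pow:
  "x \<in> carrier G \<Longrightarrow> y \<in> carrier G \<Longrightarrow> bform G (x [^] (n::nat)) y = int n * bform G x y"
  by (induction n) (auto simp: bform_one bform_mult algebra_simps)

lemma bform_int_pow:
  "x \<in> carrier G \<Longrightarrow> y \<in> carrier G \<Longrightarrow> bform G (x [^] (k::int)) y = k * bform G x y"
  by (cases k rule: int_cases2) (auto simp: int_pow_int int_pow_neg_int bform_nat_pow bform_inv)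

lemma generate_nat_pow: "x \<in> generate G A \<Longrightarrow> x [^] (n::nat) \<in> generate G A"
  by (induction n) (auto intro: generate.one generate.eng)

lemma saturation_carrier: "x \<in> saturation G A \<Longrightarrow> x \<in> carrier G"
  by (simp add: saturation_def)

lemma saturation_root:
  assumes "x \<in> carrier G" "m \<noteq> 0" "x [^] (m::int) \<in> saturation G A"
  shows "x \<in> saturation G A"
proof -
  obtain k :: int where k: "k \<noteq> 0" "(x [^] m) [^] k \<in> generate G A"
    using assms(3) by (auto simp: saturation_def)
  then have "x [^] (m * k) \<in> generate G A" using int_pow_pow assms(1) by simp
  then show ?thesis
    using assms(1,2) k(1) unfolding saturation_def by (intro CollectI conjI exI[of _ "m * k"]) auto
qed

lemma saturation_inv:
  assumes "x \<in> saturation G A"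
  shows "inv x \<in> saturation G A"
proof -
  obtain k :: int where k: "k \<noteq> 0" "x [^] k \<in> generate G A" and x: "x \<in> carrier G"
    using assms by (auto simp: saturation_def)
  have "(inv x) [^] (- k) = x [^] k"
    using x by (simp add: int_pow_neg int_pow_inv)
  then show ?thesis
    using k x unfolding saturation_def by (intro CollectI conjI exI[of _ "- k"]) auto
qed

text \<open>The set \<open>A\<close> need not lie in the carrier, so \<open>generate G A\<close> is only closed under products.
  The elements with a positive power in \<open>generate G A\<close> form a submonoid \<open>C\<close>, and the saturation is
  the union of \<open>C\<close> and its inverse; mixed products are controlled by \<open>\<psi>\<close>.\<close>

lemma saturation_mult:
  fixes \<psi> :: "'c \<Rightarrow> nat \<Rightarrow> int"
  assumes hom: "\<And>x y. x \<in> saturation G A \<Longrightarrow> y \<in> saturation G A \<Longrightarrow>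
      \<psi> (x \<otimes> y) = (\<lambda>i. \<psi> x i + \<psi> y i)"
    and inj: "inj_on \<psi> (saturation G A)"
    and diff: "\<And>x y. x \<in> saturation G A \<Longrightarrow> y \<in> saturation G A \<Longrightarrow>
      \<exists>z\<in>saturation G A. \<psi> z = (\<lambda>i. \<psi> x i - \<psi> y i)"
    and x: "x \<in> saturation G A" and y: "y \<in> saturation G A"
  shows "x \<otimes> y \<in> saturation G A"
proof -
  define D where "D = saturation G A"
  note hom = hom[folded D_def] and inj = inj[folded D_def] and diff = diff[folded D_def]
  have carr: "z \<in> carrier G" if "z \<in> D" for z using that saturation_carrier by (simp add: D_def)
  define C where "C = {z \<in> carrier G. \<exists>m>0. z [^] (m::int) \<in> generate G A}"
  have CD: "C \<subseteq> D"
  proof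
    fix z assume "z \<in> C"
    then obtain m :: int where "z \<in> carrier G" "m > 0" "z [^] m \<in> generate G A"
      unfolding C_def by blast
    then show "z \<in> D"
      unfolding D_def saturation_def by (intro CollectI conjI exI[of _ m]) auto
  qed
  have D_cases: "z \<in> C \<or> inv z \<in> C" if zD: "z \<in> D" for z
  proof -
    obtain m :: int where m: "m \<noteq> 0" "z [^] m \<in> generate G A" and z: "z \<in> carrier G"
      using zD unfolding D_def saturation_def by auto
    show ?thesis
    proof (cases "m > 0")
      case True
      then show ?thesis using m z by (auto simp: C_def)
    next
      case False
      have "(inv z) [^] (- m) = z [^] m" using z by (simp add: int_pow_neg int_pow_inv)
      then show ?thesis
        using m z False unfolding C_def by (intro disjI2 CollectI conjI exI[of _ "- m"]) auto
    qed
  qed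
  have C_mult: "z \<otimes> w \<in> C" if z: "z \<in> C" and w: "w \<in> C" for z w
  proof -
    obtain m n :: int where m: "m > 0" "z [^] m \<in> generate G A" and n: "n > 0" "w [^] n \<in> generate G A"
      and c: "z \<in> carrier G" "w \<in> carrier G"
      using z w unfolding C_def by auto
    have "z [^] (m * n) = (z [^] m) [^] nat n" "w [^] (m * n) = (w [^] n) [^] nat m"
      using c m(1) n(1) int_pow_pow[of z m n] int_pow_pow[of w n m]
        int_pow_int[of _ "nat n"] int_pow_int[of _ "nat m"] by (simp_all add: mult.commute)
    then have "z [^] (m * n) \<otimes> w [^] (m * n) \<in> generate G A"
      using generate_nat_pow m(2) n(2) by (metis generate.eng)
    then have "(z \<otimes> w) [^] (m * n) \<in> generate G A" using int_pow_distrib[OF c] by simp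
    then show ?thesis
      using c m(1) n(1) unfolding C_def by (intro CollectI conjI exI[of _ "m * n"]) auto
  qed
  have C_mult_D: "z \<otimes> w \<in> D" if "z \<in> C" "w \<in> C" for z w using C_mult[OF that] CD by blast
  have inv_D: "inv z \<in> D" if "z \<in> D" for z using that saturation_inv by (simp add: D_def)
  have "\<one> \<in> D"
    unfolding D_def saturation_def by (auto intro!: exI[of _ "1::int"] generate.one)
  then have psi1: "\<psi> \<one> i = 0" for i using hom[of \<one> \<one>] by (metis add_cancel_left_left one_closed r_one)
  have psi_inv: "\<psi> (inv z) i = - \<psi> z i" if z: "z \<in> D" for z i
  proof -
    have "\<psi> (z \<otimes> inv z) = (\<lambda>i. \<psi> z i + \<psi> (inv z) i)" using hom z inv_D by blast
    then show ?thesis using psi1[of i] carr[OF z] by (simp add: fun_eq_iff)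
  qed
  have mixed: "z \<otimes> inv w \<in> D" if z: "z \<in> C" and w: "w \<in> C" for z w
  proof -
    have zw: "z \<in> D" "w \<in> D" "z \<in> carrier G" "w \<in> carrier G" using z w CD carr by auto
    \<comment> \<open>The difference of the images is attained by some \<open>t\<close>. According
      to whether \<open>t\<close> or its inverse lies in \<open>C\<close>, the claim is rewritten as
      \<open>t \<otimes> w = z\<close> or \<open>inv t \<otimes> z = w\<close>, where only products
      inside \<open>C\<close> occur and injectivity of \<psi> decides.\<close>
    obtain t where t: "t \<in> D" "\<psi> t = (\<lambda>i. \<psi> z i - \<psi> w i)" using diff zw by blast
    have tc: "t \<in> carrier G" using carr t(1) .
    have "t = z \<otimes> inv w"
    proof (cases "t \<in> C")
      case True
      have "\<psi> (t \<otimes> w) = \<psi> z" using hom[OF t(1) zw(2)] t(2) by simp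
      then have "t \<otimes> w = z" using inj C_mult_D[OF True w] zw(1) by (auto dest: inj_onD)
      then show ?thesis using tc zw by (metis inv_solve_right)
    next
      case False
      then have tC: "inv t \<in> C" using D_cases t(1) by blast
      have "\<psi> (inv t \<otimes> z) = \<psi> w" using hom[OF inv_D[OF t(1)] zw(1)] t(2) psi_inv[OF t(1)] by simp
      then have "inv t \<otimes> z = w" using inj C_mult_D[OF tC z] zw(2) by (auto dest: inj_onD)
      then have "t \<otimes> w = z" using tc zw by (metis inv_solve_left)
      then show ?thesis using tc zw by (metis inv_solve_right)
    qed
    then show ?thesis using t(1) by simp
  qed
  have xy: "x \<in> D" "y \<in> D" "x \<in> carrier G" "y \<in> carrier G" using x y carr by (auto simp: D_def)
  have "x \<otimes> y \<in> D"
  proof (cases "x \<in> C"; cases "y \<in> C")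
    assume "x \<in> C" "y \<in> C" then show ?thesis by (rule C_mult_D)
  next
    assume "x \<in> C" "y \<notin> C"
    then have "x \<otimes> inv (inv y) \<in> D" using mixed D_cases xy by blast
    then show ?thesis using xy by simp
  next
    assume "x \<notin> C" "y \<in> C"
    then have "y \<otimes> inv (inv x) \<in> D" using mixed D_cases xy by blast
    then show ?thesis using xy by (simp add: m_comm)
  next
    assume "x \<notin> C" "y \<notin> C"
    then have "inv x \<otimes> inv y \<in> D" using C_mult_D D_cases xy by blast
    then have "inv (inv x \<otimes> inv y) \<in> D" by (rule inv_D)
    then show ?thesis using xy by (simp add: inv_mult)
  qed
  then show ?thesis by (simp add: D_def)
qed

end

section \<open>Coordinates for signature (2,10)\<close>

locale zlattice_2_10 = zlattice_form G for G :: "'c zlattice" (structure) +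
  fixes b :: "nat \<Rightarrow> 'c" and idx :: "12 \<Rightarrow> nat"
  assumes b_carrier: "\<And>i. i < 12 \<Longrightarrow> b i \<in> carrier G"
    and b_orth: "\<And>i j. i < 12 \<Longrightarrow> j < 12 \<Longrightarrow> i \<noteq> j \<Longrightarrow> bform G (b i) (b j) = 0"
    and b_pos: "\<And>i. i < 2 \<Longrightarrow> bform G (b i) (b i) > 0"
    and b_neg: "\<And>i. 2 \<le> i \<Longrightarrow> i < 12 \<Longrightarrow> bform G (b i) (b i) < 0"
    and b_gen: "\<And>x. x \<in> carrier G \<Longrightarrow> \<exists>m::int. m \<noteq> 0 \<and> x [^] m \<in> generate G (b ` {..<12})"
    and idx: "bij_betw idx UNIV {..<12}"
    and unimod: "unimodular G"
begin

text \<open>The coordinates are the pairings with the orthogonal basis, hence integers;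
  \<open>emb_form\<close> compensates by dividing by the squares of the basis vectors.\<close>

definition emb :: "'c \<Rightarrow> real ^ 12" where
  "emb x = (\<chi> i. of_int (bform G x (b (idx i))))"

definition emb_form :: "real ^ 12 \<Rightarrow> real ^ 12 \<Rightarrow> real" where
  "emb_form v w = (\<Sum>i\<in>UNIV. v $ i * w $ i / of_int (bform G (b (idx i)) (b (idx i))))"

lemma idx_less: "idx i < 12"
  using idx by (auto simp: bij_betw_def)

lemma idx_inj: "idx i = idx j \<longleftrightarrow> i = j"
  using idx by (auto simp: bij_betw_def inj_on_def)

lemma idx_ex: "j < 12 \<Longrightarrow> \<exists>i. j = idx i"
  using idx by (auto simp: bij_betw_def)

sublocale sym_form emb_form
proof
  show "bilinear emb_form"
    unfolding bilinear_def
    by (auto intro!: linearI simp: emb_form_def sum.distrib[symmetric] sum_distrib_left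
        add_divide_distrib algebra_simps)
  show "emb_form x y = emb_form y x" for x y
    by (simp add: emb_form_def mult.commute)
qed

lemma emb_mult: "x \<in> carrier G \<Longrightarrow> y \<in> carrier G \<Longrightarrow> emb (x \<otimes> y) = emb x + emb y"
  using b_carrier idx_less by (simp add: emb_def vec_eq_iff bform_mult)

lemma emb_int_pow: "x \<in> carrier G \<Longrightarrow> emb (x [^] (k::int)) = of_int k *\<^sub>R emb x"
  using b_carrier idx_less by (simp add: emb_def vec_eq_iff bform_int_pow)

lemma emb_one: "emb \<one> = 0"
  using b_carrier idx_less by (simp add: emb_def vec_eq_iff bform_one)

lemma emb_inv: "x \<in> carrier G \<Longrightarrow> emb (inv x) = - emb x"
  using b_carrier idx_less by (simp add: emb_def vec_eq_iff bform_inv)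

lemma b_ne: "i < 12 \<Longrightarrow> bform G (b i) (b i) \<noteq> 0"
  using b_pos[of i] b_neg[of i] by (cases "i < 2") auto

lemma emb_b: "emb (b (idx j)) = of_int (bform G (b (idx j)) (b (idx j))) *\<^sub>R axis j 1"
  using b_orth idx_less idx_inj by (simp add: emb_def vec_eq_iff axis_def)

lemma emb_form_b:
  "emb_form (emb x) (emb (b (idx j))) = of_int (bform G x (b (idx j)))"
proof -
  have "emb_form (emb x) (emb (b (idx j))) =
      (\<Sum>i\<in>UNIV. if i = j then of_int (bform G x (b (idx j))) else 0)"
    unfolding emb_form_def emb_b
    using b_ne[OF idx_less] by (intro sum.cong) (auto simp: axis_def emb_def)
  then show ?thesis by simp
qed

lemma emb_form_generate:
  assumes "x \<in> generate G (b ` {..<12})" and y: "y \<in> carrier G"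
  shows "x \<in> carrier G \<and> emb_form (emb x) (emb y) = of_int (bform G x y)"
  using assms(1)
proof (induction rule: generate.induct)
  case one
  show ?case using y by (simp add: emb_one bform_one)
next
  case (incl h)
  then obtain j where h: "h = b (idx j)" using idx_ex by blast
  have hc: "h \<in> carrier G" using h b_carrier idx_less by simp
  have "emb_form (emb h) (emb y) = emb_form (emb y) (emb h)" by (rule commute)
  also have "\<dots> = of_int (bform G y h)" unfolding h by (rule emb_form_b)
  also have "\<dots> = of_int (bform G h y)" using bform_commute y hc by simp
  finally show ?case using hc by simp
next
  case (inv h)
  then obtain j where h: "h = b (idx j)" using idx_ex by blast
  have hc: "h \<in> carrier G" using h b_carrier idx_less by simp
  have "emb_form (emb h) (emb y) = emb_form (emb y) (emb h)" by (rule commute)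
  also have "\<dots> = of_int (bform G y h)" unfolding h by (rule emb_form_b)
  also have "\<dots> = of_int (bform G h y)" using bform_commute y hc by simp
  finally show ?case using hc y by (simp add: emb_inv bform_inv)
next
  case (eng h1 h2)
  then show ?case using y by (simp add: emb_mult bform_mult)
qed

text \<open>A nonzero multiple of \<open>x\<close> lies in the subgroup generated by the basis,
  where the identity is checked on generators; both sides are homogeneous in
  \<open>x\<close>.\<close>

lemma emb_form_emb:
  assumes x: "x \<in> carrier G" and y: "y \<in> carrier G"
  shows "emb_form (emb x) (emb y) = of_int (bform G x y)"
proof -
  obtain m :: int where m: "m \<noteq> 0" "x [^] m \<in> generate G (b ` {..<12})" using b_gen[OF x] by blast
  have "of_int m * emb_form (emb x) (emb y) = of_int m * of_int (bform G x y)"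
    using emb_form_generate[OF m(2) y] emb_int_pow[OF x, of m] bform_int_pow[OF x y, of m] by simp
  then show ?thesis using m(1) by simp
qed

lemma nondegenerate:
  assumes "x \<in> carrier G" "\<And>y. y \<in> carrier G \<Longrightarrow> bform G x y = 0"
  shows "x = \<one>"
proof -
  have "(\<lambda>y. 0) \<in> hom G integer_group" by (auto simp: hom_def integer_group_def)
  then have "\<exists>!x. x \<in> carrier G \<and> (\<forall>y\<in>carrier G. 0 = bform G x y)"
    by (rule bspec[OF unimod[unfolded unimodular_def]])
  then show ?thesis using assms bform_one by (metis one_closed)
qed

lemma emb_inj: "inj_on emb (carrier G)"
proof (rule inj_onI)
  fix x y assume xy: "x \<in> carrier G" "y \<in> carrier G" "emb x = emb y"
  have "bform G (x \<otimes> inv y) z = 0" if z: "z \<in> carrier G" for z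
  proof -
    have "real_of_int (bform G (x \<otimes> inv y) z) = emb_form (emb (x \<otimes> inv y)) (emb z)"
      using emb_form_emb xy z by simp
    also have "emb (x \<otimes> inv y) = 0" using xy by (simp add: emb_mult emb_inv)
    finally show ?thesis by simp
  qed
  then have "x \<otimes> inv y = \<one>" using nondegenerate xy by simp
  then have "inv (inv y) = x" using xy by (intro inv_equality) auto
  then show "x = y" using xy by simp
qed

lemma emb_unimodular: "unimodular_in (emb ` carrier G)"
  unfolding unimodular_in_def
proof (intro conjI allI impI ballI)
  have "emb x + emb y \<in> emb ` carrier G \<and> emb x - emb y \<in> emb ` carrier G"
    if "x \<in> carrier G" "y \<in> carrier G" for x y
  proof -
    have "emb (x \<otimes> y) = emb x + emb y" "emb (x \<otimes> inv y) = emb x - emb y"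
      using that by (simp_all add: emb_mult emb_inv)
    then show ?thesis using that by (metis image_eqI inv_closed m_closed)
  qed
  moreover have "0 \<in> emb ` carrier G" using emb_one by (intro image_eqI[of _ _ \<one>]) auto
  ultimately show "additive_subgroup (emb ` carrier G)"
    unfolding additive_subgroup_def by blast
next
  fix v w assume "v \<in> emb ` carrier G" "w \<in> emb ` carrier G"
  then show "emb_form v w \<in> \<int>" using emb_form_emb by auto
next
  fix v assume v: "v \<in> emb ` carrier G" "\<forall>w\<in>emb ` carrier G. emb_form v w = 0"
  then obtain x where x: "x \<in> carrier G" "v = emb x" by blast
  have "bform G x y = 0" if "y \<in> carrier G" for y
    using v(2) emb_form_emb[OF x(1) that] that x(2) by auto
  then show "v = 0" using nondegenerate[OF x(1)] x(2) emb_one by simp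
next
  fix f :: "real ^ 12 \<Rightarrow> real"
  assume f: "(\<forall>v\<in>emb ` carrier G. f v \<in> \<int>) \<and>
    (\<forall>v\<in>emb ` carrier G. \<forall>w\<in>emb ` carrier G. f (v + w) = f v + f w)"
  \<comment> \<open>The floor turns a real functional with integral values into a homomorphism to
    the integers, to which \<open>unimodular\<close> applies.\<close>
  define F where "F x = \<lfloor>f (emb x)\<rfloor>" for x
  have F: "of_int (F x) = f (emb x)" if "x \<in> carrier G" for x
    using f that unfolding F_def by (simp add: Ints_cases)
  have "F (x \<otimes> y) = F x + F y" if "x \<in> carrier G" "y \<in> carrier G" for x y
  proof -
    have "real_of_int (F (x \<otimes> y)) = of_int (F x + F y)"
      using F[of "x \<otimes> y"] F[of x] F[of y] f that by (simp add: emb_mult)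
    then show ?thesis by (simp only: of_int_eq_iff)
  qed
  then have "F \<in> hom G integer_group" by (auto simp: hom_def integer_group_def)
  from bspec[OF unimod[unfolded unimodular_def] this]
  obtain x where x: "x \<in> carrier G" "\<And>y. y \<in> carrier G \<Longrightarrow> F y = bform G x y"
    by blast
  have "emb_form (emb x) w = f w" if "w \<in> emb ` carrier G" for w
    using that x F emb_form_emb by auto
  then show "\<exists>v\<in>emb ` carrier G. \<forall>w\<in>emb ` carrier G. emb_form v w = f w" using x(1) by blast
qed

lemma emb_span: "span (emb ` carrier G) = UNIV"
proof -
  have "axis j 1 \<in> span (emb ` carrier G)" for j
  proof -
    have "(1 / of_int (bform G (b (idx j)) (b (idx j)))) *\<^sub>R emb (b (idx j)) \<in> span (emb ` carrier G)"
      using b_carrier[OF idx_less] by (intro span_scale span_base imageI)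
    then show ?thesis unfolding emb_b using b_ne[OF idx_less, of j] by simp
  qed
  then have "Basis \<subseteq> span (emb ` carrier G)" by (auto simp: Basis_vec_def)
  then show ?thesis by (metis span_Basis span_mono span_span top.extremum_unique)
qed

lemma emb_definite:
  obtains P Q where "subspace P" "dim P = 2" "\<And>z. z \<in> P \<Longrightarrow> z \<noteq> 0 \<Longrightarrow> emb_form z z > 0"
    "subspace Q" "dim Q = 10" "\<And>z. z \<in> Q \<Longrightarrow> z \<noteq> 0 \<Longrightarrow> emb_form z z < 0"
proof -
  have bb: "emb_form (emb (b i)) (emb (b j)) = of_int (bform G (b i) (b j))" if "i < 12" "j < 12" for i j
    using emb_form_emb b_carrier that by simp
  have inj: "inj_on (\<lambda>i. emb (b i)) {..<12}"
  proof (rule inj_onI)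
    fix i j assume ij: "i \<in> {..<12}" "j \<in> {..<12}" "emb (b i) = emb (b j)"
    then have "of_int (bform G (b i) (b j)) = (of_int (bform G (b i) (b i)) :: real)"
      using bb[of i j] bb[of i i] by simp
    then show "i = j" using b_orth[of i j] b_ne[of i] ij by auto
  qed
  have card: "card ((\<lambda>i. emb (b i)) ` I) = card I" if "I \<subseteq> {..<12}" for I
    using card_image[OF inj_on_subset[OF inj that]] .
  have *: "dim ({} \<union> (\<lambda>i. emb (b i)) ` I) = dim ({} :: (real ^ 12) set) + card ((\<lambda>i. emb (b i)) ` I) \<and>
      (\<forall>z\<in>span ({} \<union> (\<lambda>i. emb (b i)) ` I). z \<noteq> 0 \<longrightarrow> \<epsilon> * emb_form z z > 0)"
    if I: "I \<subseteq> {..<12}" and sgn: "\<And>i. i \<in> I \<Longrightarrow> \<epsilon> * of_int (bform G (b i) (b i)) > (0::real)" for I \<epsilon>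
  proof (rule definite_span_orth)
    show "finite ((\<lambda>i. emb (b i)) ` I)" using I by (meson finite_imageI finite_lessThan finite_subset)
    show "\<epsilon> * emb_form v v > 0" if "v \<in> (\<lambda>i. emb (b i)) ` I" for v
      using that sgn I bb by auto
    show "emb_form v w = 0" if vw: "v \<in> (\<lambda>i. emb (b i)) ` I" "w \<in> (\<lambda>i. emb (b i)) ` I" "v \<noteq> w" for v w
    proof -
      obtain i j where "i \<in> I" "j \<in> I" "v = emb (b i)" "w = emb (b j)" using vw by blast
      then show ?thesis using \<open>v \<noteq> w\<close> bb[of i j] b_orth[of i j] I by (cases "i = j") auto
    qed
  qed auto
  have I: "{..<2} \<subseteq> {..<12::nat}" "{2..<12} \<subseteq> {..<12::nat}" by auto
  show ?thesis
  proof
    show "subspace (span ((\<lambda>i. emb (b i)) ` {..<2}))" "subspace (span ((\<lambda>i. emb (b i)) ` {2..<12}))"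
      by (rule subspace_span)+
    show "dim (span ((\<lambda>i. emb (b i)) ` {..<2})) = 2"
      using *[OF I(1), of 1] card[OF I(1)] b_pos by simp
    show "dim (span ((\<lambda>i. emb (b i)) ` {2..<12})) = 10"
      using *[OF I(2), of "- 1"] card[OF I(2)] b_neg by simp
    show "emb_form z z > 0" if "z \<in> span ((\<lambda>i. emb (b i)) ` {..<2})" "z \<noteq> 0" for z
      using *[OF I(1), of 1] b_pos that by simp
    show "emb_form z z < 0" if "z \<in> span ((\<lambda>i. emb (b i)) ` {2..<12})" "z \<noteq> 0" for z
      using *[OF I(2), of "- 1"] b_neg that by simp
  qed
qed

end

section \<open>The lattice \<open>D_6\<close> in coordinates\<close>

lemma D6_simps:
  "carrier (rescale n (D_lattice 6 0)) = {v. (\<forall>i\<ge>6. v i = 0) \<and> even (\<Sum>i<6. v i)}"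
  "x \<otimes>\<^bsub>rescale n (D_lattice 6 0)\<^esub> y = (\<lambda>i. x i + y i)"
  "bform (rescale n (D_lattice 6 0)) x y = n * (\<Sum>i<6. x i * y i)"
  by (auto simp: rescale_def D_lattice_def sublattice_on_def Z_lattice_def)

lemma target_simps:
  "carrier (direct_sum (rescale m (Z_lattice k 0)) (rescale n (Z_lattice l 0)))
    = {v. \<forall>i\<ge>k. v i = 0} \<times> {v. \<forall>i\<ge>l. v i = 0}"
  "(x, x') \<otimes>\<^bsub>direct_sum (rescale m (Z_lattice k 0)) (rescale n (Z_lattice l 0))\<^esub> (y, y')
    = (\<lambda>i. x i + y i, \<lambda>i. x' i + y' i)"
  "bform (direct_sum (rescale m (Z_lattice k 0)) (rescale n (Z_lattice l 0))) (x, x') (y, y')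
    = m * (\<Sum>i<k. x i * y i) + n * (\<Sum>i<l. x' i * y' i)"
  by (auto simp: direct_sum_def rescale_def Z_lattice_def)

definition D6_vectors :: "(nat \<Rightarrow> int) set" where
  "D6_vectors = {v. (\<forall>i\<ge>6. v i = 0) \<and> even (\<Sum>i<6. v i)}"

lemma D6_vectors_add: "v \<in> D6_vectors \<Longrightarrow> w \<in> D6_vectors \<Longrightarrow> (\<lambda>i. v i + w i) \<in> D6_vectors"
  and D6_vectors_diff: "v \<in> D6_vectors \<Longrightarrow> w \<in> D6_vectors \<Longrightarrow> (\<lambda>i. v i - w i) \<in> D6_vectors"
  by (auto simp: D6_vectors_def sum.distrib sum_subtractf)

lemma D6_vectors_even: "(\<And>i. i \<ge> 6 \<Longrightarrow> v i = 0) \<Longrightarrow> (\<And>i. even (v i)) \<Longrightarrow> v \<in> D6_vectors"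
  by (auto simp: D6_vectors_def intro: dvd_sum)

text \<open>Doubled unit vectors generate all vectors with even entries, among them the double of
  \<open>v\<close>, and the integers have no torsion. Hence orthogonality to the six
  \<open>e i\<close> will amount to orthogonality to the whole sublattice.\<close>

lemma D6_functional_zero:
  fixes f :: "(nat \<Rightarrow> int) \<Rightarrow> int"
  assumes add: "\<And>v w. v \<in> D6_vectors \<Longrightarrow> w \<in> D6_vectors \<Longrightarrow> f (\<lambda>i. v i + w i) = f v + f w"
    and zero: "\<And>n. n < 6 \<Longrightarrow> f (\<lambda>j. 2 * unit_vec n j) = 0" and v: "v \<in> D6_vectors"
  shows "f v = 0"
proof -
  have mult: "f (\<lambda>j. 2 * k * unit_vec n j) = 0" if n: "n < 6" for n k
  proof -
    have mem: "(\<lambda>j. 2 * k * unit_vec n j) \<in> D6_vectors" for k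
      using n by (intro D6_vectors_even) (auto simp: unit_vec_def)
    have step: "f (\<lambda>j. 2 * (k + 1) * unit_vec n j) = f (\<lambda>j. 2 * k * unit_vec n j)" for k
      using add[OF mem[of k] mem[of 1]] zero[OF n] by (simp add: algebra_simps)
    show ?thesis
    proof (induction k rule: int_induct[where k = 0])
      case base
      show ?case using add[OF mem[of 0] mem[of 0]] by simp
    next
      case (step1 i)
      then show ?case using step[of i] by simp
    next
      case (step2 i)
      then show ?case using step[of "i - 1"] by simp
    qed
  qed
  have even: "f w = 0" if "n \<le> 6" "\<And>i. even (w i)" "\<And>i. i \<ge> n \<Longrightarrow> w i = 0" for n w
    using that
  proof (induction n arbitrary: w)
    case 0
    then have "w = (\<lambda>j. 2 * 0 * unit_vec 0 j)" by auto
    then show ?case using mult[of 0 0] by simp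
  next
    case (Suc n)
    obtain k where k: "w n = 2 * k" using Suc.prems(2) by (auto elim: evenE)
    define w' where "w' = w(n := 0)"
    have "f w' = 0"
    proof (rule Suc.IH)
      fix i assume "n \<le> i"
      then show "w' i = 0" using Suc.prems(3) by (cases "i = n") (auto simp: w'_def)
    qed (use Suc.prems in \<open>auto simp: w'_def\<close>)
    moreover have "w = (\<lambda>i. w' i + 2 * k * unit_vec n i)"
      using k by (auto simp: w'_def unit_vec_def)
    moreover have "w' \<in> D6_vectors" "(\<lambda>i. 2 * k * unit_vec n i) \<in> D6_vectors"
      using Suc.prems by (auto intro!: D6_vectors_even simp: w'_def unit_vec_def)
    ultimately show ?case using add mult[of n k] Suc.prems(1) by fastforce
  qed
  have "f (\<lambda>i. v i + v i) = 0"
    by (rule even[of 6]) (use v in \<open>auto simp: D6_vectors_def\<close>)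
  then show ?thesis using add[OF v v] by simp
qed

section \<open>The isometry with the target lattice\<close>

context zlattice_2_10
begin

lemma target_frame_isometric:
  assumes U: "U = orth_compl G D" "D \<subseteq> carrier G"
    and tf: "target_frame (emb ` U) v1 v2 w1 w2 w3 w4"
  shows "isometric (sublattice_on G U)
    (direct_sum (rescale 2 (Z_lattice 2 0)) (rescale (- 1) (Z_lattice 4 0)))"
proof -
  have UG: "x \<in> carrier G" if "x \<in> U" for x using that U by (simp add: orth_compl_def)
  have mem: "v1 \<in> emb ` U" "v2 \<in> emb ` U" "w1 \<in> emb ` U" "w2 \<in> emb ` U" "w3 \<in> emb ` U" "w4 \<in> emb ` U"
    using tf by (auto simp: target_frame_def)
  obtain p where p: "p \<in> U" "v1 = emb p" using mem(1) by blast
  obtain q where q: "q \<in> U" "v2 = emb q" using mem(2) by blast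
  obtain r1 where r1: "r1 \<in> U" "w1 = emb r1" using mem(3) by blast
  obtain r2 where r2: "r2 \<in> U" "w2 = emb r2" using mem(4) by blast
  obtain r3 where r3: "r3 \<in> U" "w3 = emb r3" using mem(5) by blast
  obtain r4 where r4: "r4 \<in> U" "w4 = emb r4" using mem(6) by blast
  note frU = p(1) q(1) r1(1) r2(1) r3(1) r4(1)
  note frG = frU[THEN UG]
  note tf' = tf[unfolded target_frame_def p(2) q(2) r1(2) r2(2) r3(2) r4(2)]
  have ef: "real_of_int (bform G x y) = emb_form (emb x) (emb y)" if "x \<in> carrier G" "y \<in> carrier G" for x y
    using emb_form_emb that by simp
  have int_eq: "bform G x y = k" if "x \<in> carrier G" "y \<in> carrier G" "emb_form (emb x) (emb y) = of_int k" for x y k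
    using ef[OF that(1,2)] that(3) by simp
  have gram: "bform G p p = 2" "bform G q q = 2" "bform G r1 r1 = - 1" "bform G r2 r2 = - 1"
    "bform G r3 r3 = - 1" "bform G r4 r4 = - 1" "bform G p q = 0" "bform G p r1 = 0" "bform G p r2 = 0"
    "bform G p r3 = 0" "bform G p r4 = 0" "bform G q r1 = 0" "bform G q r2 = 0" "bform G q r3 = 0"
    "bform G q r4 = 0" "bform G r1 r2 = 0" "bform G r1 r3 = 0" "bform G r1 r4 = 0"
    "bform G r2 r3 = 0" "bform G r2 r4 = 0" "bform G r3 r4 = 0"
    using tf' by (auto intro!: int_eq frG)
  have gram': "bform G q p = 0" "bform G r1 p = 0" "bform G r2 p = 0" "bform G r3 p = 0" "bform G r4 p = 0"
    "bform G r1 q = 0" "bform G r2 q = 0" "bform G r3 q = 0" "bform G r4 q = 0"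
    "bform G r2 r1 = 0" "bform G r3 r1 = 0" "bform G r4 r1 = 0" "bform G r3 r2 = 0" "bform G r4 r2 = 0"
    "bform G r4 r3 = 0"
    using gram(7-) bform_commute frG by metis+
  have expand: "even (bform G x p) \<and> even (bform G x q) \<and>
      emb x = (of_int (bform G x p) / 2) *\<^sub>R emb p + (of_int (bform G x q) / 2) *\<^sub>R emb q
        - of_int (bform G x r1) *\<^sub>R emb r1 - of_int (bform G x r2) *\<^sub>R emb r2
        - of_int (bform G x r3) *\<^sub>R emb r3 - of_int (bform G x r4) *\<^sub>R emb r4"
    if x: "x \<in> U" for x
    unfolding half_of_int[symmetric] ef[OF UG[OF x] frG(1)] ef[OF UG[OF x] frG(2)]
      ef[OF UG[OF x] frG(3)] ef[OF UG[OF x] frG(4)] ef[OF UG[OF x] frG(5)] ef[OF UG[OF x] frG(6)]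
    using tf' x by blast
  have pair: "bform G x y = 2 * ((bform G x p div 2) * (bform G y p div 2) + (bform G x q div 2) * (bform G y q div 2))
      - (bform G x r1 * bform G y r1 + bform G x r2 * bform G y r2 + bform G x r3 * bform G y r3
        + bform G x r4 * bform G y r4)" if x: "x \<in> U" and y: "y \<in> U" for x y
  proof -
    obtain k1 k2 l1 l2 where k: "bform G x p = 2 * k1" "bform G x q = 2 * k2"
      "bform G y p = 2 * l1" "bform G y q = 2 * l2"
      using expand[OF x] expand[OF y] by (auto elim!: evenE)
    have sym: "emb_form (emb z) (emb y) = of_int (bform G y z)" if "z \<in> carrier G" for z
      using ef[OF UG[OF y] that] commute by metis
    have "real_of_int (bform G x y) = emb_form (emb x) (emb y)" using ef UG x y by simp
    also have "\<dots> = of_int (2 * (k1 * l1 + k2 * l2) - (bform G x r1 * bform G y r1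
        + bform G x r2 * bform G y r2 + bform G x r3 * bform G y r3 + bform G x r4 * bform G y r4))"
      by (subst conjunct2[OF conjunct2[OF expand[OF x]]]) (simp add: sym frG k algebra_simps)
    finally show ?thesis unfolding k by (simp only: of_int_eq_iff) simp
  qed
  \<comment> \<open>Coordinates in the frame: half the pairing for the vectors of square 2, its
    negative for those of square -1.\<close>
  define h where "h x = (\<lambda>i::nat. if i = 0 then bform G x p div 2 else if i = 1 then bform G x q div 2 else 0,
    \<lambda>i::nat. if i = 0 then - bform G x r1 else if i = 1 then - bform G x r2
      else if i = 2 then - bform G x r3 else if i = 3 then - bform G x r4 else 0)" for x
  let ?Z = "direct_sum (rescale 2 (Z_lattice 2 0)) (rescale (- 1) (Z_lattice 4 0))"
  have U_mult: "x \<otimes> y \<in> U" if "x \<in> U" "y \<in> U" for x y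
    using that U by (auto simp: orth_compl_def bform_mult)
  have U_pow: "x [^] (k::int) \<in> U" if "x \<in> U" for x k
    using that U by (auto simp: orth_compl_def bform_int_pow)
  have "h \<in> hom (sublattice_on G U) ?Z"
    unfolding hom_def
  proof (intro CollectI conjI ballI funcsetI)
    fix x assume "x \<in> carrier (sublattice_on G U)"
    then show "h x \<in> carrier ?Z" by (simp add: target_simps h_def)
  next
    fix x y assume "x \<in> carrier (sublattice_on G U)" "y \<in> carrier (sublattice_on G U)"
    then have xy: "x \<in> U" "y \<in> U" "x \<in> carrier G" "y \<in> carrier G"
      using UG by (auto simp: sublattice_on_def)
    have "(bform G x p + bform G y p) div 2 = bform G x p div 2 + bform G y p div 2"
      "(bform G x q + bform G y q) div 2 = bform G x q div 2 + bform G y q div 2"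
      using expand[OF xy(1)] by (simp_all add: div_plus_div_distrib_dvd_left)
    then show "h (x \<otimes>\<^bsub>sublattice_on G U\<^esub> y) = h x \<otimes>\<^bsub>?Z\<^esub> h y"
      using frG xy by (simp add: target_simps h_def sublattice_on_def bform_mult fun_eq_iff)
  qed
  moreover have "inj_on h U"
  proof (rule inj_onI)
    fix x y assume xy: "x \<in> U" "y \<in> U" "h x = h y"
    then have s: "fst (h x) 0 = fst (h y) 0" "fst (h x) 1 = fst (h y) 1"
      "snd (h x) 0 = snd (h y) 0" "snd (h x) 1 = snd (h y) 1" "snd (h x) 2 = snd (h y) 2"
      "snd (h x) 3 = snd (h y) 3" by simp_all
    have "bform G x p = bform G y p" "bform G x q = bform G y q"
      using s(1,2) expand[OF xy(1)] expand[OF xy(2)] by (auto simp: h_def elim!: evenE)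
    moreover have "bform G x r1 = bform G y r1" "bform G x r2 = bform G y r2"
      "bform G x r3 = bform G y r3" "bform G x r4 = bform G y r4"
      using s(3-6) by (simp_all add: h_def)
    ultimately have "emb x = emb y" using expand[OF xy(1)] expand[OF xy(2)] by simp
    then show "x = y" using emb_inj UG xy by (meson inj_onD)
  qed
  moreover have "h ` U = carrier ?Z"
  proof (intro equalityI subsetI)
    fix z assume "z \<in> carrier ?Z"
    then obtain s t where z: "z = (s, t)" "\<And>i. i \<ge> 2 \<Longrightarrow> s i = 0" "\<And>i. i \<ge> 4 \<Longrightarrow> t i = 0"
      by (auto simp: target_simps)
    define x where "x = p [^] s 0 \<otimes> q [^] s 1 \<otimes> r1 [^] t 0 \<otimes> r2 [^] t 1 \<otimes> r3 [^] t 2 \<otimes> r4 [^] t 3"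
    have x: "x \<in> U" unfolding x_def by (intro U_mult U_pow frU)
    have bx: "bform G x y = s 0 * bform G p y + s 1 * bform G q y + t 0 * bform G r1 y + t 1 * bform G r2 y
        + t 2 * bform G r3 y + t 3 * bform G r4 y" if "y \<in> carrier G" for y
      unfolding x_def using frG that by (simp add: bform_mult bform_int_pow)
    have "fst (h x) i = s i" for i
      using z(2)[of i] gram gram' frG by (auto simp: h_def bx)
    moreover have "snd (h x) i = t i" for i
    proof -
      consider "i = 0" | "i = 1" | "i = 2" | "i = 3" | "i \<ge> 4" by linarith
      then show ?thesis using z(3)[of i] gram gram' frG by cases (auto simp: h_def bx)
    qed
    ultimately have "h x = z" using z(1) by (simp add: prod_eq_iff fun_eq_iff)
    then show "z \<in> h ` U" using x by blast
  qed (auto simp: target_simps h_def)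
  moreover have "bform ?Z (h x) (h y) = bform G x y" if "x \<in> U" "y \<in> U" for x y
    unfolding pair[OF that] h_def target_simps by (simp add: numeral_eq_Suc algebra_simps)
  ultimately show ?thesis
    unfolding isometric_def iso_def bij_betw_def
    by (intro bexI[of _ h]) (auto simp: sublattice_on_def)
qed

theorem orth_compl_D6_isometric:
  assumes odd: "odd_lattice G"
    and isom: "isometric (sublattice_on G (saturation G A)) (rescale (- 1) (D_lattice 6 0))"
  shows "isometric (sublattice_on G (orth_compl G (saturation G A)))
    (direct_sum (rescale 2 (Z_lattice 2 0)) (rescale (- 1) (Z_lattice 4 0)))"
proof -
  define D where "D = saturation G A"
  have DG: "x \<in> carrier G" if "x \<in> D" for x using that saturation_carrier by (simp add: D_def)
  obtain \<psi> where \<psi>: "\<psi> \<in> iso (sublattice_on G D) (rescale (- 1) (D_lattice 6 0))"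
    "\<And>x y. x \<in> D \<Longrightarrow> y \<in> D \<Longrightarrow> bform G x y = - (\<Sum>i<6. \<psi> x i * \<psi> y i)"
    using isom unfolding isometric_def D_def[symmetric] by (auto simp: sublattice_on_def D6_simps)
  have hom: "\<psi> (x \<otimes> y) = (\<lambda>i. \<psi> x i + \<psi> y i)" if "x \<in> D" "y \<in> D" for x y
    using \<psi>(1) that by (simp add: iso_def hom_def sublattice_on_def D6_simps)
  have bij: "bij_betw \<psi> D D6_vectors"
    using \<psi>(1) by (simp add: iso_def sublattice_on_def D6_simps D6_vectors_def)
  have \<psi>D: "\<psi> x \<in> D6_vectors" if "x \<in> D" for x using bij that by (auto simp: bij_betw_def)
  define \<rho> where "\<rho> = inv_into D \<psi>"
  have \<rho>: "\<rho> v \<in> D" "\<psi> (\<rho> v) = v" if "v \<in> D6_vectors" for v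
    using bij that unfolding \<rho>_def by (auto simp: bij_betw_def inv_into_into f_inv_into_f)
  have \<rho>\<psi>: "\<rho> (\<psi> x) = x" if "x \<in> D" for x
    using bij that unfolding \<rho>_def by (simp add: bij_betw_def)
  \<comment> \<open>Closure under products must be known before additivity of \<psi> passes to its
    inverse \<rho>.\<close>
  have D_mult: "x \<otimes> y \<in> D" if "x \<in> D" "y \<in> D" for x y
    unfolding D_def
  proof (rule saturation_mult[of A \<psi>])
    show "inj_on \<psi> (saturation G A)" using bij by (simp add: bij_betw_def D_def)
    show "\<exists>z\<in>saturation G A. \<psi> z = (\<lambda>i. \<psi> x i - \<psi> y i)"
      if "x \<in> saturation G A" "y \<in> saturation G A" for x y
    proof -
      have "(\<lambda>i. \<psi> x i - \<psi> y i) \<in> D6_vectors"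
        using that by (intro D6_vectors_diff \<psi>D) (simp_all add: D_def)
      from \<rho>[OF this] show ?thesis unfolding D_def by blast
    qed
  qed (use hom that in \<open>auto simp: D_def\<close>)
  have \<rho>_add: "\<rho> (\<lambda>i. v i + w i) = \<rho> v \<otimes> \<rho> w" if "v \<in> D6_vectors" "w \<in> D6_vectors" for v w
    using hom[OF \<rho>(1) \<rho>(1)] \<rho>(2) \<rho>\<psi>[OF D_mult[OF \<rho>(1) \<rho>(1)]] that by simp
  define \<epsilon> where "\<epsilon> v = emb (\<rho> v)" for v
  have \<epsilon>_add: "\<epsilon> (\<lambda>i. v i + w i) = \<epsilon> v + \<epsilon> w" if "v \<in> D6_vectors" "w \<in> D6_vectors" for v w
    using \<rho>_add[OF that] emb_mult DG \<rho>(1) that by (simp add: \<epsilon>_def)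
  have \<epsilon>_form: "emb_form (\<epsilon> v) (\<epsilon> w) = - of_int (\<Sum>i<6. v i * w i)" if "v \<in> D6_vectors" "w \<in> D6_vectors" for v w
    using emb_form_emb[OF DG DG] \<rho> \<psi>(2) that by (simp add: \<epsilon>_def)
  define u where "u i = (\<lambda>j. 2 * unit_vec i j)" for i
  have uD: "u i \<in> D6_vectors" if "i < 6" for i
    using that by (auto intro!: D6_vectors_even simp: u_def unit_vec_def)
  define e where "e i = (1/2) *\<^sub>R \<epsilon> (u i)" for i
  have e2: "2 *\<^sub>R e i = \<epsilon> (u i)" for i by (simp add: e_def)
  obtain P Q :: "(real ^ 12) set" where PQ: "subspace P" "dim P = 2" "\<And>z. z \<in> P \<Longrightarrow> z \<noteq> 0 \<Longrightarrow> emb_form z z > 0"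
    "subspace Q" "dim Q = 10" "\<And>z. z \<in> Q \<Longrightarrow> z \<noteq> 0 \<Longrightarrow> emb_form z z < 0"
    by (rule emb_definite, rule that)
  have "D6_sublattice emb_form (emb ` carrier G) P Q e"
  proof (unfold_locales)
    show "DIM(real ^ 12) = 12" by simp
    show "unimodular_in (emb ` carrier G)" by (rule emb_unimodular)
    show "span (emb ` carrier G) = UNIV" by (rule emb_span)
    obtain x where x: "x \<in> carrier G" "odd (bform G x x)" using odd by (auto simp: odd_lattice_def)
    have "emb_form (emb x) (emb x) / 2 \<notin> \<int>"
      unfolding emb_form_emb[OF x(1) x(1)] half_of_int by (rule x(2))
    then show "\<exists>x\<in>emb ` carrier G. emb_form x x / 2 \<notin> \<int>" using x(1) by blast
    show "subspace P" "dim P = 2" "subspace Q" "dim Q = 10" by fact+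
    show "emb_form z z > 0" if "z \<in> P" "z \<noteq> 0" for z using PQ that by blast
    show "emb_form z z < 0" if "z \<in> Q" "z \<noteq> 0" for z using PQ that by blast
    show "emb_form (e i) (e j) = (if i = j then - 1 else 0)" if "i < 6" "j < 6" for i j
    proof -
      have "(\<Sum>k<6. u i k * u j k) = (\<Sum>k<6. if k = i then (if i = j then 4 else 0) else 0)"
        by (intro sum.cong) (auto simp: u_def unit_vec_def)
      also have "\<dots> = (if i = j then 4 else 0)" using that by simp
      finally have "emb_form (\<epsilon> (u i)) (\<epsilon> (u j)) = - of_int (if i = j then 4 else 0)"
        using \<epsilon>_form[OF uD[OF that(1)] uD[OF that(2)]] by (simp only:)
      then show ?thesis by (simp add: e_def)
    qed
    show "e i - e 0 \<in> emb ` carrier G" if i: "i < 6" for i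
    proof -
      define w where "w = (\<lambda>j. unit_vec i j - unit_vec 0 j)"
      have "(\<Sum>j<6. w j) = (\<Sum>j<6. if j = i then 1 else 0) - (\<Sum>j<6. if j = (0::nat) then 1 else 0)"
        by (simp add: w_def unit_vec_def sum_subtractf)
      also have "\<dots> = 0" using i by simp
      finally have w: "w \<in> D6_vectors" using i by (auto simp: D6_vectors_def w_def unit_vec_def)
      have "u i = (\<lambda>j. u 0 j + (w j + w j))" by (auto simp: u_def w_def)
      then have "\<epsilon> (u i) = \<epsilon> (u 0) + (\<epsilon> w + \<epsilon> w)"
        using \<epsilon>_add[OF uD[of 0] D6_vectors_add[OF w w]] \<epsilon>_add[OF w w] by simp
      then have "e i - e 0 = \<epsilon> w" by (simp add: e_def scaleR_right_distrib scaleR_half_double)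
      then show ?thesis using DG[OF \<rho>(1)[OF w]] by (simp add: \<epsilon>_def)
    qed
    show "2 *\<^sub>R e 0 \<in> emb ` carrier G"
      unfolding e2 \<epsilon>_def using DG[OF \<rho>(1)[OF uD[of 0]]] by simp
    \<comment> \<open>Otherwise \<open>e 0\<close> comes from some \<open>y\<close> whose double
      lies in the saturation. Then so does \<open>y\<close>, but its image under \<psi> is a unit
      vector, whose coordinate sum is odd.\<close>
    show "e 0 \<notin> emb ` carrier G"
    proof
      assume "e 0 \<in> emb ` carrier G"
      then obtain y where y: "y \<in> carrier G" "e 0 = emb y" by blast
      have u0: "u 0 \<in> D6_vectors" by (rule uD) simp
      have "emb (y [^] (2::int)) = emb (\<rho> (u 0))"
        using emb_int_pow[OF y(1), of 2] y(2) e2[of 0] by (simp add: \<epsilon>_def)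
      then have y2: "y [^] (2::int) = \<rho> (u 0)"
        using emb_inj y(1) DG[OF \<rho>(1)[OF u0]] by (meson inj_onD int_pow_closed)
      then have yD: "y \<in> D"
        using saturation_root[OF y(1), of 2 A] \<rho>(1)[OF u0] by (simp add: D_def)
      have "y \<otimes> y = \<rho> (u 0)" using y2 int_pow_mult[OF y(1), of 1 1] y(1) by simp
      then have "(\<lambda>i. \<psi> y i + \<psi> y i) = u 0" using hom[OF yD yD] \<rho>(2)[OF u0] by simp
      then have "\<psi> y i = (if i = 0 then 1 else 0)" for i
        by (auto simp: fun_eq_iff u_def unit_vec_def split: if_splits)
      then have "(\<Sum>i<6. \<psi> y i) = 1" by simp
      then show False using \<psi>D[OF yD] by (simp add: D6_vectors_def)
    qed
  qed
  then interpret D6_sublattice emb_form "emb ` carrier G" P Q e .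
  have "{v \<in> emb ` carrier G. \<forall>i<6. emb_form v (e i) = 0} = emb ` orth_compl G D"
  proof -
    have "(\<forall>i<6. emb_form (emb x) (e i) = 0) \<longleftrightarrow> x \<in> orth_compl G D" if x: "x \<in> carrier G" for x
    proof -
      have ei: "emb_form (emb x) (e i) = of_int (bform G x (\<rho> (u i))) / 2" if "i < 6" for i
        using emb_form_emb[OF x DG[OF \<rho>(1)[OF uD[OF that]]]] by (simp add: e_def \<epsilon>_def)
      have "bform G x y = 0" if *: "\<forall>i<6. emb_form (emb x) (e i) = 0" and y: "y \<in> D" for y
      proof -
        have "bform G x (\<rho> (\<psi> y)) = 0"
        proof (rule D6_functional_zero[of "\<lambda>v. bform G x (\<rho> v)"])
          show "bform G x (\<rho> (\<lambda>i. v i + w i)) = bform G x (\<rho> v) + bform G x (\<rho> w)"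
            if "v \<in> D6_vectors" "w \<in> D6_vectors" for v w
            using \<rho>_add[OF that] bform_mult_right x DG \<rho>(1) that by simp
          show "bform G x (\<rho> (\<lambda>j. 2 * unit_vec n j)) = 0" if "n < 6" for n
            using * ei[OF that] that by (simp add: u_def)
        qed (rule \<psi>D[OF y])
        then show ?thesis using \<rho>\<psi>[OF y] by simp
      qed
      then show ?thesis
        using x ei \<rho>(1)[OF uD] by (auto simp: orth_compl_def)
    qed
    then show ?thesis by (auto simp: orth_compl_def)
  qed
  then obtain v1 v2 w1 w2 w3 w4 where tf: "target_frame (emb ` orth_compl G D) v1 v2 w1 w2 w3 w4"
    using target_frame_exists by auto
  have "D \<subseteq> carrier G" using DG by blast
  from target_frame_isometric[OF refl this tf] show ?thesis by (simp add: D_def)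
qed

end

lemma orth_compl_D6_lattice:
  fixes H :: "'c zlattice"
  assumes "is_lattice H" and "unimodular H" and "odd_lattice H" and "has_signature H 2 10"
    and "isometric (sublattice_on H (saturation H A)) (rescale (- 1) (D_lattice 6 0))"
  shows "isometric (sublattice_on H (orth_compl H (saturation H A)))
    (direct_sum (rescale 2 (Z_lattice 2 0)) (rescale (- 1) (Z_lattice 4 0)))"
proof -
  obtain b :: "nat \<Rightarrow> 'c" where b: "b \<in> {..<12} \<rightarrow> carrier H"
    "\<And>i j. i < 12 \<Longrightarrow> j < 12 \<Longrightarrow> i \<noteq> j \<Longrightarrow> bform H (b i) (b j) = 0"
    "\<And>i. i < 2 \<Longrightarrow> bform H (b i) (b i) > 0"
    "\<And>i. 2 \<le> i \<Longrightarrow> i < 12 \<Longrightarrow> bform H (b i) (b i) < 0"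
    "\<And>x. x \<in> carrier H \<Longrightarrow> \<exists>m::int. m \<noteq> 0 \<and> x [^]\<^bsub>H\<^esub> m \<in> generate H (b ` {..<12})"
    using assms(4) by (auto simp: has_signature_def)
  obtain idx :: "12 \<Rightarrow> nat" where idx: "bij_betw idx UNIV {..<12}"
    using finite_same_card_bij[of "UNIV :: 12 set" "{..<12::nat}"] by auto
  interpret comm_group H using assms(1) by (simp add: is_lattice_def)
  interpret zlattice_2_10 H b idx
    by unfold_locales (use assms(1,2) b idx in \<open>auto simp: is_lattice_def\<close>)
  show ?thesis by (rule orth_compl_D6_isometric[OF assms(3,5)])
qed

theorem proposition3p28:
  fixes X :: "('a, 2) complex_space" and S :: "('b, 2) complex_space"
    and \<sigma> :: "'a \<Rightarrow> 'a" and p :: "'a \<Rightarrow> 'b"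
    and h :: "(nat \<Rightarrow> int) \<Rightarrow> 'b bundle_data set" and g :: "nat \<Rightarrow> complex option \<Rightarrow> 'a"
  assumes "Enriques_cover X \<sigma> p S"
    and "\<forall>k<6. holo_map proj_line X (g k) \<and> holo_embedding proj_line S (p \<circ> g k)"
    and "D16_polarisation S h (\<lambda>k. (p \<circ> g k) ` topspace (top_of proj_line))"
    and "is_lattice (twisted_H2 X \<sigma>)" and "unimodular (twisted_H2 X \<sigma>)"
    and "odd_lattice (twisted_H2 X \<sigma>)" and "has_signature (twisted_H2 X \<sigma>) 2 10"
    and "isometric (sublattice_on (twisted_H2 X \<sigma>) (distinguished_sublattice X \<sigma> g))
           (rescale (- 1) (D_lattice 6 0))"
  shows "isometric (generic_transcendental_lattice X \<sigma> g)
           (direct_sum (rescale 2 (Z_lattice 2 0)) (rescale (- 1) (Z_lattice 4 0))) \<and>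
         (twisted_H11 X \<sigma> = distinguished_sublattice X \<sigma> g \<longrightarrow>
           isometric (transcendental_lattice X \<sigma>)
             (direct_sum (rescale 2 (Z_lattice 2 0)) (rescale (- 1) (Z_lattice 4 0))))"
proof -
  have "isometric (generic_transcendental_lattice X \<sigma> g)
      (direct_sum (rescale 2 (Z_lattice 2 0)) (rescale (- 1) (Z_lattice 4 0)))"
    unfolding generic_transcendental_lattice_def distinguished_sublattice_def
    using assms(8) unfolding distinguished_sublattice_def
    by (rule orth_compl_D6_lattice[OF assms(4-7)])
  \<comment> \<open>Once \<open>twisted_H11\<close> equals the distinguished sublattice, both
    transcendental lattices are the same orthogonal complement.\<close>
  then show ?thesis
    by (simp add: transcendental_lattice_def generic_transcendental_lattice_def)
qed

end
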